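(* Suppose that the size of the ground set is unknown (the tester is only given the binary structure $(q,O_1,O_2)$, where $q\ge|\Gamma|$ is an upper bound on the size), and suppose that $0<\epsilon\le 1/23$. Then the query complexity of any $\epsilon$-tester for the class of cyclic groups, with respect to the Hamming distance or with respect to the edit distance, is $\Omega(q^{1/6})$.
   Context: A magma $(\Gamma,\circ)$ is a finite set $\Gamma$ with a binary operation $\circ\colon\Gamma\times\Gamma\to\Gamma$. Hamming distance: for two magmas $(\Gamma,\circ),(\Gamma,\ast)$ on the same set, $\mathrm{Ham}_\Gamma(\circ,\ast)=|\{(x,y)\in\Gamma\times\Gamma : x\circ y\neq x\ast y\}|$. Edit distance: a table of size $k$ is a function $T\colon\Pi\times\Pi\to\mathbb N$ with $\Pi\subseteq\mathbb N$, $|\Pi|=k$. Allowed operations: exchange (change one value $T(a,b)$ arbitrarily; cost $1$); insert (add a new $a\in\mathbb N\setminus\Pi$ to the domain, setting the $2k+1$ new values arbitrarily; cost $2k+1$); delete (remove some $a\in\Pi$, restricting $T$ to $(\Pi\setminus\{a\})^2$; cost $2k-1$). The edit distance between two tables is the minimum total cost to transform one into the other. A multiplication table for $(\Gamma,\circ)$ is a table $T\colon\Pi\times\Pi\to\mathbb N$ with $|\Pi|=|\Gamma|$ together with a bijection $\sigma\colon\Pi\to\Gamma$ such that $T(a,b)=\sigma^{-1}(\sigma(a)\circ\sigma(b))$ for all $a,b\in\Pi$. The edit distance $\mathrm{edit}((\Gamma,\circ),(\Gamma',\ast))$ between two magmas is the minimum edit distance between $T$ and $T'$ over all multiplication tables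 $T$ of $(\Gamma,\circ)$ and $T'$ of $(\Gamma',\ast)$. For a class $\mathscr C$ of groups, $(\Gamma,\circ)$ is $\delta$-far from $\mathscr C$ w.r.t. the Hamming distance if $\mathrm{Ham}_\Gamma(\circ,\ast)\ge\delta|\Gamma|^2$ for every operation $\ast$ on $\Gamma$ with $(\Gamma,\ast)$ a group in $\mathscr C$; it is $\delta$-far w.r.t. the edit distance if $\mathrm{edit}((\Gamma,\circ),(\Gamma',\ast))\ge\delta|\Gamma|^2$ for every group $(\Gamma',\ast)$ in $\mathscr C$. Binary structure: a binary structure for $(\Gamma,\circ)$ is a triple $(q,O_1,O_2)$ where $q\ge|\Gamma|$ is an integer and there is an injective map $\pi\colon\Gamma\to\Sigma=\{0,1\}^{\lceil\log_2 q\rceil}$ such that the oracle $O_1$ picks $x\in\Gamma$ uniformly at random and outputs $\pi(x)$, and the oracle $O_2$, on strings $z_1,z_2\in\pi(\Gamma)$, outputs $\pi(\pi^{-1}(z_1)\circ\pi^{-1}(z_2))$ (its behaviour on strings outside $\pi(\Gamma)$ is arbitrary). Each oracle call is one query. An $\epsilon$-tester (w.r.t. a given distance) for a class $\mathscr C$ is a randomized algorithm which, given any binary structure for a magma $(\Gamma,\circ)$, outputs PASS with probability at least $2/3$ if $(\Gamma,\circ)$ is a group in $\mathscr C$, and outputs FAIL with probability at least $2/3$ if $(\Gamma,\circ)$ is $\epsilon$-far from $\mathscr C$ with respect to that distance. *)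

theory Defs
  imports "HOL-Probability.Probability" "HOL-Algebra.Elementary_Groups"
begin

text \<open>
  All ground sets are finite, hence up to isomorphism subsets of \<^typ>\<open>nat\<close>; only the values of an
  operation on the ground set matter.  Nonemptiness is needed for uniform sampling.
\<close>

definition magma :: "nat set \<Rightarrow> (nat \<Rightarrow> nat \<Rightarrow> nat) \<Rightarrow> bool" where
  "magma \<Gamma> f \<longleftrightarrow> finite \<Gamma> \<and> \<Gamma> \<noteq> {} \<and> (\<forall>x\<in>\<Gamma>. \<forall>y\<in>\<Gamma>. f x y \<in> \<Gamma>)"

definition group_in :: "(nat monoid \<Rightarrow> bool) \<Rightarrow> nat set \<Rightarrow> (nat \<Rightarrow> nat \<Rightarrow> nat) \<Rightarrow> bool" where
  "group_in \<C> \<Gamma> f \<longleftrightarrow>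
     (\<exists>e. group \<lparr>carrier = \<Gamma>, mult = f, one = e\<rparr> \<and> \<C> \<lparr>carrier = \<Gamma>, mult = f, one = e\<rparr>)"


section \<open>Distances\<close>

definition hamming :: "nat set \<Rightarrow> (nat \<Rightarrow> nat \<Rightarrow> nat) \<Rightarrow> (nat \<Rightarrow> nat \<Rightarrow> nat) \<Rightarrow> nat" where
  "hamming \<Gamma> f g = card {(x, y). x \<in> \<Gamma> \<and> y \<in> \<Gamma> \<and> f x y \<noteq> g x y}"

text \<open>
  A table on \<open>D\<close> is a partial map with domain \<open>D \<times> D\<close>, so that equality of partial maps is equality
  of tables and \<open>D\<close> is determined by the map.
\<close>

type_synonym table = "nat \<times> nat \<rightharpoonup> nat"

definition table_on :: "nat set \<Rightarrow> table \<Rightarrow> bool" where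
  "table_on D T \<longleftrightarrow> finite D \<and> dom T = D \<times> D"

inductive edits :: "table \<Rightarrow> nat \<Rightarrow> table \<Rightarrow> bool" for T :: table where
  none: "edits T 0 T"
| exchange: "\<lbrakk>edits T c T'; table_on D T'; a \<in> D; b \<in> D\<rbrakk>
    \<Longrightarrow> edits T (c + 1) (T'((a, b) \<mapsto> v))"
| insert: "\<lbrakk>edits T c T'; table_on D T'; a \<notin> D; table_on (insert a D) T''; T'' |` (D \<times> D) = T'\<rbrakk>
    \<Longrightarrow> edits T (c + (2 * card D + 1)) T''"
| delete: "\<lbrakk>edits T c T'; table_on D T'; a \<in> D\<rbrakk>
    \<Longrightarrow> edits T (c + (2 * card D - 1)) (T' |` ((D - {a}) \<times> (D - {a})))"

definition table_edit_dist :: "table \<Rightarrow> table \<Rightarrow> nat" where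
  "table_edit_dist T T' = (LEAST c. edits T c T')"

definition mult_table :: "nat set \<Rightarrow> (nat \<Rightarrow> nat \<Rightarrow> nat) \<Rightarrow> table \<Rightarrow> bool" where
  "mult_table \<Gamma> f T \<longleftrightarrow>
     (\<exists>D \<sigma>. table_on D T \<and> card D = card \<Gamma> \<and> bij_betw \<sigma> D \<Gamma> \<and>
       (\<forall>a\<in>D. \<forall>b\<in>D. T (a, b) = Some (the_inv_into D \<sigma> (f (\<sigma> a) (\<sigma> b)))))"

definition edit_dist ::
  "nat set \<Rightarrow> (nat \<Rightarrow> nat \<Rightarrow> nat) \<Rightarrow> nat set \<Rightarrow> (nat \<Rightarrow> nat \<Rightarrow> nat) \<Rightarrow> nat" where
  "edit_dist \<Gamma> f \<Gamma>' g =
     (LEAST d. \<exists>T T'. mult_table \<Gamma> f T \<and> mult_table \<Gamma>' g T' \<and> d = table_edit_dist T T')"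

definition hamming_far ::
  "real \<Rightarrow> (nat monoid \<Rightarrow> bool) \<Rightarrow> nat set \<Rightarrow> (nat \<Rightarrow> nat \<Rightarrow> nat) \<Rightarrow> bool" where
  "hamming_far \<delta> \<C> \<Gamma> f \<longleftrightarrow>
     (\<forall>g. magma \<Gamma> g \<and> group_in \<C> \<Gamma> g \<longrightarrow> real (hamming \<Gamma> f g) \<ge> \<delta> * real (card \<Gamma>) ^ 2)"

definition edit_far ::
  "real \<Rightarrow> (nat monoid \<Rightarrow> bool) \<Rightarrow> nat set \<Rightarrow> (nat \<Rightarrow> nat \<Rightarrow> nat) \<Rightarrow> bool" where
  "edit_far \<delta> \<C> \<Gamma> f \<longleftrightarrow>
     (\<forall>\<Gamma>' g. magma \<Gamma>' g \<and> group_in \<C> \<Gamma>' g \<longrightarrow>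
       real (edit_dist \<Gamma> f \<Gamma>' g) \<ge> \<delta> * real (card \<Gamma>) ^ 2)"


section \<open>Binary structures\<close>

definition bitstrings :: "nat \<Rightarrow> bool list set" where
  "bitstrings q = {z. length z = nat \<lceil>log 2 (real q)\<rceil>}"

definition binary_structure ::
  "nat set \<Rightarrow> (nat \<Rightarrow> nat \<Rightarrow> nat) \<Rightarrow> nat \<Rightarrow> bool list pmf \<Rightarrow>
   (bool list \<Rightarrow> bool list \<Rightarrow> bool list) \<Rightarrow> bool" where
  "binary_structure \<Gamma> f q O\<^sub>1 O\<^sub>2 \<longleftrightarrow>
     card \<Gamma> \<le> q \<and>
     (\<exists>\<pi>. inj_on \<pi> \<Gamma> \<and> \<pi> ` \<Gamma> \<subseteq> bitstrings q \<and>
       O\<^sub>1 = map_pmf \<pi> (pmf_of_set \<Gamma>) \<and>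
       (\<forall>z\<^sub>1\<in>\<pi> ` \<Gamma>. \<forall>z\<^sub>2\<in>\<pi> ` \<Gamma>.
         O\<^sub>2 z\<^sub>1 z\<^sub>2 = \<pi> (f (the_inv_into \<Gamma> \<pi> z\<^sub>1) (the_inv_into \<Gamma> \<pi> z\<^sub>2))))"


section \<open>Randomized query algorithms and testers\<close>

text \<open>
  An algorithm maps the transcript of its queries and their answers to a probability distribution on
  its next action.  Since actions form a countable type and past actions are recorded, this covers
  every use of internal randomness; computability is not demanded.
\<close>

datatype verdict = PASS | FAIL

datatype oracle_query = Sample | Product "bool list" "bool list"

datatype action = Ask oracle_query | Halt verdict

type_synonym transcript = "(oracle_query \<times> bool list) list"

type_synonym algorithm = "transcript \<Rightarrow> action pmf"

datatype config = Running transcript | Halted transcript verdict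

fun answer ::
  "bool list pmf \<Rightarrow> (bool list \<Rightarrow> bool list \<Rightarrow> bool list) \<Rightarrow> oracle_query \<Rightarrow> bool list pmf" where
  "answer O\<^sub>1 O\<^sub>2 Sample = O\<^sub>1"
| "answer O\<^sub>1 O\<^sub>2 (Product z\<^sub>1 z\<^sub>2) = return_pmf (O\<^sub>2 z\<^sub>1 z\<^sub>2)"

fun perform ::
  "bool list pmf \<Rightarrow> (bool list \<Rightarrow> bool list \<Rightarrow> bool list) \<Rightarrow> transcript \<Rightarrow> action \<Rightarrow> config pmf" where
  "perform O\<^sub>1 O\<^sub>2 h (Ask u) = map_pmf (\<lambda>z. Running (h @ [(u, z)])) (answer O\<^sub>1 O\<^sub>2 u)"
| "perform O\<^sub>1 O\<^sub>2 h (Halt v) = return_pmf (Halted h v)"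

fun next_config ::
  "algorithm \<Rightarrow> bool list pmf \<Rightarrow> (bool list \<Rightarrow> bool list \<Rightarrow> bool list) \<Rightarrow> config \<Rightarrow> config pmf" where
  "next_config A O\<^sub>1 O\<^sub>2 (Running h) = bind_pmf (A h) (perform O\<^sub>1 O\<^sub>2 h)"
| "next_config A O\<^sub>1 O\<^sub>2 (Halted h v) = return_pmf (Halted h v)"

primrec run ::
  "algorithm \<Rightarrow> bool list pmf \<Rightarrow> (bool list \<Rightarrow> bool list \<Rightarrow> bool list) \<Rightarrow> nat \<Rightarrow> config pmf" where
  "run A O\<^sub>1 O\<^sub>2 0 = return_pmf (Running [])"
| "run A O\<^sub>1 O\<^sub>2 (Suc n) = bind_pmf (run A O\<^sub>1 O\<^sub>2 n) (next_config A O\<^sub>1 O\<^sub>2)"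

text \<open>
  Halted configurations are absorbing, so the probabilities below increase with \<open>n\<close> and their
  supremum is the probability of ever halting with verdict \<open>v\<close>.
\<close>

definition output_prob ::
  "algorithm \<Rightarrow> bool list pmf \<Rightarrow> (bool list \<Rightarrow> bool list \<Rightarrow> bool list) \<Rightarrow> verdict \<Rightarrow> real" where
  "output_prob A O\<^sub>1 O\<^sub>2 v = (SUP n. measure_pmf.prob (run A O\<^sub>1 O\<^sub>2 n) {Halted h v | h. True})"

fun num_queries :: "config \<Rightarrow> nat" where
  "num_queries (Running h) = length h"
| "num_queries (Halted h v) = length h"

text \<open>
  The algorithm receives the number \<open>q\<close> of the binary structure as its input.  The query complexity
  at \<open>q\<close> is the worst case over all binary structures with this \<open>q\<close> and all executions of positive
  probability; it is \<open>\<infinity>\<close> if there is no bound.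
\<close>

definition query_complexity :: "(nat \<Rightarrow> algorithm) \<Rightarrow> nat \<Rightarrow> enat" where
  "query_complexity A q =
     Sup {enat (num_queries c) | c n \<Gamma> f O\<^sub>1 O\<^sub>2.
       magma \<Gamma> f \<and> binary_structure \<Gamma> f q O\<^sub>1 O\<^sub>2 \<and> c \<in> set_pmf (run (A q) O\<^sub>1 O\<^sub>2 n)}"

text \<open>
  The notion of farness is a parameter, to be instantiated with \<^const>\<open>hamming_far\<close> or
  \<^const>\<open>edit_far\<close>.
\<close>

definition tester ::
  "(real \<Rightarrow> (nat monoid \<Rightarrow> bool) \<Rightarrow> nat set \<Rightarrow> (nat \<Rightarrow> nat \<Rightarrow> nat) \<Rightarrow> bool) \<Rightarrow>
   real \<Rightarrow> (nat monoid \<Rightarrow> bool) \<Rightarrow> (nat \<Rightarrow> algorithm) \<Rightarrow> bool" where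
  "tester far \<epsilon> \<C> A \<longleftrightarrow>
     (\<forall>\<Gamma> f q O\<^sub>1 O\<^sub>2. magma \<Gamma> f \<and> binary_structure \<Gamma> f q O\<^sub>1 O\<^sub>2 \<longrightarrow>
       (group_in \<C> \<Gamma> f \<longrightarrow> output_prob (A q) O\<^sub>1 O\<^sub>2 PASS \<ge> 2 / 3) \<and>
       (far \<epsilon> \<C> \<Gamma> f \<longrightarrow> output_prob (A q) O\<^sub>1 O\<^sub>2 FAIL \<ge> 2 / 3))"

end

theory Submission
  imports Defs "HOL-Algebra.Multiplicative_Group" "HOL-Number_Theory.Cong" "HOL-Real_Asymp.Real_Asymp"
begin

text \<open>
  For a prime \<open>p \<le> \<surd>q\<close> compare the cyclic group \<open>\<int>/p\<^sup>2\<close> with \<open>(\<int>/p)\<^sup>2\<close>, under a uniformly random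
  labelling of the elements by strings.  Everything an algorithm sees is a nonnegative integer
  combination of random elements, with coefficients at most \<open>2\<^sup>k\<close> after \<open>k\<close> queries.  In either group
  two different combinations collide with probability about \<open>1/p\<^sup>2\<close>, unless they agree modulo \<open>p\<close>.
  A nonzero coefficient difference has only \<open>O(k / log q)\<close> prime factors of size \<open>q\<close> to a constant
  power, whereas by Chebyshev's bound there are of the order of \<open>\<surd>q / log q\<close> primes to choose from.
  With \<open>O(k\<^sup>2)\<close> pairs of combinations, \<open>k\<close> queries therefore hit an unlucky prime only with
  probability \<open>O(k\<^sup>3 / \<surd>q)\<close>; otherwise both groups look like the same ideal game, in which every new
  combination receives a fresh random string.  Since only a lower bound on the likelihood of each
  transcript against its ideal likelihood is needed, no coupling is involved.

  The group \<open>(\<int>/p)\<^sup>2\<close> is far from every cyclic group: an edit sequence of cost \<open>c\<close> leaves all but \<open>c\<close>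
  table entries unchanged, so a small edit distance to a cyclic group yields a partial injection into
  that group which is almost a homomorphism.  Self-correction turns it into an injective homomorphism,
  but a cyclic group has at most \<open>p\<close> elements whose order divides \<open>p\<close>.
\<close>

section \<open>A lower bound on the number of primes\<close>

text \<open>A fixed prime would not do: if \<open>p\<close> is known, \<open>p\<close> times a
  sample takes \<open>O(log p)\<close> products and tells the two groups apart. So the order itself
  has to be hidden, and all groups are labelled from one set \<open>\<Sigma>\<close> of
  \<open>N >= q\<close> strings that does not depend on \<open>p\<close>. An algorithm may also
  query strings that it never received. Every index below \<open>N\<close> is therefore read modulo
  \<open>p^2\<close>, so that a guessed string is just one more, almost uniform, variable. On
  average over primes and labellings, each transcript has at least 4/5 of its ideal likelihood. A
  tester outputs FAIL on the cyclic groups, and PASS on the products, with probability at most 1/3.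
  Hence both verdicts have ideal probability at most 5/12, although a halting algorithm must give
  one of them.\<close>

text \<open>
  The entries \<open>L(n, k) = 1 / (Suc n * (n choose k))\<close> of Leibniz' harmonic triangle satisfy
  \<open>L(n, Suc k) = L(n - 1, k) - L(n, k)\<close>.
\<close>

lemma leibniz_triangle_dvd_Lcm:
  assumes "k \<le> n"
  shows "Suc n * (n choose k) dvd Lcm {1..Suc n}"
  using assms
proof (induction k arbitrary: n)
  case 0
  have "Suc n \<in> {1..Suc n}" by simp
  then show ?case by (simp only: binomial_n_0 mult_1_right dvd_Lcm)
next
  case (Suc k)
  then obtain m where n: "n = Suc m" and km: "k \<le> m" by (cases n) auto
  define L where "L = Lcm {1..Suc n}"
  have "Suc m * (m choose k) dvd Lcm {1..Suc m}" using Suc.IH[OF km] .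
  moreover have "Lcm {1..Suc m} dvd L"
    unfolding L_def n by (rule Lcm_subset) auto
  ultimately obtain a where a: "L = Suc m * (m choose k) * a" by (metis dvd_def dvd_trans)
  have "Suc n * (n choose k) dvd L"
    unfolding L_def using Suc.IH[of n] Suc.prems by simp
  then obtain b where b: "L = Suc n * (n choose k) * b" by (auto simp: dvd_def)
  define X where "X = n choose Suc k"
  define Y where "Y = n choose k"
  define Z where "Z = m choose k"
  have e1: "Suc k * X = Suc m * Z"
    unfolding X_def Z_def n using Suc_times_binomial_eq[of m k] by (simp add: mult.commute)
  have e2: "Suc k * X = (n - k) * Y"
    unfolding X_def Y_def using binomial_absorption[of k n] binomial_absorb_comp[of n k]
    by (metis binomial_absorb_comp binomial_absorption diff_Suc_1 diff_Suc_eq_diff_pred n)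
  have nk: "k < n" using n km by simp
  have pos: "Y > 0" unfolding Y_def using nk by simp
  \<comment> \<open>The triangle identity multiplied by \<open>L\<close>: the quotients of
    \<open>L\<close> by \<open>Suc m * Z\<close> and \<open>Suc n * Y\<close> are \<open>a\<close>
    and \<open>b\<close>, so the quotient by \<open>Suc n * X\<close> is \<open>a - b\<close>. The
    factor \<open>Y\<close> avoids division and is cancelled afterwards.\<close>
  have "int Y * int L = int Y * (int (Suc n) * int X * (int a - int b))"
  proof -
    have LY: "int L = int (Suc n) * int Y * int b" by (simp only: b Y_def of_nat_mult)
    have LZ: "int L = int (Suc m) * int Z * int a" by (simp only: a Z_def of_nat_mult)
    have E1: "int (Suc k) * int X = int (Suc m) * int Z" using e1 by (metis of_nat_mult)
    have E2: "int (Suc k) * int X = (int n - int k) * int Y"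
      using e2 nk by (metis of_nat_mult of_nat_diff less_imp_le)
    have S: "int (Suc n) = (int n - int k) + int (Suc k)" by simp
    have "int Y * (int (Suc n) * int X * (int a - int b))
        = int Y * int (Suc n) * int X * int a - int X * int L"
      using LY by (simp add: algebra_simps)
    also have "int Y * int (Suc n) * int X * int a
        = int X * int a * ((int n - int k) * int Y) + int Y * int a * (int (Suc k) * int X)"
      by (subst S) (simp add: algebra_simps)
    also have "\<dots> = int X * int a * (int (Suc m) * int Z) + int Y * int a * (int (Suc m) * int Z)"
      using E1 E2 by simp
    also have "\<dots> = int X * int L + int Y * int L" using LZ by (simp add: algebra_simps)
    finally show ?thesis by (metis add_diff_cancel_left')
  qed
  then have "int L = int (Suc n * X) * (int a - int b)"
    using pos by (metis mult_cancel_left of_nat_0_eq_iff of_nat_mult less_irrefl)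
  then have "int (Suc n * X) dvd int L" by (metis dvd_triv_left)
  then have "Suc n * X dvd L" using int_dvd_int_iff by blast
  then show ?case unfolding X_def L_def .
qed

text \<open>Row \<open>2 * m\<close> of Pascal's triangle sums to \<open>4 ^ m\<close> and its
  central entry is the largest, so \<open>Suc (2 * m)\<close> times that entry is at least
  \<open>4 ^ m\<close>; this product divides the lcm.\<close>

lemma Lcm_upto_ge: "4 ^ m \<le> Lcm {1..Suc (2 * m)}"
proof -
  have "(4::nat) ^ m = (\<Sum>k\<le>2 * m. (2 * m) choose k)"
    by (simp add: choose_row_sum power_mult)
  also have "\<dots> \<le> (\<Sum>k\<le>2 * m. (2 * m) choose m)"
    by (rule sum_mono) (metis binomial_maximum nonzero_mult_div_cancel_left zero_neq_numeral)
  also have "\<dots> = Suc (2 * m) * ((2 * m) choose m)" by simp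
  also have "\<dots> \<le> Lcm {1..Suc (2 * m)}"
  proof (rule dvd_imp_le[OF leibniz_triangle_dvd_Lcm])
    have "Lcm {1..Suc (2 * m)} \<noteq> 0" by (subst Lcm_0_iff) auto
    then show "0 < Lcm {1..Suc (2 * m)}" by (rule neq0_conv[THEN iffD1])
  qed simp
  finally show ?thesis .
qed

text \<open>Each maximal prime power in the lcm already divides a single \<open>j \<le> y\<close>,
  so it is at most \<open>y\<close>; there is one such factor for each prime that occurs.\<close>

lemma Lcm_upto_le: "Lcm {1..y} \<le> y ^ card {p. prime p \<and> p \<le> y}" for y :: nat
proof (cases "y = 0")
  case True
  then have "{p::nat. prime p \<and> p \<le> y} = {}" by (auto dest: prime_gt_0_nat)
  then show ?thesis unfolding True by (simp only: card.empty) simp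
next
  case False
  define L where "L = Lcm {1..y}"
  have L0: "L \<noteq> 0" unfolding L_def by (subst Lcm_0_iff) auto
  have fin: "finite {p::nat. prime p \<and> p \<le> y}" by (rule finite_subset[of _ "{..y}"]) auto
  have *: "p ^ multiplicity p L \<le> y \<and> p \<le> y" if p: "p \<in> prime_factors L" for p
  proof -
    have pr: "prime p" and m0: "multiplicity p L \<noteq> 0"
      using p by (auto simp: prime_factors_multiplicity)
    have nu: "\<not> is_unit p" using pr not_prime_unit by blast
    define e where "e = multiplicity p L"
    have e: "e > 0" using m0 e_def by simp
    have "\<exists>j\<in>{1..y}. p ^ e dvd j"
    \<comment> \<open>If \<open>p ^ e\<close> divided no \<open>j\<close>, then \<open>L / p\<close>
      would still be a common multiple, against the minimality of \<open>L\<close>.\<close>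
    proof (rule ccontr)
      assume no: "\<not> ?thesis"
      obtain r where r: "L = p ^ e * r"
        using multiplicity_dvd[of p L] unfolding e_def by (auto simp: dvd_def)
      have r0: "r > 0" using r L0 by (cases "r = 0") auto
      have "j dvd p ^ (e - 1) * r" if j: "j \<in> {1..y}" for j
      proof -
        have j0: "j \<noteq> 0" using j by simp
        obtain s where s: "j = p ^ multiplicity p j * s" "\<not> p dvd s"
          by (rule multiplicity_decompose'[OF j0 nu]) blast
        have "\<not> p ^ e dvd j" using no j by blast
        then have "multiplicity p j < e" using multiplicity_dvd'[of e p j] by linarith
        then have 1: "p ^ multiplicity p j dvd p ^ (e - 1)" by (intro le_imp_power_dvd) simp
        have "j dvd L" unfolding L_def using j by (rule dvd_Lcm)
        then have "s dvd L" by (subst (asm) s(1)) (rule dvd_mult_right)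
        moreover have "coprime s (p ^ e)"
          using prime_imp_coprime[OF pr s(2)] by (simp add: coprime_commute)
        ultimately have "s dvd r" unfolding r using coprime_dvd_mult_right_iff by blast
        with 1 show ?thesis by (subst s(1)) (rule mult_dvd_mono)
      qed
      then have "L dvd p ^ (e - 1) * r" unfolding L_def by (rule Lcm_least)
      moreover have "p ^ (e - 1) * r > 0" using r0 prime_gt_0_nat[OF pr] by simp
      ultimately have "L \<le> p ^ (e - 1) * r" by (rule dvd_imp_le)
      moreover have "p ^ (e - 1) < p ^ e"
        using e prime_gt_1_nat[OF pr] by (intro power_strict_increasing) auto
      ultimately show False using r r0 by simp
    qed
    then obtain j where j: "j \<in> {1..y}" "p ^ e dvd j" by blast
    then have "p ^ e \<le> y" using dvd_imp_le[of "p ^ e" j] by simp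
    moreover have "p ^ 1 \<le> p ^ e"
      using e prime_ge_1_nat[OF pr] by (intro power_increasing) auto
    ultimately show ?thesis unfolding e_def by simp
  qed
  have sub: "prime_factors L \<subseteq> {p. prime p \<and> p \<le> y}"
    using * by (auto simp: prime_factors_multiplicity)
  have "L = (\<Prod>p\<in>prime_factors L. p ^ multiplicity p L)"
    using L0 prime_factorization_nat by blast
  also have "\<dots> \<le> (\<Prod>p\<in>prime_factors L. y)" by (rule prod_mono) (use * in auto)
  also have "\<dots> = y ^ card (prime_factors L)" by simp
  also have "\<dots> \<le> y ^ card {p. prime p \<and> p \<le> y}"
  proof (rule power_increasing)
    show "card (prime_factors L) \<le> card {p. prime p \<and> p \<le> y}"
      using fin sub by (rule card_mono)
  qed (use False in auto)
  finally show ?thesis unfolding L_def .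
qed

lemma power_card_primes_ge:
  fixes y :: nat
  assumes "y \<ge> 2"
  shows "2 ^ (y - 2) \<le> y ^ card {p. prime p \<and> p \<le> y}"
proof -
  \<comment> \<open>\<open>Suc (2 * m)\<close> is the largest odd number up to \<open>y\<close>; the
    loss by parity is why the exponent is \<open>y - 2\<close>.\<close>
  define m where "m = (y - 1) div 2"
  have "(2::nat) ^ (y - 2) \<le> 2 ^ (2 * m)"
    by (rule power_increasing) (use assms in \<open>auto simp: m_def\<close>)
  also have "\<dots> = 4 ^ m" by (simp add: power_mult)
  also have "\<dots> \<le> Lcm {1..Suc (2 * m)}" by (rule Lcm_upto_ge)
  also have "\<dots> \<le> Lcm {1..y}"
  proof (rule dvd_imp_le[OF Lcm_subset])
    show "{1..Suc (2 * m)} \<subseteq> {1..y}" using assms by (auto simp: m_def)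
    have "Lcm {1..y} \<noteq> 0" by (subst Lcm_0_iff) auto
    then show "0 < Lcm {1..y}" by (rule neq0_conv[THEN iffD1])
  qed
  also have "\<dots> \<le> y ^ card {p. prime p \<and> p \<le> y}" by (rule Lcm_upto_le)
  finally show ?thesis .
qed

text \<open>
  The lower bound on \<open>p\<close> makes \<open>log p\<close> comparable to \<open>log y\<close>, so that few of these primes divide a
  given number.
\<close>

definition big_primes :: "nat \<Rightarrow> nat set" where
  "big_primes y = {p. prime p \<and> p \<le> y \<and> y < p\<^sup>2}"

lemma finite_big_primes: "finite (big_primes y)"
  unfolding big_primes_def by (rule finite_subset[of _ "{..y}"]) auto

text \<open>At most \<open>sqrt y\<close> primes satisfy \<open>p\<^sup>2 \<le> y\<close>. Dropping
  them from the Chebyshev bound costs \<open>sqrt y * log 2 y\<close>, which the factor 2 absorbs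
  for large \<open>y\<close>.\<close>

lemma card_big_primes_ge:
  "\<exists>y\<^sub>0. \<forall>y\<ge>y\<^sub>0. real y \<le> 2 * real (card (big_primes y)) * log 2 (real y)"
proof -
  have "eventually (\<lambda>x::real. x / 2 \<le> x - 2 - sqrt x * log 2 x) at_top" by real_asymp
  then obtain x0 where x0: "\<And>x. x \<ge> x0 \<Longrightarrow> x / 2 \<le> x - 2 - sqrt x * log 2 x"
    by (auto simp: eventually_at_top_linorder)
  have "real y \<le> 2 * real (card (big_primes y)) * log 2 (real y)"
    if y: "y \<ge> max 2 (nat \<lceil>x0\<rceil>)" for y
  proof -
    have y2: "y \<ge> 2" and yx: "real y \<ge> x0" using y by (auto simp: ceiling_le_iff)
    define S where "S = {p. prime p \<and> p \<le> y \<and> p\<^sup>2 \<le> y}"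
    have "{p. prime p \<and> p \<le> y} = S \<union> big_primes y"
      unfolding S_def big_primes_def by auto
    then have "card {p. prime p \<and> p \<le> y} \<le> card S + card (big_primes y)"
      by (metis card_Un_le)
    moreover have "real (card S) \<le> sqrt (real y)"
    proof -
      have "S \<subseteq> {1..nat \<lfloor>sqrt (real y)\<rfloor>}"
      proof
        fix p assume p: "p \<in> S"
        then have "real p \<le> sqrt (real y)"
          unfolding S_def by (intro real_le_rsqrt) (metis (mono_tags, lifting) mem_Collect_eq of_nat_le_iff of_nat_power)
        then show "p \<in> {1..nat \<lfloor>sqrt (real y)\<rfloor>}"
          using p prime_ge_1_nat unfolding S_def by (auto simp: le_nat_floor)
      qed
      then have "card S \<le> card {1..nat \<lfloor>sqrt (real y)\<rfloor>}" by (intro card_mono) auto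
      then have "real (card S) \<le> real (nat \<lfloor>sqrt (real y)\<rfloor>)" by (simp only: of_nat_le_iff card_atLeastAtMost diff_Suc_1 diff_add_inverse2 Suc_eq_plus1)
      also have "\<dots> \<le> sqrt (real y)" by (intro of_nat_floor) simp
      finally show ?thesis .
    qed
    moreover have "real y - 2 \<le> real (card {p. prime p \<and> p \<le> y}) * log 2 (real y)"
    proof -
      have "(2::real) ^ (y - 2) \<le> real y ^ card {p. prime p \<and> p \<le> y}"
        using power_card_primes_ge[OF y2] by (metis of_nat_le_iff of_nat_numeral of_nat_power)
      then have "log 2 (2 ^ (y - 2)) \<le> log 2 (real y ^ card {p. prime p \<and> p \<le> y})"
        using y2 by (intro log_mono) auto
      then show ?thesis using y2 by (simp add: log_nat_power of_nat_diff)
    qed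
    moreover have l0: "log 2 (real y) > 0" using y2 by simp
    ultimately have "real y - 2 \<le> (sqrt (real y) + real (card (big_primes y))) * log 2 (real y)"
      by (smt (verit) mult_right_mono of_nat_add of_nat_le_iff)
    with x0[OF yx] show ?thesis by (simp add: algebra_simps)
  qed
  then show ?thesis by blast
qed

text \<open>The product of the distinct primes dividing \<open>d\<close> divides \<open>d\<close>,
  so it is at most \<open>2 ^ M\<close>; each of these primes exceeds the square root of
  \<open>y\<close>. Comparing the squares gives the bound.\<close>

lemma card_big_prime_divisors:
  fixes d :: int
  assumes "d \<noteq> 0" "\<bar>d\<bar> \<le> 2 ^ M" "y \<ge> 2"
  shows "real (card {p \<in> big_primes y. int p dvd d}) * log 2 (real y) \<le> 2 * real M"
proof -
  define B where "B = {p \<in> big_primes y. int p dvd d}"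
  have fin: "finite B" unfolding B_def using finite_big_primes by simp
  have "(\<Prod>p\<in>B. int p) dvd d"
  proof -
    have "(\<Prod>p\<in>C. int p) dvd d" if "finite C" "C \<subseteq> B" for C
      using that
    proof (induction C rule: finite_induct)
      case (insert p C)
      have "coprime (int p) (\<Prod>p\<in>C. int p)"
      proof (rule prod_coprime_right)
        fix r assume "r \<in> C"
        then have "prime p" "prime r" "p \<noteq> r" using insert by (auto simp: B_def big_primes_def)
        then show "coprime (int p) (int r)" by (simp add: primes_coprime)
      qed
      then show ?case using insert by (auto simp: B_def intro!: divides_mult)
    qed auto
    then show ?thesis using fin by blast
  qed
  then have "\<bar>\<Prod>p\<in>B. int p\<bar> \<le> \<bar>d\<bar>" using dvd_imp_le_int[OF assms(1)] by blast
  then have "(\<Prod>p\<in>B. int p) \<le> 2 ^ M" using assms(2) by linarith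
  then have "int (\<Prod>p\<in>B. p) \<le> int (2 ^ M)" by simp
  then have 1: "(\<Prod>p\<in>B. p) \<le> 2 ^ M" by (rule of_nat_le_iff[THEN iffD1])
  have "y ^ card B = (\<Prod>p\<in>B. y)" by simp
  also have "\<dots> \<le> (\<Prod>p\<in>B. p\<^sup>2)" by (rule prod_mono) (auto simp: B_def big_primes_def)
  also have "\<dots> = (\<Prod>p\<in>B. p)\<^sup>2" by (simp add: prod_power_distrib)
  also have "\<dots> \<le> (2 ^ M)\<^sup>2" using 1 by (rule power_mono) simp
  finally have "y ^ card B \<le> 2 ^ (2 * M)" by (simp add: power_mult[symmetric] mult.commute)
  then have "real (y ^ card B) \<le> real (2 ^ (2 * M))" by (rule of_nat_mono)
  then have "real y ^ card B \<le> 2 ^ (2 * M)" by simp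
  then have "log 2 (real y ^ card B) \<le> log 2 (2 ^ (2 * M))"
    using assms(3) by (intro log_mono) auto
  then show ?thesis using assms unfolding B_def[symmetric] by (simp add: log_nat_power)
qed


section \<open>Edit distance and partial homomorphisms\<close>

lemma finite_table_diff:
  assumes "finite (dom T)" "finite (dom T')"
  shows "finite {t. T t \<noteq> T' t}"
  by (rule finite_subset[of _ "dom T \<union> dom T'"]) (use assms in auto)

lemma edits_imp_finite_dom:
  assumes "edits T c T'" "finite (dom T)"
  shows "finite (dom T')"
  using assms
proof (induction rule: edits.induct)
  case (insert c T' D a T'')
  then show ?case unfolding table_on_def by auto
qed (auto intro: finite_subset)

lemma card_table_diff_trans:
  assumes "finite (dom T)" "finite (dom T')" "finite (dom T'')"
    and "card {t. T t \<noteq> T' t} \<le> c" and "{t. T' t \<noteq> T'' t} \<subseteq> X" "finite X" "card X \<le> d"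
  shows "card {t. T t \<noteq> T'' t} \<le> c + d"
proof -
  have "card {t. T t \<noteq> T'' t} \<le> card ({t. T t \<noteq> T' t} \<union> X)"
    by (rule card_mono) (use assms finite_table_diff in auto)
  also have "\<dots> \<le> card {t. T t \<noteq> T' t} + card X" by (rule card_Un_le)
  finally show ?thesis using assms by linarith
qed

lemma card_square_Diff:
  assumes "finite D" "a \<in> D"
  shows "card (D \<times> D - (D - {a}) \<times> (D - {a})) \<le> 2 * card D - 1"
proof -
  obtain k where k: "card D = Suc k" using assms by (cases "card D") auto
  have "card (D \<times> D - (D - {a}) \<times> (D - {a}))
      = card (D \<times> D) - card ((D - {a}) \<times> (D - {a}))"
    using assms by (intro card_Diff_subset) auto
  then show ?thesis using assms k by (simp add: card_cartesian_product)
qed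

text \<open>Each operation costs at least the number of entries it changes, where an entry present
  in only one table counts as changed: inserting or deleting a label affects one row and one
  column.\<close>

lemma edits_ge_card_diff:
  assumes "edits T c T'" "finite (dom T)"
  shows "card {t. T t \<noteq> T' t} \<le> c"
  using assms
proof (induction rule: edits.induct)
  case none
  then show ?case by simp
next
  case (exchange c T' D a b v)
  then have "finite (dom T')" using edits_imp_finite_dom by blast
  then show ?case
    using exchange by (intro card_table_diff_trans[of T T' "T'((a, b) \<mapsto> v)" c "{(a, b)}"])
      (simp_all only: dom_fun_upd, auto split: if_splits)
next
  case (insert c T' D a T'')
  then have f: "finite (dom T')" "finite (dom T'')" "finite D" "a \<notin> D"
    using edits_imp_finite_dom by (auto simp: table_on_def)
  have T': "dom T' = D \<times> D" and T'': "dom T'' = (insert a D) \<times> (insert a D)"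
    using insert by (auto simp: table_on_def)
  let ?D = "Set.insert a D"
  show ?case
  proof (rule card_table_diff_trans[of T T' _ c "?D \<times> ?D - (?D - {a}) \<times> (?D - {a})"])
    show "{t. T' t \<noteq> T'' t} \<subseteq> ?D \<times> ?D - (?D - {a}) \<times> (?D - {a})"
    proof
      fix t assume "t \<in> {t. T' t \<noteq> T'' t}"
      then have ne: "T' t \<noteq> T'' t" by simp
      have "t \<notin> D \<times> D" using ne insert(5) by (metis restrict_in)
      moreover have "t \<in> dom T'' \<or> t \<in> dom T'" using ne by (metis domIff)
      ultimately show "t \<in> ?D \<times> ?D - (?D - {a}) \<times> (?D - {a})"
        using T' T'' f(4) by auto
    qed
    show "card (?D \<times> ?D - (?D - {a}) \<times> (?D - {a})) \<le> 2 * card D + 1"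
      using card_square_Diff[of ?D a] f by simp
  qed (use insert f in auto)
next
  case (delete c T' D a)
  then have f: "finite (dom T')" "finite D" "dom T' = D \<times> D"
    using edits_imp_finite_dom by (auto simp: table_on_def)
  let ?T = "T' |` ((D - {a}) \<times> (D - {a}))"
  show ?case
  proof (rule card_table_diff_trans[of T T' _ c "D \<times> D - (D - {a}) \<times> (D - {a})"])
    show "{t. T' t \<noteq> ?T t} \<subseteq> D \<times> D - (D - {a}) \<times> (D - {a})"
      using f by (auto simp: restrict_map_def split: if_splits)
    show "card (D \<times> D - (D - {a}) \<times> (D - {a})) \<le> 2 * card D - 1"
      using f(2) delete.hyps(3) by (rule card_square_Diff)
  qed (use delete f in auto)
qed

lemma table_on_restrict:
  assumes "table_on D T" "E \<subseteq> D"
  shows "table_on E (T |` (E \<times> E))"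
  using assms by (auto simp: table_on_def finite_subset)

lemma table_on_restrict_self: "table_on D T \<Longrightarrow> T |` (D \<times> D) = T"
  by (rule ext) (metis domIff restrict_map_def table_on_def)

text \<open>Delete all labels of \<open>D\<close>, then insert those of \<open>D'\<close>. This
  makes the \<open>LEAST\<close> in \<open>table_edit_dist\<close> an attained minimum.\<close>

lemma edits_exist:
  assumes T: "table_on D T" and T': "table_on D' T'"
  shows "\<exists>c. edits T c T'"
proof -
  have *: "\<exists>c. edits T c (T |` ((D - X) \<times> (D - X)))" if "finite X" "X \<subseteq> D" for X
    using that
  proof (induction X rule: finite_induct)
    case empty
    have "T |` (D \<times> D) = T" using T by (rule table_on_restrict_self)
    then show ?case using edits.none[of T] by auto
  next
    case (insert x X)
    let ?E = "D - X"
    obtain c where "edits T c (T |` (?E \<times> ?E))" using insert by auto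
    from edits.delete[OF this table_on_restrict[OF T], of x]
    have "edits T (c + (2 * card ?E - 1)) (T |` (?E \<times> ?E) |` ((?E - {x}) \<times> (?E - {x})))"
      using insert by auto
    moreover have "T |` (?E \<times> ?E) |` ((?E - {x}) \<times> (?E - {x}))
        = T |` ((D - Set.insert x X) \<times> (D - Set.insert x X))"
      unfolding Map.restrict_restrict by (rule arg_cong[where f = "\<lambda>S. T |` S"]) auto
    ultimately show ?case by metis
  qed
  have fin: "finite D" "finite D'" using T T' by (auto simp: table_on_def)
  obtain c0 where c0: "edits T c0 (Map.empty)" using *[of D] fin by auto
  have "\<exists>c. edits T c (T' |` (E \<times> E))" if "finite E" "E \<subseteq> D'" for E
    using that
  proof (induction E rule: finite_induct)
    case empty
    then show ?case using c0 by auto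
  next
    case (insert x E)
    obtain c where c: "edits T c (T' |` (E \<times> E))" using insert by auto
    have "edits T (c + (2 * card E + 1)) (T' |` (Set.insert x E \<times> Set.insert x E))"
    proof (rule edits.insert[OF c])
      show "table_on E (T' |` (E \<times> E))"
        and "table_on (Set.insert x E) (T' |` (Set.insert x E \<times> Set.insert x E))"
        using table_on_restrict[OF T'] insert by blast+
      show "T' |` (Set.insert x E \<times> Set.insert x E) |` (E \<times> E) = T' |` (E \<times> E)"
        unfolding Map.restrict_restrict by (rule arg_cong[where f = "\<lambda>S. T' |` S"]) auto
    qed (use insert in auto)
    then show ?case by blast
  qed
  from this[OF fin(2)] obtain c where "edits T c (T' |` (D' \<times> D'))" by auto
  moreover have "T' |` (D' \<times> D') = T'" using T' by (rule table_on_restrict_self)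
  ultimately show ?thesis by metis
qed

lemma table_edit_dist_ge:
  assumes "table_on D T" "table_on D' T'"
  shows "card {t. T t \<noteq> T' t} \<le> table_edit_dist T T'"
proof -
  have "edits T (table_edit_dist T T') T'"
    unfolding table_edit_dist_def using edits_exist[OF assms] by (rule LeastI_ex)
  moreover have "finite (dom T)" using assms by (auto simp: table_on_def)
  ultimately show ?thesis by (rule edits_ge_card_diff)
qed

text \<open>The multiplication table whose labels are the elements themselves. It shows that
  \<open>edit_dist\<close> minimises over a nonempty set, and it turns Hamming distance into a count
  of differing table entries.\<close>

definition id_table :: "nat set \<Rightarrow> (nat \<Rightarrow> nat \<Rightarrow> nat) \<Rightarrow> table" where
  "id_table \<Gamma> f = (\<lambda>(x, y). if x \<in> \<Gamma> \<and> y \<in> \<Gamma> then Some (f x y) else None)"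

lemma mult_table_id_table:
  assumes "magma \<Gamma> f"
  shows "mult_table \<Gamma> f (id_table \<Gamma> f)"
proof -
  have "dom (id_table \<Gamma> f) = \<Gamma> \<times> \<Gamma>" by (auto simp: id_table_def split: if_splits)
  moreover have "the_inv_into \<Gamma> id (f x y) = f x y" if "x \<in> \<Gamma>" "y \<in> \<Gamma>" for x y
    using the_inv_into_f_f[of id \<Gamma> "f x y"] assms that by (auto simp: magma_def)
  ultimately show ?thesis
    using assms unfolding mult_table_def table_on_def magma_def
    by (intro exI[of _ \<Gamma>] exI[of _ id]) (auto simp: id_table_def)
qed

text \<open>A common strengthening of both notions of farness: differing entries bound the edit cost
  from below, and for tables of type \<open>id_table\<close> on one ground set they are the Hamming
  distance. Farness thus has to be proved only once.\<close>

definition table_far :: "real \<Rightarrow> nat set \<Rightarrow> (nat \<Rightarrow> nat \<Rightarrow> nat) \<Rightarrow> bool" where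
  "table_far \<delta> \<Gamma> f \<longleftrightarrow> (\<forall>\<Gamma>' g T T'. magma \<Gamma>' g \<longrightarrow> group_in cyclic_group \<Gamma>' g \<longrightarrow>
     mult_table \<Gamma> f T \<longrightarrow> mult_table \<Gamma>' g T' \<longrightarrow>
     \<delta> * real (card \<Gamma>) ^ 2 \<le> real (card {t. T t \<noteq> T' t}))"

lemma table_far_imp_edit_far:
  assumes "table_far \<delta> \<Gamma> f" "magma \<Gamma> f"
  shows "edit_far \<delta> cyclic_group \<Gamma> f"
  unfolding edit_far_def
proof (intro allI impI, elim conjE)
  fix \<Gamma>' g assume g: "magma \<Gamma>' g" "group_in cyclic_group \<Gamma>' g"
  have "\<exists>d T T'. mult_table \<Gamma> f T \<and> mult_table \<Gamma>' g T' \<and> d = table_edit_dist T T'"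
    using mult_table_id_table assms g by blast
  then have "\<exists>T T'. mult_table \<Gamma> f T \<and> mult_table \<Gamma>' g T' \<and> edit_dist \<Gamma> f \<Gamma>' g = table_edit_dist T T'"
    unfolding edit_dist_def by (rule LeastI_ex)
  then obtain T T' where T: "mult_table \<Gamma> f T" "mult_table \<Gamma>' g T'"
      "edit_dist \<Gamma> f \<Gamma>' g = table_edit_dist T T'" by blast
  then have "card {t. T t \<noteq> T' t} \<le> edit_dist \<Gamma> f \<Gamma>' g"
    using table_edit_dist_ge by (metis mult_table_def)
  then show "\<delta> * real (card \<Gamma>) ^ 2 \<le> real (edit_dist \<Gamma> f \<Gamma>' g)"
    using assms(1) g T unfolding table_far_def by (meson of_nat_mono order_trans)
qed

lemma table_far_imp_hamming_far:
  assumes "table_far \<delta> \<Gamma> f" "magma \<Gamma> f"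
  shows "hamming_far \<delta> cyclic_group \<Gamma> f"
  unfolding hamming_far_def
proof (intro allI impI, elim conjE)
  fix g assume g: "magma \<Gamma> g" "group_in cyclic_group \<Gamma> g"
  have "{t. id_table \<Gamma> f t \<noteq> id_table \<Gamma> g t} = {(x, y). x \<in> \<Gamma> \<and> y \<in> \<Gamma> \<and> f x y \<noteq> g x y}"
    by (auto simp: id_table_def split: if_splits)
  moreover have "\<delta> * real (card \<Gamma>) ^ 2 \<le> real (card {t. id_table \<Gamma> f t \<noteq> id_table \<Gamma> g t})"
    using assms g mult_table_id_table unfolding table_far_def by blast
  ultimately show "\<delta> * real (card \<Gamma>) ^ 2 \<le> real (hamming \<Gamma> f g)"
    by (simp add: hamming_def)
qed

text \<open>
  The value \<open>h (f x y) - h y\<close> is the same for most \<open>y\<close>, because both \<open>h (f x y) + h z\<close> and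
  \<open>h (f x z) + h y\<close> usually equal \<open>h (f (f x y) z)\<close>; the popular value is the homomorphism.
\<close>

lemma almost_hom_imp_embedding:
  fixes h :: "nat \<Rightarrow> int" and m :: int
  assumes fin: "finite G" and SG: "S \<subseteq> G"
    and closed: "\<And>x y. x \<in> G \<Longrightarrow> y \<in> G \<Longrightarrow> f x y \<in> G"
    and assoc: "\<And>x y z. x \<in> G \<Longrightarrow> y \<in> G \<Longrightarrow> z \<in> G \<Longrightarrow> f (f x y) z = f x (f y z)"
    and comm: "\<And>x y. x \<in> G \<Longrightarrow> y \<in> G \<Longrightarrow> f x y = f y x"
    and cancel: "\<And>x y z. x \<in> G \<Longrightarrow> y \<in> G \<Longrightarrow> z \<in> G \<Longrightarrow> f x y = f x z \<Longrightarrow> y = z"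
    and inj: "\<And>x y. x \<in> S \<Longrightarrow> y \<in> S \<Longrightarrow> [h x = h y] (mod m) \<Longrightarrow> x = y"
    and bad: "23 * card {(x, y) \<in> G \<times> G.
      \<not> (x \<in> S \<and> y \<in> S \<and> f x y \<in> S \<and> [h (f x y) = h x + h y] (mod m))} < card G ^ 2"
  shows "\<exists>\<phi>. (\<forall>x\<in>G. \<forall>y\<in>G. [\<phi> (f x y) = \<phi> x + \<phi> y] (mod m)) \<and>
             (\<forall>x\<in>G. \<forall>y\<in>G. [\<phi> x = \<phi> y] (mod m) \<longrightarrow> x = y)"
proof -
  define good where "good x y \<longleftrightarrow> x \<in> S \<and> y \<in> S \<and> f x y \<in> S \<and> [h (f x y) = h x + h y] (mod m)" for x y
  define B where "B = {(x, y) \<in> G \<times> G. \<not> good x y}"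
  have finB: "finite B" unfolding B_def by (rule finite_subset[of _ "G \<times> G"]) (use fin in auto)
  have B: "23 * card B < card G ^ 2" using bad unfolding B_def good_def by simp
  define n where "n = card G"
  have n0: "n > 0" using B n_def by (cases n) auto
  define V where "V x v = {y \<in> G. \<not> (y \<in> S \<and> f x y \<in> S \<and> [h (f x y) - h y = v] (mod m))}" for x v
  \<comment> \<open>Double counting: if every value failed for at least \<open>2 * n / 23\<close> of
    the \<open>y\<close>, then the value read off at each \<open>z\<close> would produce that many
    bad pairs \<open>(z, y)\<close>, in total \<open>2 * n * n / 23\<close>. But each of the two
    conditions in \<open>C\<close> fails for at most \<open>card B\<close> pairs.\<close>
  have "\<exists>v. 23 * card (V x v) < 2 * n" if x: "x \<in> G" for x
  proof (rule ccontr)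
    assume no: "\<not> ?thesis"
    define C where "C = {(z, y) \<in> G \<times> G. \<not> (good (f x y) z \<and> good (f x z) y)}"
    define C1 where "C1 = {(z, y) \<in> G \<times> G. \<not> good (f x y) z}"
    define C2 where "C2 = {(z, y) \<in> G \<times> G. \<not> good (f x z) y}"
    have "card C1 \<le> card B"
      by (rule card_inj_on_le[of "\<lambda>(z, y). (f x y, z)"])
        (use finB cancel[OF x] x closed in \<open>auto simp: inj_on_def C1_def B_def\<close>)
    moreover have "card C2 \<le> card B"
      by (rule card_inj_on_le[of "\<lambda>(z, y). (f x z, y)"])
        (use finB cancel[OF x] x closed in \<open>auto simp: inj_on_def C2_def B_def\<close>)
    moreover have "C = C1 \<union> C2" unfolding C_def C1_def C2_def by auto
    ultimately have "card C \<le> 2 * card B" using card_Un_le[of C1 C2] by simp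
    moreover have "23 * card C \<ge> 2 * n * n"
    proof -
      have "C = Sigma G (\<lambda>z. {y \<in> G. (z, y) \<in> C})" unfolding C_def by auto
      then have "card C = (\<Sum>z\<in>G. card {y \<in> G. (z, y) \<in> C})"
        using card_SigmaI[OF fin, of "\<lambda>z. {y \<in> G. (z, y) \<in> C}"] fin by simp
      moreover have "2 * n \<le> 23 * card {y \<in> G. (z, y) \<in> C}" if z: "z \<in> G" for z
      proof -
        have "V x (h (f x z) - h z) \<subseteq> {y \<in> G. (z, y) \<in> C}"
        proof
          fix y assume y: "y \<in> V x (h (f x z) - h z)"
          then have yG: "y \<in> G" by (simp add: V_def)
          have "\<not> (good (f x y) z \<and> good (f x z) y)"
          proof
            assume g: "good (f x y) z \<and> good (f x z) y"
            have e: "f (f x y) z = f (f x z) y"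
              using assoc comm x yG z by metis
            have "[h (f x y) + h z = h (f x z) + h y] (mod m)"
              using g e unfolding good_def by (metis cong_sym cong_trans)
            then have "[h (f x y) - h y = h (f x z) - h z] (mod m)"
              by (simp add: cong_iff_dvd_diff algebra_simps)
            then show False using g y unfolding V_def good_def by auto
          qed
          then show "y \<in> {y \<in> G. (z, y) \<in> C}" using yG z by (auto simp: C_def)
        qed
        then have "card (V x (h (f x z) - h z)) \<le> card {y \<in> G. (z, y) \<in> C}"
          using fin by (intro card_mono) auto
        then show ?thesis using no by (meson le_trans mult_le_mono2 not_less)
      qed
      ultimately have "23 * card C \<ge> (\<Sum>z\<in>G. 2 * n)"
        by (simp only: sum_distrib_left) (rule sum_mono)
      then show ?thesis by (simp add: n_def ac_simps)
    qed
    ultimately show False using B n_def by (simp add: power2_eq_square)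
  qed
  then obtain \<phi> where \<phi>: "\<And>x. x \<in> G \<Longrightarrow> 23 * card (V x (\<phi> x)) < 2 * n" by metis
  have finV: "finite (V x v)" for x v unfolding V_def using fin by simp
  \<comment> \<open>Test \<open>x\<close> at \<open>f y z\<close>, and both \<open>y\<close> and
    \<open>f x y\<close> at \<open>z\<close>. Each test fails for fewer than
    \<open>2 * n / 23\<close> of the \<open>z\<close>, so some \<open>z\<close> passes all three and
    the values telescope.\<close>
  have "[\<phi> (f x y) = \<phi> x + \<phi> y] (mod m)" if x: "x \<in> G" and y: "y \<in> G" for x y
  proof -
    define U where "U = {z \<in> G. f y z \<in> V x (\<phi> x)}"
    have "card U \<le> card (V x (\<phi> x))"
      by (rule card_inj_on_le[of "f y"]) (use finV cancel[OF y] in \<open>auto simp: inj_on_def U_def\<close>)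
    moreover have "card (U \<union> V y (\<phi> y) \<union> V (f x y) (\<phi> (f x y)))
        \<le> card U + card (V y (\<phi> y)) + card (V (f x y) (\<phi> (f x y)))"
      by (metis add_right_mono card_Un_le order_trans)
    ultimately have "23 * card (U \<union> V y (\<phi> y) \<union> V (f x y) (\<phi> (f x y))) < 23 * n"
      using \<phi>[OF x] \<phi>[OF y] \<phi>[OF closed[OF x y]] n0 by linarith
    then have "\<not> G \<subseteq> U \<union> V y (\<phi> y) \<union> V (f x y) (\<phi> (f x y))"
      using n_def finV U_def fin card_mono[of "U \<union> V y (\<phi> y) \<union> V (f x y) (\<phi> (f x y))" G] by auto
    then obtain z where z: "z \<in> G" "f y z \<notin> V x (\<phi> x)" "z \<notin> V y (\<phi> y)" "z \<notin> V (f x y) (\<phi> (f x y))"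
      unfolding U_def by auto
    have "[h (f x (f y z)) - h (f y z) = \<phi> x] (mod m)" "[h (f y z) - h z = \<phi> y] (mod m)"
      "[h (f x (f y z)) - h z = \<phi> (f x y)] (mod m)"
      using z closed[OF y z(1)] assoc[OF x y z(1)] unfolding V_def by auto
    moreover from cong_add[OF this(1,2)]
    have "[h (f x (f y z)) - h z = \<phi> x + \<phi> y] (mod m)" by simp
    ultimately show ?thesis by (meson cong_sym cong_trans)
  qed
  \<comment> \<open>A \<open>z\<close> good for both \<open>x\<close> and \<open>y\<close> puts
    \<open>f x z\<close> and \<open>f y z\<close> in \<open>S\<close> with congruent images.
    Injectivity is thus needed only on \<open>S\<close>.\<close>
  moreover have "x = y" if x: "x \<in> G" and y: "y \<in> G" and e: "[\<phi> x = \<phi> y] (mod m)" for x y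
  proof -
    have "card (V x (\<phi> x) \<union> V y (\<phi> y)) \<le> card (V x (\<phi> x)) + card (V y (\<phi> y))"
      by (rule card_Un_le)
    then have "card (V x (\<phi> x) \<union> V y (\<phi> y)) < n"
      using \<phi>[OF x] \<phi>[OF y] by linarith
    then have "\<not> G \<subseteq> V x (\<phi> x) \<union> V y (\<phi> y)"
      using n_def finV card_mono[of "V x (\<phi> x) \<union> V y (\<phi> y)" G] by auto
    then obtain z where z: "z \<in> G" "z \<notin> V x (\<phi> x)" "z \<notin> V y (\<phi> y)" by auto
    then have "[h (f x z) - h z = \<phi> x] (mod m)" "[h (f y z) - h z = \<phi> y] (mod m)"
      and S: "f x z \<in> S" "f y z \<in> S"
      unfolding V_def by auto
    then have "[h (f x z) - h z = h (f y z) - h z] (mod m)" using e by (meson cong_sym cong_trans)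
    then have "[h (f x z) = h (f y z)] (mod m)" by (simp add: cong_iff_dvd_diff)
    then have "f x z = f y z" using inj S by blast
    then show ?thesis using comm cancel x y z(1) by metis
  qed
  ultimately show ?thesis by blast
qed

text \<open>
  Both \<open>\<int>/p\<^sup>2\<close> and \<open>(\<int>/p)\<^sup>2\<close> are quotients of \<open>\<int>\<^sup>2\<close> in which multiplication by an integer prime to \<open>p\<close>
  is injective; \<open>K\<close> is the kernel, and an element is coded by its two base-\<open>p\<close> digits.
\<close>

locale pair_group =
  fixes p :: nat and enc :: "int \<Rightarrow> int \<Rightarrow> nat" and K :: "int \<Rightarrow> int \<Rightarrow> bool"
  assumes prime: "prime p"
    and enc_less: "enc i j < p\<^sup>2"
    and enc_digits: "x < p\<^sup>2 \<Longrightarrow> enc (int (x mod p)) (int (x div p)) = x"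
    and enc_eq_iff: "enc i j = enc i' j' \<longleftrightarrow> K (i - i') (j - j')"
    and K_add: "K a b \<Longrightarrow> K c d \<Longrightarrow> K (a + c) (b + d)"
    and K_cancel: "\<not> int p dvd k \<Longrightarrow> K (k * a) (k * b) \<Longrightarrow> K a b"
begin

text \<open>Digits are added without carry; the reduction inside \<open>enc\<close> performs the
  carry in the cyclic case and discards it in the product case.\<close>

definition op :: "nat \<Rightarrow> nat \<Rightarrow> nat" where
  "op x y = enc (int (x mod p) + int (y mod p)) (int (x div p) + int (y div p))"

lemma op_less: "op x y < p\<^sup>2"
  unfolding op_def by (rule enc_less)

lemma enc_add_cong:
  assumes "enc a b = enc a' b'" "enc c d = enc c' d'"
  shows "enc (a + c) (b + d) = enc (a' + c') (b' + d')"
  using K_add[of "a - a'" "b - b'" "c - c'" "d - d'"] assms by (simp add: enc_eq_iff algebra_simps)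

lemma op_enc: "op (enc i j) (enc i' j') = enc (i + i') (j + j')"
  unfolding op_def by (intro enc_add_cong enc_digits enc_less)

lemma op_assoc:
  assumes "x < p\<^sup>2" "y < p\<^sup>2" "z < p\<^sup>2"
  shows "op (op x y) z = op x (op y z)"
proof -
  have "op (op (enc a b) (enc c d)) (enc e g) = op (enc a b) (op (enc c d) (enc e g))" for a b c d e g
    by (simp add: op_enc add.assoc)
  from this[of "int (x mod p)" "int (x div p)" "int (y mod p)" "int (y div p)" "int (z mod p)" "int (z div p)"]
  show ?thesis by (simp only: enc_digits assms)
qed

lemma op_comm: "op x y = op y x"
  by (simp add: op_def add.commute)

lemma op_cancel:
  assumes "x < p\<^sup>2" "y < p\<^sup>2" "z < p\<^sup>2" "op x y = op x z"
  shows "y = z"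
proof -
  have "enc c d = enc e g" if "op (enc a b) (enc c d) = op (enc a b) (enc e g)" for a b c d e g
    using that by (simp add: op_enc enc_eq_iff)
  from this[of "int (x mod p)" "int (x div p)" "int (y mod p)" "int (y div p)" "int (z mod p)" "int (z div p)"]
  show ?thesis using assms(4) by (simp only: enc_digits assms(1-3))
qed

lemma magma_op: "magma {..<p\<^sup>2} op"
  using prime by (auto simp: magma_def op_less lessThan_empty_iff prime_gt_0_nat)

end

section \<open>The cyclic and the elementary abelian group of order \<open>p^2\<close>\<close>

definition cyclic_enc :: "nat \<Rightarrow> int \<Rightarrow> int \<Rightarrow> nat" where
  "cyclic_enc p i j = nat ((i + int p * j) mod (int p)\<^sup>2)"

definition product_enc :: "nat \<Rightarrow> int \<Rightarrow> int \<Rightarrow> nat" where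
  "product_enc p i j = nat (i mod int p + int p * (j mod int p))"

lemma pair_group_cyclic:
  assumes p: "prime p"
  shows "pair_group p (cyclic_enc p) (\<lambda>a b. (int p)\<^sup>2 dvd a + int p * b)"
proof
  have p0: "(int p)\<^sup>2 > 0" using prime_gt_0_nat[OF p] by simp
  fix i j i' j' a b c d k :: int and x :: nat
  show "prime p" by fact
  have "(i + int p * j) mod (int p)\<^sup>2 < (int p)\<^sup>2" using p0 by simp
  then show "cyclic_enc p i j < p\<^sup>2"
    unfolding cyclic_enc_def by (subst nat_less_iff) (use p0 in auto)
  show "cyclic_enc p (int (x mod p)) (int (x div p)) = x" if "x < p\<^sup>2"
  proof -
    have "int (x mod p) + int p * int (x div p) = int x"
      by (metis add.commute mod_div_mult_eq mult.commute of_nat_add of_nat_mult)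
    moreover have "int x mod (int p)\<^sup>2 = int x"
      using that by (intro mod_pos_pos_trivial) (auto simp flip: of_nat_power)
    ultimately show ?thesis by (simp add: cyclic_enc_def)
  qed
  have "cyclic_enc p i j = cyclic_enc p i' j' \<longleftrightarrow>
      (i + int p * j) mod (int p)\<^sup>2 = (i' + int p * j') mod (int p)\<^sup>2"
    unfolding cyclic_enc_def using p0 by (intro eq_nat_nat_iff) auto
  then show "cyclic_enc p i j = cyclic_enc p i' j' \<longleftrightarrow> (int p)\<^sup>2 dvd i - i' + int p * (j - j')"
    by (simp add: mod_eq_dvd_iff algebra_simps)
  show "(int p)\<^sup>2 dvd a + c + int p * (b + d)"
    if "(int p)\<^sup>2 dvd a + int p * b" "(int p)\<^sup>2 dvd c + int p * d"
    using dvd_add[OF that] by (simp add: algebra_simps)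
  show "(int p)\<^sup>2 dvd a + int p * b" if "\<not> int p dvd k" "(int p)\<^sup>2 dvd k * a + int p * (k * b)"
  proof -
    have "coprime (int p) k" using that(1) p by (intro prime_imp_coprime) auto
    moreover have "(int p)\<^sup>2 dvd k * (a + int p * b)" using that(2) by (simp add: algebra_simps)
    ultimately show ?thesis by (metis coprime_dvd_mult_right_iff coprime_power_left_iff)
  qed
qed

lemma pair_group_product:
  assumes p: "prime p"
  shows "pair_group p (product_enc p) (\<lambda>a b. int p dvd a \<and> int p dvd b)"
proof
  have p0: "int p > 0" using prime_gt_0_nat[OF p] by simp
  fix i j i' j' a b c d k :: int and x :: nat
  show "prime p" by fact
  have lt: "i mod int p + int p * (j mod int p) < (int p)\<^sup>2" for i j
  proof -
    have "i mod int p < int p" "int p * (j mod int p) \<le> int p * (int p - 1)"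
      using p0 by (auto intro: mult_left_mono simp: zle_diff1_eq)
    then show ?thesis by (simp add: power2_eq_square right_diff_distrib)
  qed
  have ge: "i mod int p + int p * (j mod int p) \<ge> 0" for i j using p0 by simp
  show "product_enc p i j < p\<^sup>2"
    unfolding product_enc_def using lt[of i j] ge[of i j] by (simp add: nat_less_iff)
  show "product_enc p (int (x mod p)) (int (x div p)) = x" if "x < p\<^sup>2"
  proof -
    have "x div p < p" using that by (simp add: less_mult_imp_div_less power2_eq_square)
    then have "product_enc p (int (x mod p)) (int (x div p)) = nat (int (x mod p + p * (x div p)))"
      unfolding product_enc_def by (simp only: of_nat_add of_nat_mult flip: of_nat_mod) simp
    then show ?thesis by (simp only: nat_int mod_mult_div_eq)
  qed
  have "i mod int p = i' mod int p \<and> j mod int p = j' mod int p"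
    if e: "i mod int p + int p * (j mod int p) = i' mod int p + int p * (j' mod int p)"
  proof -
    have "(i mod int p + int p * (j mod int p)) mod int p = (i' mod int p + int p * (j' mod int p)) mod int p"
      using e by simp
    then have "i mod int p = i' mod int p" by simp
    with e p0 show ?thesis by simp
  qed
  then have "product_enc p i j = product_enc p i' j' \<longleftrightarrow>
      i mod int p = i' mod int p \<and> j mod int p = j' mod int p"
    unfolding product_enc_def using ge eq_nat_nat_iff[OF ge ge] by metis
  then show "product_enc p i j = product_enc p i' j' \<longleftrightarrow> int p dvd i - i' \<and> int p dvd j - j'"
    by (simp add: mod_eq_dvd_iff)
  show "int p dvd a + c \<and> int p dvd b + d" if "int p dvd a \<and> int p dvd b" "int p dvd c \<and> int p dvd d"
    using that by auto
  show "int p dvd a \<and> int p dvd b" if "\<not> int p dvd k" "int p dvd k * a \<and> int p dvd k * b"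
    using that p by (auto simp: prime_dvd_mult_iff)
qed

definition cyclic_op :: "nat \<Rightarrow> nat \<Rightarrow> nat \<Rightarrow> nat" where
  "cyclic_op p = pair_group.op p (cyclic_enc p)"

definition product_op :: "nat \<Rightarrow> nat \<Rightarrow> nat \<Rightarrow> nat" where
  "product_op p = pair_group.op p (product_enc p)"

lemma cyclic_op_eq:
  assumes "prime p"
  shows "cyclic_op p x y = (x + y) mod p\<^sup>2"
proof -
  interpret pair_group p "cyclic_enc p" "\<lambda>a b. (int p)\<^sup>2 dvd a + int p * b"
    by (rule pair_group_cyclic[OF assms])
  have x: "int (x mod p) + int p * int (x div p) = int x" for x
    by (metis add.commute mod_div_mult_eq mult.commute of_nat_add of_nat_mult)
  have "int (x mod p) + int (y mod p) + int p * (int (x div p) + int (y div p)) = int (x + y)"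
    using x[of x] x[of y] by (simp only: distrib_left of_nat_add)
  then have "cyclic_op p x y = nat (int (x + y) mod (int p)\<^sup>2)"
    unfolding cyclic_op_def op_def cyclic_enc_def by (simp only:)
  also have "int (x + y) mod (int p)\<^sup>2 = int ((x + y) mod p\<^sup>2)" by (simp add: zmod_int)
  finally show ?thesis by simp
qed

lemma group_in_cyclic_op:
  assumes p: "prime p"
  shows "group_in cyclic_group {..<p\<^sup>2} (cyclic_op p)"
proof -
  define n where "n = p\<^sup>2"
  have n1: "n > 1" unfolding n_def using prime_gt_1_nat[OF p] by (intro one_less_power) auto
  let ?G = "\<lparr>carrier = {..<n}, mult = cyclic_op p, one = 0\<rparr>"
  have mult: "cyclic_op p x y = (x + y) mod n" for x y using cyclic_op_eq[OF p] n_def by simp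
  have G: "group ?G"
  proof (rule groupI)
    fix x y z assume x: "x \<in> carrier ?G"
    have "(n - x) mod n \<in> carrier ?G" "(n - x) mod n \<otimes>\<^bsub>?G\<^esub> x = \<one>\<^bsub>?G\<^esub>"
      using x n1 by (auto simp: mult mod_add_left_eq)
    then show "\<exists>y\<in>carrier ?G. y \<otimes>\<^bsub>?G\<^esub> x = \<one>\<^bsub>?G\<^esub>" by blast
    show "x \<otimes>\<^bsub>?G\<^esub> y \<otimes>\<^bsub>?G\<^esub> z = x \<otimes>\<^bsub>?G\<^esub> (y \<otimes>\<^bsub>?G\<^esub> z)"
      by (simp add: mult mod_add_left_eq mod_add_right_eq add.assoc)
  qed (use n1 in \<open>auto simp: mult\<close>)
  have "1 [^]\<^bsub>?G\<^esub> (k::nat) = k mod n" for k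
  proof (induction k)
    case (Suc k)
    then show ?case using group.is_monoid[OF G] monoid.nat_pow_Suc by (simp add: mult mod_Suc_eq)
  qed (use group.is_monoid[OF G] n1 in \<open>simp add: monoid.nat_pow_0\<close>)
  then have pow: "1 [^]\<^bsub>?G\<^esub> int k = k mod n" for k by (simp add: int_pow_int)
  have "carrier ?G = range (\<lambda>k::int. 1 [^]\<^bsub>?G\<^esub> k)"
  proof
    show "carrier ?G \<subseteq> range (\<lambda>k::int. 1 [^]\<^bsub>?G\<^esub> k)"
    proof
      fix x assume "x \<in> carrier ?G"
      then have "x = 1 [^]\<^bsub>?G\<^esub> int x" unfolding pow by simp
      then show "x \<in> range (\<lambda>k::int. 1 [^]\<^bsub>?G\<^esub> k)" by blast
    qed
    show "range (\<lambda>k::int. 1 [^]\<^bsub>?G\<^esub> k) \<subseteq> carrier ?G"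
      using group.int_pow_closed[OF G, of 1] n1 by auto
  qed
  then have "cyclic_group ?G" using group.cyclic_group[OF G] n1 by auto
  with G show ?thesis unfolding group_in_def n_def by blast
qed

text \<open>Every element is killed by \<open>p\<close>, so an embedding would place
  \<open>p^2\<close> elements in the \<open>p\<close>-torsion of the integers modulo
  \<open>m\<close>, which has at most \<open>p\<close>.\<close>

lemma product_op_not_embeddable:
  fixes m :: int
  assumes p: "prime p" and m: "m > 0"
    and hom: "\<And>x y. x < p\<^sup>2 \<Longrightarrow> y < p\<^sup>2 \<Longrightarrow> [\<phi> (product_op p x y) = \<phi> x + \<phi> y] (mod m)"
    and inj: "\<And>x y. x < p\<^sup>2 \<Longrightarrow> y < p\<^sup>2 \<Longrightarrow> [\<phi> x = \<phi> y] (mod m) \<Longrightarrow> x = y"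
  shows False
proof -
  interpret pair_group p "product_enc p" "\<lambda>a b. int p dvd a \<and> int p dvd b"
    by (rule pair_group_product[OF p])
  have p0: "int p > 0" and p1: "p > 1" using prime_gt_0_nat[OF p] prime_gt_1_nat[OF p] by auto
  define E where "E i j = product_enc p i j" for i j
  \<comment> \<open>The summand \<open>\<phi> (E 0 0)\<close> starts the induction at
    \<open>k = 0\<close> without first showing that the identity maps to 0; it cancels
    later.\<close>
  have mult: "[\<phi> (E (int k * i) (int k * j)) = int k * \<phi> (E i j) + \<phi> (E 0 0)] (mod m)" for k i j
  proof (induction k)
    case (Suc k)
    have "E (int (Suc k) * i) (int (Suc k) * j) = product_op p (E i j) (E (int k * i) (int k * j))"
      unfolding product_op_def E_def op_enc by (simp add: algebra_simps)
    then have "[\<phi> (E (int (Suc k) * i) (int (Suc k) * j)) = \<phi> (E i j) + \<phi> (E (int k * i) (int k * j))] (mod m)"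
      using hom enc_less E_def by simp
    also have "[\<phi> (E i j) + \<phi> (E (int k * i) (int k * j)) = \<phi> (E i j) + (int k * \<phi> (E i j) + \<phi> (E 0 0))] (mod m)"
      using Suc.IH by (intro cong_add) auto
    finally show ?case by (simp add: algebra_simps)
  qed simp
  have "m dvd int p * \<phi> x" if x: "x < p\<^sup>2" for x
  proof -
    let ?i = "int (x mod p)" and ?j = "int (x div p)"
    have "E (int p * ?i) (int p * ?j) = E 0 0" unfolding E_def enc_eq_iff by simp
    with mult[of p ?i ?j] have "[\<phi> (E 0 0) = int p * \<phi> (E ?i ?j) + \<phi> (E 0 0)] (mod m)" by simp
    moreover have "E ?i ?j = x" unfolding E_def using enc_digits[OF x] .
    ultimately have "[int p * \<phi> x + \<phi> (E 0 0) = 0 + \<phi> (E 0 0)] (mod m)" by (simp add: cong_sym)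
    then show ?thesis by (simp only: cong_add_rcancel cong_0_iff)
  qed
  then have tors: "m dvd int p * (\<phi> x mod m)" if "x < p\<^sup>2" for x
    using that by (metis mod_mod_trivial mod_mult_right_eq dvd_eq_mod_eq_0)
  \<comment> \<open>The residue of \<open>\<phi> x\<close> is a multiple of \<open>m / p\<close>;
    \<open>r x\<close> is the multiplier, hence one of \<open>0, ..., p - 1\<close>.\<close>
  define r where "r x = int p * (\<phi> x mod m) div m" for x
  have "inj_on r {..<p\<^sup>2}"
  proof (rule inj_onI; simp)
    fix x y assume xy: "x < p\<^sup>2" "y < p\<^sup>2" "r x = r y"
    then have "int p * (\<phi> x mod m) = int p * (\<phi> y mod m)"
      unfolding r_def using tors by (metis dvd_div_mult_self)
    then have "\<phi> x mod m = \<phi> y mod m" using p0 by simp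
    then show "x = y" using inj xy by (simp add: cong_def)
  qed
  moreover have "r ` {..<p\<^sup>2} \<subseteq> {0..<int p}"
  proof
    fix t assume "t \<in> r ` {..<p\<^sup>2}"
    then obtain x where t: "t = r x" and x: "x < p\<^sup>2" by auto
    have "0 \<le> \<phi> x mod m" "\<phi> x mod m < m" using m by auto
    then have "0 \<le> int p * (\<phi> x mod m)" "int p * (\<phi> x mod m) < int p * m" using p0 by auto
    moreover have "r x * m = int p * (\<phi> x mod m)" unfolding r_def using tors x by (intro dvd_div_mult_self) auto
    ultimately have "0 \<le> r x * m" "r x * m < int p * m" by simp_all
    then show "t \<in> {0..<int p}" unfolding t using m by (simp add: zero_le_mult_iff)
  qed
  ultimately have "card {..<p\<^sup>2} \<le> card {0..<int p}" by (intro card_inj_on_le) auto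
  then have "p\<^sup>2 \<le> p" by simp
  then show False using p1 by (simp add: power2_eq_square)
qed

text \<open>Going from an element to its label in \<open>T\<close>, reading that label in
  \<open>T'\<close> and taking a discrete logarithm gives a partial map into the integers modulo
  \<open>m\<close>. It respects products wherever the two tables agree, so few differing entries
  make it an almost homomorphism.\<close>

lemma product_op_table_far:
  assumes p: "prime p"
  shows "table_far (1 / 23) {..<p\<^sup>2} (product_op p)"
  unfolding table_far_def
proof (intro allI impI, rule ccontr)
  interpret pair_group p "product_enc p" "\<lambda>a b. int p dvd a \<and> int p dvd b"
    by (rule pair_group_product[OF p])
  let ?G = "{..<p\<^sup>2}" and ?f = "product_op p"
  have f: "?f = op" by (simp add: product_op_def)
  fix \<Gamma>' g T T'
  assume g: "magma \<Gamma>' g" "group_in cyclic_group \<Gamma>' g"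
    and T: "mult_table ?G ?f T" and T': "mult_table \<Gamma>' g T'"
    and less: "\<not> 1 / 23 * real (card ?G) ^ 2 \<le> real (card {t. T t \<noteq> T' t})"
  obtain e where H: "group \<lparr>carrier = \<Gamma>', mult = g, one = e\<rparr>"
    and cyc: "cyclic_group \<lparr>carrier = \<Gamma>', mult = g, one = e\<rparr>"
    using g(2) unfolding group_in_def by blast
  define H where "H = \<lparr>carrier = \<Gamma>', mult = g, one = e\<rparr>"
  interpret H: group H using H H_def by simp
  obtain a where a: "a \<in> carrier H" "carrier H = range (\<lambda>n::int. a [^]\<^bsub>H\<^esub> n)"
    using cyc H.cyclic_group unfolding H_def by auto
  define m where "m = int (H.ord a)"
  have finH: "finite (carrier H)" using g(1) by (simp add: H_def magma_def)
  have m: "m > 0" using H.ord_ge_1[OF finH a(1)] m_def by simp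
  have "\<forall>x\<in>\<Gamma>'. \<exists>k::int. x = a [^]\<^bsub>H\<^esub> k" using a(2) unfolding H_def by auto
  \<comment> \<open>\<open>L\<close> is a discrete logarithm to the base \<open>a\<close>, unique
    modulo the order of \<open>a\<close>.\<close>
  then obtain L where L: "\<And>x. x \<in> \<Gamma>' \<Longrightarrow> x = a [^]\<^bsub>H\<^esub> (L x :: int)" by metis
  have pow_eq: "a [^]\<^bsub>H\<^esub> i = a [^]\<^bsub>H\<^esub> j \<longleftrightarrow> [i = j] (mod m)" for i j :: int
    using H.int_pow_eq[OF a(1)] unfolding m_def by (metis cong_iff_dvd_diff cong_sym_eq)
  have Linj: "x = y" if "x \<in> \<Gamma>'" "y \<in> \<Gamma>'" "[L x = L y] (mod m)" for x y
    using that L pow_eq by metis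
  have Lhom: "[L (g x y) = L x + L y] (mod m)" if xy: "x \<in> \<Gamma>'" "y \<in> \<Gamma>'" for x y
  proof -
    have "g x y \<in> \<Gamma>'" using g(1) xy by (simp add: magma_def)
    moreover have "g x y = a [^]\<^bsub>H\<^esub> L x \<otimes>\<^bsub>H\<^esub> a [^]\<^bsub>H\<^esub> L y" using xy L by (simp add: H_def)
    ultimately have "a [^]\<^bsub>H\<^esub> L (g x y) = a [^]\<^bsub>H\<^esub> (L x + L y)"
      using L a(1) by (simp add: H.int_pow_mult)
    then show ?thesis using pow_eq by blast
  qed
  obtain D \<sigma> where D: "table_on D T" "bij_betw \<sigma> D ?G"
      "\<And>a b. a \<in> D \<Longrightarrow> b \<in> D \<Longrightarrow> T (a, b) = Some (the_inv_into D \<sigma> (?f (\<sigma> a) (\<sigma> b)))"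
    using T unfolding mult_table_def by blast
  obtain D' \<tau> where D': "table_on D' T'" "bij_betw \<tau> D' \<Gamma>'"
      "\<And>a b. a \<in> D' \<Longrightarrow> b \<in> D' \<Longrightarrow> T' (a, b) = Some (the_inv_into D' \<tau> (g (\<tau> a) (\<tau> b)))"
    using T' unfolding mult_table_def by blast
  define s where "s = the_inv_into D \<sigma>"
  \<comment> \<open>The elements whose label occurs in both tables; only for these does
    \<open>h\<close> have a meaning.\<close>
  define S where "S = \<sigma> ` (D \<inter> D')"
  define h where "h x = L (\<tau> (s x))" for x
  have sD: "s x \<in> D" "\<sigma> (s x) = x" if "x \<in> ?G" for x
    using D(2) that f_the_inv_into_f[of \<sigma> D x] the_inv_into_into[of \<sigma> D x D]
    unfolding s_def bij_betw_def by auto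
  have s\<sigma>: "s (\<sigma> c) = c" if "c \<in> D" for c
    using D(2) that the_inv_into_f_f[of \<sigma> D c] unfolding s_def bij_betw_def by auto
  have Siff: "x \<in> S \<longleftrightarrow> s x \<in> D'" if "x \<in> ?G" for x
  proof
    assume "x \<in> S"
    then obtain c where "c \<in> D" "c \<in> D'" "x = \<sigma> c" unfolding S_def by auto
    then show "s x \<in> D'" using s\<sigma> by simp
  next
    assume "s x \<in> D'"
    then have "s x \<in> D \<inter> D'" using sD(1)[OF that] by simp
    then show "x \<in> S" unfolding S_def using sD(2)[OF that] by (metis imageI)
  qed
  have SG: "S \<subseteq> ?G" using D(2) unfolding S_def bij_betw_def by auto
  have \<tau>in: "\<tau> c \<in> \<Gamma>'" if "c \<in> D'" for c using D'(2) that unfolding bij_betw_def by auto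
  have fin: "finite {t. T t \<noteq> T' t}"
    by (rule finite_table_diff) (use D(1) D'(1) in \<open>simp_all add: table_on_def\<close>)
  let ?B = "{(x, y) \<in> ?G \<times> ?G.
      \<not> (x \<in> S \<and> y \<in> S \<and> ?f x y \<in> S \<and> [h (?f x y) = h x + h y] (mod m))}"
  have "card ?B \<le> card {t. T t \<noteq> T' t}"
  proof (rule card_inj_on_le[where f = "\<lambda>(x, y). (s x, s y)"])
    show "finite {t. T t \<noteq> T' t}" by (rule fin)
    have "inj_on s ?G"
      by (rule inj_on_inverseI[where g = \<sigma>]) (rule sD(2))
    then have "inj_on (map_prod s s) (?G \<times> ?G)" by (intro map_prod_inj_on)
    then have "inj_on (\<lambda>(x, y). (s x, s y)) (?G \<times> ?G)" by (simp only: map_prod_def)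
    then show "inj_on (\<lambda>(x, y). (s x, s y)) ?B" by (rule inj_on_subset) blast
    show "(\<lambda>(x, y). (s x, s y)) ` ?B \<subseteq> {t. T t \<noteq> T' t}"
    proof (rule image_subsetI, rule CollectI, rule notI)
      fix w assume w: "w \<in> ?B" and "T (case w of (x, y) \<Rightarrow> (s x, s y)) = T' (case w of (x, y) \<Rightarrow> (s x, s y))"
      moreover obtain x y where "w = (x, y)" by (cases w)
      ultimately have xy: "x \<in> ?G" "y \<in> ?G" and eq: "T (s x, s y) = T' (s x, s y)"
        and bad: "\<not> (x \<in> S \<and> y \<in> S \<and> ?f x y \<in> S \<and> [h (?f x y) = h x + h y] (mod m))"
        by auto
      have fG: "?f x y \<in> ?G" using op_less f by simp
      have "T (s x, s y) = Some (s (?f x y))"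
        using D(3)[of "s x" "s y"] sD xy s_def by simp
      \<comment> \<open>Agreement with a defined entry of \<open>T\<close> puts both labels into
        \<open>D'\<close>, and then the value of the entry as well. So one equation yields all four
        conditions of goodness.\<close>
      with eq have e': "T' (s x, s y) = Some (s (?f x y))" by simp
      then have "(s x, s y) \<in> dom T'" by auto
      then have in': "s x \<in> D'" "s y \<in> D'" using D'(1) by (auto simp: table_on_def)
      have gin: "g (\<tau> (s x)) (\<tau> (s y)) \<in> \<Gamma>'" using g(1) \<tau>in in' by (auto simp: magma_def)
      have "s (?f x y) = the_inv_into D' \<tau> (g (\<tau> (s x)) (\<tau> (s y)))"
        using D'(3)[OF in'] e' by simp
      then have "s (?f x y) \<in> D'" and \<tau>: "\<tau> (s (?f x y)) = g (\<tau> (s x)) (\<tau> (s y))"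
        using D'(2) gin f_the_inv_into_f[of \<tau> D' "g (\<tau> (s x)) (\<tau> (s y))"]
          the_inv_into_into[of \<tau> D' "g (\<tau> (s x)) (\<tau> (s y))" D']
        unfolding bij_betw_def by auto
      moreover have "[h (?f x y) = h x + h y] (mod m)"
        unfolding h_def \<tau> using Lhom \<tau>in in' by blast
      ultimately show False using bad Siff xy fG in' by blast
    qed
  qed
  then have "real (card ?B) \<le> real (card {t. T t \<noteq> T' t})" by simp
  with less have "23 * real (card ?B) < real (card ?G) ^ 2" by linarith
  then have "real (23 * card ?B) < real (card ?G ^ 2)"
    by (simp only: of_nat_mult of_nat_numeral of_nat_power)
  then have B: "23 * card ?B < card ?G ^ 2" by (rule of_nat_less_iff[THEN iffD1])
  have hinj: "x = y" if xy: "x \<in> S" "y \<in> S" "[h x = h y] (mod m)" for x y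
  proof -
    have G: "x \<in> ?G" "y \<in> ?G" using SG xy by auto
    then have "s x \<in> D'" "s y \<in> D'" using Siff xy by auto
    then have "\<tau> (s x) = \<tau> (s y)" using Linj \<tau>in xy(3) unfolding h_def by blast
    then have "s x = s y" using D'(2) \<open>s x \<in> D'\<close> \<open>s y \<in> D'\<close> unfolding bij_betw_def by (meson inj_onD)
    then show ?thesis using sD(2) G by metis
  qed
  have "\<exists>\<phi>. (\<forall>x\<in>?G. \<forall>y\<in>?G. [\<phi> (?f x y) = \<phi> x + \<phi> y] (mod m)) \<and>
      (\<forall>x\<in>?G. \<forall>y\<in>?G. [\<phi> x = \<phi> y] (mod m) \<longrightarrow> x = y)"
  proof (rule almost_hom_imp_embedding[OF _ SG _ _ _ _ _ B])
    fix x y z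
    show "?f x y \<in> ?G" using op_less f by simp
    assume "x \<in> ?G" "y \<in> ?G"
    show "?f x y = ?f y x" unfolding f by (rule op_comm)
    assume "z \<in> ?G"
    show "?f (?f x y) z = ?f x (?f y z)"
      unfolding f using \<open>x \<in> ?G\<close> \<open>y \<in> ?G\<close> \<open>z \<in> ?G\<close> by (intro op_assoc) auto
    assume "?f x y = ?f x z"
    with \<open>x \<in> ?G\<close> \<open>y \<in> ?G\<close> \<open>z \<in> ?G\<close> show "y = z"
      unfolding f using op_cancel[of x y z] by simp
  qed (simp, erule (2) hinj)
  then obtain \<phi> where \<phi>: "\<forall>x\<in>?G. \<forall>y\<in>?G. [\<phi> (?f x y) = \<phi> x + \<phi> y] (mod m)"
      "\<forall>x\<in>?G. \<forall>y\<in>?G. [\<phi> x = \<phi> y] (mod m) \<longrightarrow> x = y" by (elim exE conjE)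
  show False
  proof (rule product_op_not_embeddable[OF p m])
    fix x y assume "x < p\<^sup>2" "y < p\<^sup>2"
    then have xy: "x \<in> ?G" "y \<in> ?G" by simp_all
    show "[\<phi> (?f x y) = \<phi> x + \<phi> y] (mod m)" by (rule \<phi>(1)[rule_format, OF xy])
    assume "[\<phi> x = \<phi> y] (mod m)"
    then show "x = y" by (rule \<phi>(2)[rule_format, OF xy])
  qed
qed


section \<open>Likelihoods of transcripts\<close>

lemma pmf_bind_finite:
  assumes "finite S" "\<And>x. x \<notin> S \<Longrightarrow> pmf (f x) c = 0"
  shows "pmf (bind_pmf M f) c = (\<Sum>x\<in>S. pmf M x * pmf (f x) c)"
proof -
  have "pmf (bind_pmf M f) c = (\<integral>x. pmf (f x) c \<partial>measure_pmf M)" by (rule pmf_bind)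
  also have "\<dots> = (\<Sum>x\<in>S. pmf M x *\<^sub>R pmf (f x) c)"
    by (rule integral_measure_pmf[OF assms(1)]) (use assms(2) in blast)
  finally show ?thesis by simp
qed

text \<open>Lifts a pointwise comparison of likelihoods to events. Since \<open>S\<close> may be
  infinite, the summation is a nonnegative integral over counting measure.\<close>

lemma scaled_prob_le_sum_prob:
  fixes P :: "'a pmf" and Q :: "'b \<Rightarrow> 'a pmf"
  assumes fin: "finite \<Omega>" and c: "c \<ge> 0" and w: "\<And>\<omega>. \<omega> \<in> \<Omega> \<Longrightarrow> w \<omega> \<ge> 0"
    and le: "\<And>x. x \<in> S \<Longrightarrow> c * pmf P x \<le> (\<Sum>\<omega>\<in>\<Omega>. w \<omega> * pmf (Q \<omega>) x)"
  shows "c * measure_pmf.prob P S \<le> (\<Sum>\<omega>\<in>\<Omega>. w \<omega> * measure_pmf.prob (Q \<omega>) S)"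
proof -
  have "ennreal (c * measure_pmf.prob P S) = ennreal c * (\<integral>\<^sup>+x. ennreal (pmf P x) \<partial>count_space S)"
    using c by (simp add: nn_integral_pmf measure_pmf.emeasure_eq_measure ennreal_mult)
  also have "\<dots> = (\<integral>\<^sup>+x. ennreal (c * pmf P x) \<partial>count_space S)"
    using c by (simp add: nn_integral_cmult[symmetric] ennreal_mult)
  also have "\<dots> \<le> (\<integral>\<^sup>+x. (\<Sum>\<omega>\<in>\<Omega>. ennreal (w \<omega> * pmf (Q \<omega>) x)) \<partial>count_space S)"
  proof (rule nn_integral_mono)
    fix x assume "x \<in> space (count_space S)"
    then have "c * pmf P x \<le> (\<Sum>\<omega>\<in>\<Omega>. w \<omega> * pmf (Q \<omega>) x)" using le by simp
    then have "ennreal (c * pmf P x) \<le> ennreal (\<Sum>\<omega>\<in>\<Omega>. w \<omega> * pmf (Q \<omega>) x)" by (rule ennreal_leI)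
    also have "\<dots> = (\<Sum>\<omega>\<in>\<Omega>. ennreal (w \<omega> * pmf (Q \<omega>) x))"
      by (rule sum_ennreal[symmetric]) (use w in simp)
    finally show "ennreal (c * pmf P x) \<le> (\<Sum>\<omega>\<in>\<Omega>. ennreal (w \<omega> * pmf (Q \<omega>) x))" .
  qed
  also have "\<dots> = (\<Sum>\<omega>\<in>\<Omega>. \<integral>\<^sup>+x. ennreal (w \<omega> * pmf (Q \<omega>) x) \<partial>count_space S)"
    by (rule nn_integral_sum) simp
  also have "\<dots> = (\<Sum>\<omega>\<in>\<Omega>. ennreal (w \<omega> * measure_pmf.prob (Q \<omega>) S))"
  proof (rule sum.cong[OF refl])
    fix \<omega> assume "\<omega> \<in> \<Omega>"
    then have w0: "w \<omega> \<ge> 0" by (rule w)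
    have "(\<integral>\<^sup>+x. ennreal (w \<omega> * pmf (Q \<omega>) x) \<partial>count_space S)
        = ennreal (w \<omega>) * (\<integral>\<^sup>+x. ennreal (pmf (Q \<omega>) x) \<partial>count_space S)"
      using w0 by (simp add: nn_integral_cmult[symmetric] ennreal_mult)
    then show "(\<integral>\<^sup>+x. ennreal (w \<omega> * pmf (Q \<omega>) x) \<partial>count_space S)
        = ennreal (w \<omega> * measure_pmf.prob (Q \<omega>) S)"
      using w0 by (simp add: nn_integral_pmf measure_pmf.emeasure_eq_measure ennreal_mult)
  qed
  also have "\<dots> = ennreal (\<Sum>\<omega>\<in>\<Omega>. w \<omega> * measure_pmf.prob (Q \<omega>) S)"
    by (rule sum_ennreal) (use w in simp)
  finally show ?thesis
    by (subst (asm) ennreal_le_iff) (auto intro!: sum_nonneg mult_nonneg_nonneg w)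
qed

section \<open>Runs against oracles whose answers may depend on the transcript\<close>

type_synonym answers = "transcript \<Rightarrow> oracle_query \<Rightarrow> bool list pmf"

fun perform_adaptive :: "answers \<Rightarrow> transcript \<Rightarrow> action \<Rightarrow> config pmf" where
  "perform_adaptive R h (Ask u) = map_pmf (\<lambda>z. Running (h @ [(u, z)])) (R h u)"
| "perform_adaptive R h (Halt v) = return_pmf (Halted h v)"

fun next_adaptive :: "algorithm \<Rightarrow> answers \<Rightarrow> config \<Rightarrow> config pmf" where
  "next_adaptive A R (Running h) = bind_pmf (A h) (perform_adaptive R h)"
| "next_adaptive A R (Halted h v) = return_pmf (Halted h v)"

primrec run_adaptive :: "algorithm \<Rightarrow> answers \<Rightarrow> nat \<Rightarrow> config pmf" where
  "run_adaptive A R 0 = return_pmf (Running [])"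
| "run_adaptive A R (Suc n) = bind_pmf (run_adaptive A R n) (next_adaptive A R)"

lemma run_conv_run_adaptive: "run A O\<^sub>1 O\<^sub>2 n = run_adaptive A (\<lambda>_. answer O\<^sub>1 O\<^sub>2) n"
proof -
  have "perform O\<^sub>1 O\<^sub>2 h a = perform_adaptive (\<lambda>_. answer O\<^sub>1 O\<^sub>2) h a" for h a by (cases a) auto
  then have "perform O\<^sub>1 O\<^sub>2 h = perform_adaptive (\<lambda>_. answer O\<^sub>1 O\<^sub>2) h" for h by blast
  then have "next_config A O\<^sub>1 O\<^sub>2 c = next_adaptive A (\<lambda>_. answer O\<^sub>1 O\<^sub>2) c" for c by (cases c) auto
  then have "next_config A O\<^sub>1 O\<^sub>2 = next_adaptive A (\<lambda>_. answer O\<^sub>1 O\<^sub>2)" by blast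
  then show ?thesis by (induction n) auto
qed

text \<open>The probability of a transcript splits into the choices of the algorithm and the answers
  of the oracle. The first factor is the same for all oracles, so only \<open>answer_weight\<close>
  has to be compared.\<close>

definition query_weight :: "algorithm \<Rightarrow> transcript \<Rightarrow> real" where
  "query_weight A h = (\<Prod>i<length h. pmf (A (take i h)) (Ask (fst (h ! i))))"

definition answer_weight :: "answers \<Rightarrow> transcript \<Rightarrow> real" where
  "answer_weight R h = (\<Prod>i<length h. pmf (R (take i h) (fst (h ! i))) (snd (h ! i)))"

lemma query_weight_nonneg: "query_weight A h \<ge> 0"
  unfolding query_weight_def by (rule prod_nonneg) simp

lemma answer_weight_nonneg: "answer_weight R h \<ge> 0"
  unfolding answer_weight_def by (rule prod_nonneg) simp

lemma query_weight_Nil [simp]: "query_weight A [] = 1"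
  by (simp add: query_weight_def)

lemma answer_weight_Nil [simp]: "answer_weight R [] = 1"
  by (simp add: answer_weight_def)

lemma query_weight_snoc: "query_weight A (h @ [(u, z)]) = query_weight A h * pmf (A h) (Ask u)"
  unfolding query_weight_def by (simp add: nth_append)

lemma answer_weight_snoc: "answer_weight R (h @ [(u, z)]) = answer_weight R h * pmf (R h u) z"
  unfolding answer_weight_def by (simp add: nth_append)

lemma pmf_next_adaptive_Running_snoc:
  "pmf (next_adaptive A R (Running h)) (Running (h @ [(u, z)])) = pmf (A h) (Ask u) * pmf (R h u) z"
proof -
  have 0: "pmf (perform_adaptive R h a) (Running (h @ [(u, z)])) = 0" if "a \<notin> {Ask u}" for a
    using that by (cases a) (auto simp: pmf_eq_0_set_pmf)
  have inj: "inj (\<lambda>z. Running (h @ [(u, z)]))" by (auto intro: injI)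
  have "pmf (map_pmf (\<lambda>z. Running (h @ [(u, z)])) (R h u)) (Running (h @ [(u, z)])) = pmf (R h u) z"
    using pmf_map_inj'[OF inj, of "R h u" z] .
  then show ?thesis using pmf_bind_finite[of "{Ask u}", OF _ 0] by simp
qed

lemma pmf_next_adaptive_Halted:
  "pmf (next_adaptive A R (Running h)) (Halted h v) = pmf (A h) (Halt v)"
proof -
  have 0: "pmf (perform_adaptive R h a) (Halted h v) = 0" if "a \<notin> {Halt v}" for a
    using that by (cases a) (auto simp: pmf_eq_0_set_pmf)
  show ?thesis using pmf_bind_finite[of "{Halt v}", OF _ 0] by simp
qed

lemma pmf_next_adaptive_0:
  "c \<noteq> Running h \<Longrightarrow> pmf (next_adaptive A R c) (Running (h @ [(u, z)])) = 0"
  "pmf (next_adaptive A R c) (Running []) = 0"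
  "c \<noteq> Running h \<Longrightarrow> c \<noteq> Halted h v \<Longrightarrow> pmf (next_adaptive A R c) (Halted h v) = 0"
proof -
  have sub: "set_pmf (perform_adaptive R h a) \<subseteq> {Running (h @ [(u, z)]) |u z. True} \<union> {Halted h v |v. True}" for h a
    by (cases a) auto
  show "c \<noteq> Running h \<Longrightarrow> pmf (next_adaptive A R c) (Running (h @ [(u, z)])) = 0"
    by (cases c) (use sub in \<open>auto simp: pmf_eq_0_set_pmf subset_iff\<close>)
  show "pmf (next_adaptive A R c) (Running []) = 0"
    by (cases c) (use sub in \<open>auto simp: pmf_eq_0_set_pmf subset_iff\<close>)
  show "c \<noteq> Running h \<Longrightarrow> c \<noteq> Halted h v \<Longrightarrow> pmf (next_adaptive A R c) (Halted h v) = 0"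
    by (cases c) (use sub in \<open>auto simp: pmf_eq_0_set_pmf subset_iff\<close>)
qed

lemma pmf_run_adaptive_Running:
  "pmf (run_adaptive A R n) (Running h) = (if length h = n then query_weight A h * answer_weight R h else 0)"
proof (induction n arbitrary: h)
  case (Suc n)
  show ?case
  proof (cases h rule: rev_cases)
    case Nil
    have "pmf (bind_pmf (run_adaptive A R n) (next_adaptive A R)) (Running []) = 0"
      by (subst pmf_bind) (simp add: pmf_next_adaptive_0)
    then show ?thesis using Nil by simp
  next
    case (snoc g uz)
    obtain u z where uz: "uz = (u, z)" by (cases uz)
    have 0: "pmf (next_adaptive A R c) (Running (g @ [(u, z)])) = 0" if "c \<notin> {Running g}" for c
      using that pmf_next_adaptive_0(1) by simp
    have "pmf (run_adaptive A R (Suc n)) (Running h)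
        = (\<Sum>c\<in>{Running g}. pmf (run_adaptive A R n) c * pmf (next_adaptive A R c) (Running (g @ [(u, z)])))"
      unfolding snoc uz run_adaptive.simps(2) by (rule pmf_bind_finite[OF _ 0]) simp
    also have "\<dots> = pmf (run_adaptive A R n) (Running g) * (pmf (A g) (Ask u) * pmf (R g u) z)"
      by (simp add: pmf_next_adaptive_Running_snoc del: next_adaptive.simps)
    finally have "pmf (run_adaptive A R (Suc n)) (Running h)
        = pmf (run_adaptive A R n) (Running g) * (pmf (A g) (Ask u) * pmf (R g u) z)" .
    then show ?thesis unfolding Suc.IH by (simp add: snoc uz query_weight_snoc answer_weight_snoc)
  qed
qed (auto simp: pmf_return)

text \<open>Halting takes a step of its own after the last answer, whence the strict inequality.
  After that the probability does not depend on \<open>n\<close>.\<close>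

lemma pmf_run_adaptive_Halted:
  "pmf (run_adaptive A R n) (Halted h v) =
     (if length h < n then query_weight A h * answer_weight R h * pmf (A h) (Halt v) else 0)"
proof (induction n)
  case (Suc n)
  have 0: "pmf (next_adaptive A R c) (Halted h v) = 0" if "c \<notin> {Running h, Halted h v}" for c
    using that pmf_next_adaptive_0(3) by simp
  have "pmf (run_adaptive A R (Suc n)) (Halted h v)
      = (\<Sum>c\<in>{Running h, Halted h v}. pmf (run_adaptive A R n) c * pmf (next_adaptive A R c) (Halted h v))"
    unfolding run_adaptive.simps(2) by (rule pmf_bind_finite[OF _ 0]) simp
  also have "\<dots> = pmf (run_adaptive A R n) (Running h) * pmf (A h) (Halt v)
      + pmf (run_adaptive A R n) (Halted h v) * pmf (next_adaptive A R (Halted h v)) (Halted h v)"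
    by (simp add: pmf_next_adaptive_Halted del: next_adaptive.simps)
  finally have "pmf (run_adaptive A R (Suc n)) (Halted h v)
      = pmf (run_adaptive A R n) (Running h) * pmf (A h) (Halt v) + pmf (run_adaptive A R n) (Halted h v)"
    by simp
  then show ?case unfolding Suc.IH pmf_run_adaptive_Running by auto
qed (auto simp: pmf_return)

text \<open>Multiplying the assumed inequality by the common factor \<open>query_weight\<close>, and
  by the probability of the verdict where there is one, compares single configurations; summation
  gives events.\<close>

lemma prob_run_adaptive_le_average:
  assumes fin: "finite \<Omega>" and c: "c \<ge> 0" and w: "\<And>\<omega>. \<omega> \<in> \<Omega> \<Longrightarrow> w \<omega> \<ge> 0"
    and le: "\<And>h. length h \<le> n \<Longrightarrow> c * answer_weight R h \<le> (\<Sum>\<omega>\<in>\<Omega>. w \<omega> * answer_weight (Q \<omega>) h)"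
  shows "c * measure_pmf.prob (run_adaptive A R n) S
    \<le> (\<Sum>\<omega>\<in>\<Omega>. w \<omega> * measure_pmf.prob (run_adaptive A (Q \<omega>) n) S)"
proof (rule scaled_prob_le_sum_prob[OF fin c w])
  fix x
  have *: "c * (k * answer_weight R h) \<le> (\<Sum>\<omega>\<in>\<Omega>. w \<omega> * (k * answer_weight (Q \<omega>) h))"
    if "k \<ge> 0" "length h \<le> n" for k h
    using mult_left_mono[OF le[OF that(2)] that(1)] by (simp add: sum_distrib_left algebra_simps)
  show "c * pmf (run_adaptive A R n) x \<le> (\<Sum>\<omega>\<in>\<Omega>. w \<omega> * pmf (run_adaptive A (Q \<omega>) n) x)"
  proof (cases x)
    case (Running h)
    show ?thesis unfolding Running pmf_run_adaptive_Running
      using *[of "query_weight A h" h] query_weight_nonneg by simp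
  next
    case (Halted h v)
    have "0 \<le> query_weight A h * pmf (A h) (Halt v)" using query_weight_nonneg by simp
    then show ?thesis unfolding Halted pmf_run_adaptive_Halted
      using *[of "query_weight A h * pmf (A h) (Halt v)" h] by (simp add: algebra_simps)
  qed
qed auto

text \<open>An algorithm that never asks more than \<open>K\<close> queries has halted after \<open>Suc K\<close> steps.\<close>

lemma output_prob_le_run:
  assumes "\<And>c n. c \<in> set_pmf (run A O\<^sub>1 O\<^sub>2 n) \<Longrightarrow> num_queries c \<le> K"
  shows "output_prob A O\<^sub>1 O\<^sub>2 v \<le> measure_pmf.prob (run A O\<^sub>1 O\<^sub>2 (Suc K)) {Halted h v |h. True}"
  unfolding output_prob_def
proof (rule cSUP_least)
  fix n
  have "1 * pmf (run A O\<^sub>1 O\<^sub>2 n) x \<le> (\<Sum>\<omega>\<in>{()}. 1 * pmf (run A O\<^sub>1 O\<^sub>2 (Suc K)) x)"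
    if xH: "x \<in> {Halted h v |h. True}" for x
  proof (cases "x \<in> set_pmf (run A O\<^sub>1 O\<^sub>2 n)")
    case True
    obtain h where x: "x = Halted h v" using xH by blast
    have "length h < Suc K" using assms[OF True] x by simp
    then show ?thesis unfolding x run_conv_run_adaptive pmf_run_adaptive_Halted
      using query_weight_nonneg answer_weight_nonneg by simp
  next
    case False
    then have "pmf (run A O\<^sub>1 O\<^sub>2 n) x = 0" by (simp add: pmf_eq_0_set_pmf)
    then show ?thesis by simp
  qed
  from scaled_prob_le_sum_prob[where S = "{Halted h v |h. True}", OF _ _ _ this]
  show "measure_pmf.prob (run A O\<^sub>1 O\<^sub>2 n) {Halted h v |h. True}
      \<le> measure_pmf.prob (run A O\<^sub>1 O\<^sub>2 (Suc K)) {Halted h v |h. True}"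
    by simp
qed simp


section \<open>The ideal game\<close>

type_synonym form = "bool list \<Rightarrow> nat"
type_synonym state = "bool list \<rightharpoonup> form"

text \<open>
  A state assigns to every string seen so far the formal linear combination it stands for; the
  variables are themselves strings, namely those received as samples or guessed by the algorithm.
\<close>

definition unit_form :: "bool list \<Rightarrow> form" where
  "unit_form z = (\<lambda>x. if x = z then 1 else 0)"

definition form_add :: "form \<Rightarrow> form \<Rightarrow> form" where
  "form_add v w = (\<lambda>x. v x + w x)"

definition free :: "state \<Rightarrow> bool list set" where
  "free m = {z. m z = Some (unit_form z)}"

text \<open>A queried string that was never received is a guess; it becomes a variable of its
  own.\<close>

definition touch :: "bool list \<Rightarrow> state \<Rightarrow> state" where
  "touch z m = (if m z = None then m(z \<mapsto> unit_form z) else m)"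

text \<open>A sum of two nonzero forms has total coefficient at least 2. So the answer to a product
  query never becomes a free variable.\<close>

lemma form_add_neq_unit_form:
  assumes "\<exists>x. v x > 0" "\<exists>x. w x > 0"
  shows "form_add v w \<noteq> unit_form z"
proof
  assume eq: "form_add v w = unit_form z"
  have le: "v x + w x = (if x = z then 1 else 0)" for x
    using fun_cong[OF eq, of x] by (simp add: form_add_def unit_form_def)
  obtain x y where "v x > 0" "w y > 0" using assms by blast
  moreover have "x = z" using le[of x] \<open>v x > 0\<close> by (cases "x = z") auto
  moreover have "y = z" using le[of y] \<open>w y > 0\<close> by (cases "y = z") auto
  ultimately show False using le[of z] by simp
qed

text \<open>Injectivity gives every pair of known strings a nonzero coefficient difference, whose
  prime divisors include all unlucky primes for that pair. The support condition lets every form be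
  evaluated from values of the free strings alone.\<close>

definition state_inv :: "bool list set \<Rightarrow> nat \<Rightarrow> nat \<Rightarrow> state \<Rightarrow> bool" where
  "state_inv \<Sigma> c B m \<longleftrightarrow> dom m \<subseteq> \<Sigma> \<and> card (dom m) \<le> c \<and> inj_on m (dom m) \<and>
     (\<forall>z v. m z = Some v \<longrightarrow>
        (\<exists>x. v x > 0) \<and> (\<forall>x. v x > 0 \<longrightarrow> x \<in> free m) \<and> (\<forall>x. v x \<le> B))"

lemma state_inv_mono:
  "state_inv \<Sigma> c B m \<Longrightarrow> c \<le> c' \<Longrightarrow> B \<le> B' \<Longrightarrow> state_inv \<Sigma> c' B' m"
  unfolding state_inv_def by (meson order_trans)

lemma free_subset_dom: "free m \<subseteq> dom m"
  by (auto simp: free_def)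

lemma state_inv_fresh:
  assumes inv: "state_inv \<Sigma> c B m" and fin: "finite \<Sigma>" and z: "z \<in> \<Sigma> - dom m"
    and v: "v \<notin> ran m" "\<exists>x. v x > 0" "\<And>x. v x > 0 \<Longrightarrow> x \<in> free (m(z \<mapsto> v))" "\<And>x. v x \<le> B"
  shows "state_inv \<Sigma> (Suc c) B (m(z \<mapsto> v))"
proof -
  have m: "m z = None" using z by (auto simp: domIff)
  have findom: "finite (dom m)" using inv fin finite_subset unfolding state_inv_def by blast
  have free: "free m \<subseteq> free (m(z \<mapsto> v))" using m by (auto simp: free_def)
  have "inj_on (m(z \<mapsto> v)) (dom (m(z \<mapsto> v)))"
  proof (rule inj_onI)
    fix x y assume x: "x \<in> dom (m(z \<mapsto> v))" and y: "y \<in> dom (m(z \<mapsto> v))"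
      and eq: "(m(z \<mapsto> v)) x = (m(z \<mapsto> v)) y"
    have nr: "m x \<noteq> Some v" for x using v(1) by (auto simp: ran_def)
    show "x = y"
    proof (cases "x = z \<or> y = z")
      case True
      then show ?thesis using eq nr by (auto split: if_splits)
    next
      case False
      then show ?thesis using eq x y inv unfolding state_inv_def by (auto dest: inj_onD)
    qed
  qed
  moreover have "card (dom (m(z \<mapsto> v))) \<le> Suc c"
    using findom m inv unfolding state_inv_def by (simp add: domIff)
  moreover have "dom (m(z \<mapsto> v)) \<subseteq> \<Sigma>" using z inv unfolding state_inv_def by auto
  moreover have "(\<exists>x. u x > 0) \<and> (\<forall>x. u x > 0 \<longrightarrow> x \<in> free (m(z \<mapsto> v))) \<and> (\<forall>x. u x \<le> B)"
    if "(m(z \<mapsto> v)) y = Some u" for y u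
  proof (cases "y = z")
    case True
    then show ?thesis using that v by simp
  next
    case False
    then have "m y = Some u" using that by simp
    then show ?thesis using inv free unfolding state_inv_def by blast
  qed
  ultimately show ?thesis unfolding state_inv_def by blast
qed

lemma unit_form_notin_ran:
  assumes inv: "state_inv \<Sigma> c B m" and z: "z \<notin> dom m"
  shows "unit_form z \<notin> ran m"
proof
  assume "unit_form z \<in> ran m"
  then obtain y where "m y = Some (unit_form z)" by (auto simp: ran_def)
  moreover have "unit_form z z > 0" by (simp add: unit_form_def)
  ultimately have "z \<in> free m" using inv unfolding state_inv_def by blast
  then show False using z free_subset_dom by blast
qed

lemma state_inv_unit:
  assumes inv: "state_inv \<Sigma> c B m" and fin: "finite \<Sigma>" and z: "z \<in> \<Sigma> - dom m" and B: "B \<ge> 1"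
  shows "state_inv \<Sigma> (Suc c) B (m(z \<mapsto> unit_form z))"
proof (rule state_inv_fresh[OF inv fin z])
  show "unit_form z \<notin> ran m" using unit_form_notin_ran[OF inv] z by blast
  show "\<exists>x. unit_form z x > 0" by (rule exI[of _ z]) (simp add: unit_form_def)
qed (use B in \<open>auto simp: unit_form_def free_def split: if_splits\<close>)

lemma free_unit: "m z = None \<Longrightarrow> free (m(z \<mapsto> unit_form z)) = insert z (free m)"
  by (auto simp: free_def)

lemma free_nonunit: "m z = None \<Longrightarrow> v \<noteq> unit_form z \<Longrightarrow> free (m(z \<mapsto> v)) = free m"
  by (auto simp: free_def)

lemma map_le_fresh: "m z = None \<Longrightarrow> m \<subseteq>\<^sub>m m(z \<mapsto> v)"
  by (auto simp: map_le_def)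

text \<open>
  For \<open>s\<close> samples and a group of order \<open>n\<close> there are about \<open>n\<close> to the power \<open>s\<close> times \<open>N\<close> to the
  power \<open>card (free m) - s\<close> assignments of elements to the known strings; the first factor cancels
  against the probability of the samples, and each assignment extends to \<open>fact (N - card (dom m))\<close>
  of the \<open>fact N\<close> labellings.
\<close>

definition state_weight :: "nat \<Rightarrow> nat \<Rightarrow> state \<Rightarrow> real" where
  "state_weight N s m = real N ^ (card (free m) - s) * fact (N - card (dom m)) / fact N"

lemma state_weight_nonneg: "state_weight N s m \<ge> 0"
  by (simp add: state_weight_def)

text \<open>A new variable multiplies the weight by \<open>N / (N - card (dom m))\<close>, which is
  at least 1, so guessing a string never lowers it. The bound on \<open>s\<close> keeps the
  truncated subtraction exact.\<close>

lemma touch_props: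
  assumes inv: "state_inv \<Sigma> c B m" and fin: "finite \<Sigma>" and z: "z \<in> \<Sigma>" and B: "B \<ge> 1"
    and c: "c < card \<Sigma>" and s: "s \<le> card (free m)"
  shows "state_inv \<Sigma> (Suc c) B (touch z m)" "m \<subseteq>\<^sub>m touch z m" "z \<in> dom (touch z m)"
    "free m \<subseteq> free (touch z m)" "state_weight (card \<Sigma>) s m \<le> state_weight (card \<Sigma>) s (touch z m)"
proof -
  define N where "N = card \<Sigma>"
  have findom: "finite (dom m)" using inv fin finite_subset unfolding state_inv_def by blast
  have "state_inv \<Sigma> (Suc c) B (touch z m) \<and> m \<subseteq>\<^sub>m touch z m \<and> z \<in> dom (touch z m) \<and>
    free m \<subseteq> free (touch z m) \<and> state_weight N s m \<le> state_weight N s (touch z m)"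
  proof (cases "m z = None")
    case True
    then have t: "touch z m = m(z \<mapsto> unit_form z)" by (simp add: touch_def)
    have zd: "z \<in> \<Sigma> - dom m" using z True by auto
    have finf: "finite (free m)" using findom free_subset_dom finite_subset by blast
    have zf: "z \<notin> free m" using True by (simp add: free_def)
    define k where "k = N - Suc (card (dom m))"
    have d: "card (dom m) < N" using inv c unfolding state_inv_def N_def by linarith
    have k: "N - card (dom m) = Suc k" using d k_def by simp
    have "state_weight N s m \<le> state_weight N s (touch z m)"
    proof -
      have a: "card (free (touch z m)) - s = Suc (card (free m) - s)"
        using s zf finf unfolding t free_unit[of m z, OF True] by simp
      have b: "N - card (dom (touch z m)) = k"
        using findom True unfolding t k_def by (simp add: domIff)
      have "real (Suc k) \<le> real N" using k by linarith
      then have "real N ^ (card (free m) - s) * (real (Suc k) * fact k)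
          \<le> real N ^ (card (free m) - s) * (real N * fact k)"
        by (intro mult_left_mono mult_right_mono) auto
      then show ?thesis unfolding state_weight_def a b k
        by (intro divide_right_mono) (simp_all add: algebra_simps)
    qed
    then show ?thesis
      using state_inv_unit[OF inv fin zd B] map_le_fresh[of m z] True free_unit[of m z]
      unfolding t by auto
  next
    case False
    then have "touch z m = m" by (simp only: touch_def if_False)
    then show ?thesis using False state_inv_mono[OF inv, of "Suc c" B] by auto
  qed
  then show "state_inv \<Sigma> (Suc c) B (touch z m)" "m \<subseteq>\<^sub>m touch z m" "z \<in> dom (touch z m)"
    "free m \<subseteq> free (touch z m)" "state_weight (card \<Sigma>) s m \<le> state_weight (card \<Sigma>) s (touch z m)"
    unfolding N_def by blast+
qed

section \<open>The game in which formally different combinations never collide\<close>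

locale ideal_game =
  fixes \<Sigma> :: "bool list set" and dflt :: "bool list"
  assumes fin_\<Sigma>: "finite \<Sigma>" and dflt: "dflt \<in> \<Sigma>"
begin

text \<open>
  The product oracle may behave arbitrarily on strings that encode no element.  Here it treats them
  as aliases of elements, so that guessing strings reveals nothing about the order of the group.
\<close>

definition norm_str :: "bool list \<Rightarrow> bool list" where
  "norm_str z = (if z \<in> \<Sigma> then z else dflt)"

lemma norm_str_in: "norm_str z \<in> \<Sigma>"
  using dflt by (simp add: norm_str_def)

definition prep :: "state \<Rightarrow> bool list \<Rightarrow> bool list \<Rightarrow> state" where
  "prep m a b = touch (norm_str b) (touch (norm_str a) m)"

definition psum :: "state \<Rightarrow> bool list \<Rightarrow> bool list \<Rightarrow> form" where
  "psum m a b = form_add (the (prep m a b (norm_str a))) (the (prep m a b (norm_str b)))"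

fun step :: "state \<Rightarrow> oracle_query \<times> bool list \<Rightarrow> state" where
  "step m (Sample, z) = m(z \<mapsto> unit_form z)"
| "step m (Product a b, z) =
     (if psum m a b \<in> ran (prep m a b) then prep m a b else (prep m a b)(z \<mapsto> psum m a b))"

definition state :: "transcript \<Rightarrow> state" where
  "state h = foldl step Map.empty h"

text \<open>Samples never repeat a known string, and a formally new sum gets a new one. True
  collisions in a group are left out; this is harmless, since likelihoods are only bounded from
  below. The choice by \<open>SOME\<close> is unique as long as the state is injective.\<close>

fun ideal_answer :: "state \<Rightarrow> oracle_query \<Rightarrow> bool list pmf" where
  "ideal_answer m Sample = pmf_of_set (\<Sigma> - dom m)"
| "ideal_answer m (Product a b) =
     (if psum m a b \<in> ran (prep m a b)
      then return_pmf (SOME z. prep m a b z = Some (psum m a b))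
      else pmf_of_set (\<Sigma> - dom (prep m a b)))"

definition ideal :: answers where
  "ideal h u = ideal_answer (state h) u"

definition sampled :: "transcript \<Rightarrow> bool list set" where
  "sampled h = {z. (Sample, z) \<in> set h}"

definition num_samples :: "transcript \<Rightarrow> nat" where
  "num_samples h = length (filter (\<lambda>(u, z). u = Sample) h)"

text \<open>All answers are expressed in one final state. This is possible because known forms never
  change, so a labelling can be tested against the whole transcript at once.\<close>

definition explained :: "state \<Rightarrow> transcript \<Rightarrow> bool" where
  "explained m h \<longleftrightarrow> (\<forall>a b z. (Product a b, z) \<in> set h \<longrightarrow>
     (\<exists>v w. m (norm_str a) = Some v \<and> m (norm_str b) = Some w \<and> m z = Some (form_add v w)))"

lemma explained_mono:
  assumes "explained m h" "m \<subseteq>\<^sub>m m'"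
  shows "explained m' h"
proof -
  have "m' x = Some v" if "m x = Some v" for x v
    using assms(2) that by (metis domI map_le_def)
  then show ?thesis using assms(1) unfolding explained_def by meson
qed

lemma state_snoc: "state (h @ [uz]) = step (state h) uz"
  by (simp add: state_def)

text \<open>A query makes at most three strings known, two operands and the answer, and at most
  doubles the coefficients. The weight bound follows the same induction: operands do not lower the
  weight, and a fresh answer costs exactly its probability.\<close>

lemma ideal_transcript:
  assumes "answer_weight ideal h > 0" "3 * length h < card \<Sigma>"
  shows "state_inv \<Sigma> (3 * length h) (2 ^ length h) (state h) \<and> explained (state h) h \<and>
    sampled h \<subseteq> free (state h) \<and> card (sampled h) = num_samples h \<and>
    answer_weight ideal h \<le> state_weight (card \<Sigma>) (num_samples h) (state h)"
  using assms
proof (induction h rule: rev_induct)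
  case Nil
  have "state [] = Map.empty" by (simp add: state_def)
  moreover have "free Map.empty = {}" by (simp add: free_def)
  ultimately show ?case
    by (simp add: state_inv_def explained_def sampled_def num_samples_def state_weight_def)
next
  case (snoc uz h)
  obtain u z where uz: "uz = (u, z)" by (cases uz)
  define N where "N = card \<Sigma>"
  define m where "m = state h"
  define i where "i = length h"
  define s where "s = num_samples h"
  have aw: "answer_weight ideal (h @ [uz]) = answer_weight ideal h * pmf (ideal_answer m u) z"
    unfolding uz answer_weight_snoc ideal_def m_def by simp
  have pos: "pmf (ideal_answer m u) z > 0" and pos': "answer_weight ideal h > 0"
    using snoc.prems(1) answer_weight_nonneg[of ideal h] pmf_nonneg[of "ideal_answer m u" z]
    unfolding aw by (auto simp: zero_less_mult_iff)
  have zset: "z \<in> set_pmf (ideal_answer m u)" using pos by (simp add: pmf_positive_iff)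
  have N: "3 * i + 3 < N" using snoc.prems(2) by (simp add: i_def N_def)
  have IH: "state_inv \<Sigma> (3 * i) (2 ^ i) m" "explained m h" "sampled h \<subseteq> free m"
      "card (sampled h) = s" "answer_weight ideal h \<le> state_weight N s m"
    using snoc.IH[OF pos'] N unfolding i_def N_def m_def s_def by auto
  have findom: "finite (dom m)" using IH(1) fin_\<Sigma> finite_subset unfolding state_inv_def by blast
  have finf: "finite (free m)" using findom free_subset_dom finite_subset by blast
  have s: "s \<le> card (free m)" using card_mono[OF finf IH(3)] IH(4) by simp
  have one: "(1::nat) \<le> 2 ^ i" by simp
  have fins: "finite (sampled h)" using IH(3) finf finite_subset by blast
  \<comment> \<open>One more known string divides the factorial by \<open>N - card (dom m')\<close>,
    the number of strings available for a fresh answer. For a sample, \<open>s\<close> and the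
    number of free strings grow together.\<close>
  have fact: "state_weight N s' m' * (1 / real (N - card (dom m'))) = state_weight N s'' m''"
    if "card (dom m') < N" "card (dom m'') = Suc (card (dom m'))"
      "card (free m'') - s'' = card (free m') - s'" for m' m'' s' s''
  proof -
    define k where "k = N - Suc (card (dom m'))"
    have k: "N - card (dom m') = Suc k" "N - card (dom m'') = k" using that k_def by auto
    show ?thesis unfolding state_weight_def k that(3) fact_Suc by (simp del: of_nat_Suc)
  qed
  show ?case
  proof (cases u)
    case Sample
    have d: "card (dom m) < N" using IH(1) N unfolding state_inv_def by linarith
    have ne: "\<Sigma> - dom m \<noteq> {}"
    proof
      assume "\<Sigma> - dom m = {}"
      then have "\<Sigma> \<subseteq> dom m" by blast
      then have "N \<le> card (dom m)" unfolding N_def using findom by (intro card_mono)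
      then show False using d by simp
    qed
    have z: "z \<in> \<Sigma> - dom m" using zset Sample ne fin_\<Sigma> by simp
    have mz: "m z = None" using z by (auto simp: domIff)
    have st: "state (h @ [uz]) = m(z \<mapsto> unit_form z)"
      by (simp add: state_snoc uz Sample m_def)
    have sam: "sampled (h @ [uz]) = insert z (sampled h)"
      by (auto simp: sampled_def uz Sample)
    have ns: "num_samples (h @ [uz]) = Suc s"
      by (simp add: num_samples_def uz Sample s_def)
    have zn: "z \<notin> sampled h" using IH(3) free_subset_dom z by blast
    have zf: "z \<notin> free m" using free_subset_dom z by blast
    have "card (\<Sigma> - dom m) = N - card (dom m)"
      using IH(1) findom unfolding N_def state_inv_def by (intro card_Diff_subset) auto
    then have "pmf (ideal_answer m u) z = 1 / real (N - card (dom m))"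
      using z ne fin_\<Sigma> by (simp add: Sample)
    then have "answer_weight ideal (h @ [uz]) \<le> state_weight N s m * (1 / real (N - card (dom m)))"
      unfolding aw using IH(5) by (simp add: divide_right_mono)
    also have "\<dots> = state_weight N (Suc s) (m(z \<mapsto> unit_form z))"
      by (rule fact[OF d]) (use findom mz zf finf s in \<open>simp_all add: domIff free_unit\<close>)
    finally have 5: "answer_weight ideal (h @ [uz]) \<le> state_weight N (Suc s) (m(z \<mapsto> unit_form z))" .
    have 1: "state_inv \<Sigma> (3 * length (h @ [uz])) (2 ^ length (h @ [uz])) (m(z \<mapsto> unit_form z))"
      by (rule state_inv_mono[OF state_inv_unit[OF IH(1) fin_\<Sigma> z one]]) (simp_all add: i_def)
    have "explained (m(z \<mapsto> unit_form z)) h"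
      by (rule explained_mono[OF IH(2) map_le_fresh[of m z, OF mz]])
    then have 2: "explained (m(z \<mapsto> unit_form z)) (h @ [uz])"
      unfolding explained_def uz Sample by simp
    have 3: "sampled (h @ [uz]) \<subseteq> free (m(z \<mapsto> unit_form z))"
      unfolding sam free_unit[of m z, OF mz] using IH(3) by blast
    have 4: "card (sampled (h @ [uz])) = Suc s" unfolding sam using zn fins IH(4) by simp
    show ?thesis unfolding st ns using 1 2 3 4 5 N_def by blast
  next
    case (Product a b)
    define t where "t = touch (norm_str a) m"
    define m' where "m' = prep m a b"
    have m't: "m' = touch (norm_str b) t" by (simp add: m'_def prep_def t_def)
    have c1: "3 * i < card \<Sigma>" and c2: "Suc (3 * i) < card \<Sigma>" using N N_def by auto
    note T1 = touch_props[OF IH(1) fin_\<Sigma> norm_str_in[of a] one c1 s, folded t_def N_def]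
    have fint: "finite (dom t)" using T1(1) fin_\<Sigma> finite_subset unfolding state_inv_def by blast
    have s2: "s \<le> card (free t)"
      using s T1(4) fint free_subset_dom[of t] by (meson card_mono finite_subset le_trans)
    note T2 = touch_props[OF T1(1) fin_\<Sigma> norm_str_in[of b] one c2 s2, folded m't N_def]
    have finm': "finite (dom m')" using T2(1) fin_\<Sigma> finite_subset unfolding state_inv_def by blast
    have le: "m \<subseteq>\<^sub>m m'" using T1(2) T2(2) by (rule map_le_trans)
    have w: "state_weight N s m \<le> state_weight N s m'" using T1(5) T2(5) by linarith
    have fm: "free m \<subseteq> free m'" using T1(4) T2(4) by blast
    have da: "norm_str a \<in> dom m'"
      using T1(3) T2(2) map_le_implies_dom_le by blast
    obtain va where va: "m' (norm_str a) = Some va" using da by blast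
    obtain vb where vb: "m' (norm_str b) = Some vb" using T2(3) by blast
    have psum: "psum m a b = form_add va vb"
      using va vb by (simp add: psum_def m'_def)
    have pa: "(\<exists>x. va x > 0) \<and> (\<forall>x. va x > 0 \<longrightarrow> x \<in> free m') \<and> (\<forall>x. va x \<le> 2 ^ i)"
      using T2(1) va unfolding state_inv_def by blast
    have pb: "(\<exists>x. vb x > 0) \<and> (\<forall>x. vb x > 0 \<longrightarrow> x \<in> free m') \<and> (\<forall>x. vb x \<le> 2 ^ i)"
      using T2(1) vb unfolding state_inv_def by blast
    have d: "card (dom m') < N" using T2(1) N unfolding state_inv_def by linarith
    have sam: "sampled (h @ [uz]) = sampled h" by (auto simp: sampled_def uz Product)
    have ns: "num_samples (h @ [uz]) = s" by (simp add: num_samples_def uz Product s_def)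
    have sub: "sampled (h @ [uz]) \<subseteq> free m'" using IH(3) fm sam by simp
    show ?thesis
    proof (cases "psum m a b \<in> ran m'")
      case True
      have st: "state (h @ [uz]) = m'"
        using True by (simp add: state_snoc uz Product flip: m_def m'_def)
      have ex: "\<exists>z. m' z = Some (psum m a b)" using True by (auto simp: ran_def)
      have "z = (SOME z. m' z = Some (psum m a b))"
        using zset True by (simp add: Product flip: m'_def)
      then have z: "m' z = Some (form_add va vb)" using someI_ex[OF ex] psum by simp
      have "explained m' h" by (rule explained_mono[OF IH(2) le])
      then have 2: "explained m' (h @ [uz])"
        unfolding explained_def uz Product using va vb z by auto
      have 1: "state_inv \<Sigma> (3 * length (h @ [uz])) (2 ^ length (h @ [uz])) m'"
        by (rule state_inv_mono[OF T2(1)]) (simp_all add: i_def)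
      have "answer_weight ideal (h @ [uz]) \<le> answer_weight ideal h * 1"
        unfolding aw using pos' by (intro mult_left_mono pmf_le_1) simp
      then have "answer_weight ideal (h @ [uz]) \<le> state_weight N s m'"
        using IH(5) w by linarith
      then show ?thesis unfolding st ns using 1 2 sub sam IH(4) N_def by simp
    next
      case False
      have st: "state (h @ [uz]) = m'(z \<mapsto> form_add va vb)"
        using False psum by (simp add: state_snoc uz Product flip: m_def m'_def)
      have ne: "\<Sigma> - dom m' \<noteq> {}"
      proof
        assume "\<Sigma> - dom m' = {}"
        then have "\<Sigma> \<subseteq> dom m'" by blast
        then have "N \<le> card (dom m')" unfolding N_def using finm' by (intro card_mono)
        then show False using d by simp
      qed
      have ia: "ideal_answer m u = pmf_of_set (\<Sigma> - dom m')"
        using False by (simp add: Product flip: m'_def)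
      have z: "z \<in> \<Sigma> - dom m'" using zset ne fin_\<Sigma> unfolding ia by simp
      have mz: "m' z = None" using z by (auto simp: domIff)
      have nu: "form_add va vb \<noteq> unit_form z" using pa pb by (intro form_add_neq_unit_form) auto
      have fr: "free (m'(z \<mapsto> form_add va vb)) = free m'" by (rule free_nonunit[of m' z, OF mz nu])
      have "state_inv \<Sigma> (Suc (Suc (Suc (3 * i)))) (2 ^ Suc i) (m'(z \<mapsto> form_add va vb))"
      proof (rule state_inv_fresh[OF _ fin_\<Sigma> z])
        show "state_inv \<Sigma> (Suc (Suc (3 * i))) (2 ^ Suc i) m'"
          by (rule state_inv_mono[OF T2(1)]) simp_all
        show "form_add va vb \<notin> ran m'" using False psum by simp
        show "\<exists>x. form_add va vb x > 0" using pa by (auto simp: form_add_def)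
        show "x \<in> free (m'(z \<mapsto> form_add va vb))" if "form_add va vb x > 0" for x
          using that pa pb unfolding fr by (auto simp: form_add_def)
        show "form_add va vb x \<le> 2 ^ Suc i" for x
          using pa pb by (simp add: form_add_def mult_2 add_mono)
      qed
      then have 1: "state_inv \<Sigma> (3 * length (h @ [uz])) (2 ^ length (h @ [uz])) (m'(z \<mapsto> form_add va vb))"
        by (rule state_inv_mono) (simp_all add: i_def)
      have le': "m' \<subseteq>\<^sub>m m'(z \<mapsto> form_add va vb)" by (rule map_le_fresh[of m' z, OF mz])
      have "explained (m'(z \<mapsto> form_add va vb)) h"
        by (rule explained_mono[OF IH(2) map_le_trans[OF le le']])
      moreover have "norm_str a \<noteq> z" "norm_str b \<noteq> z" using va vb mz by auto
      ultimately have 2: "explained (m'(z \<mapsto> form_add va vb)) (h @ [uz])"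
        unfolding explained_def uz Product using va vb by auto
      have "card (\<Sigma> - dom m') = N - card (dom m')"
        using T2(1) finm' unfolding N_def state_inv_def by (intro card_Diff_subset) auto
      then have "pmf (ideal_answer m u) z = 1 / real (N - card (dom m'))"
        using z ne fin_\<Sigma> unfolding ia by simp
      then have "answer_weight ideal (h @ [uz]) = answer_weight ideal h * (1 / real (N - card (dom m')))"
        unfolding aw by simp
      also have "\<dots> \<le> state_weight N s m' * (1 / real (N - card (dom m')))"
        using IH(5) w by (intro mult_right_mono) auto
      also have "\<dots> = state_weight N s (m'(z \<mapsto> form_add va vb))"
        by (rule fact[OF d]) (use finm' mz in \<open>simp_all add: domIff fr\<close>)
      finally have 5: "answer_weight ideal (h @ [uz]) \<le> state_weight N s (m'(z \<mapsto> form_add va vb))" .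
      have 3: "sampled (h @ [uz]) \<subseteq> free (m'(z \<mapsto> form_add va vb))" unfolding fr by (rule sub)
      have 4: "card (sampled (h @ [uz])) = s" using sam IH(4) by simp
      show ?thesis unfolding st ns using 1 2 3 4 5[unfolded N_def] by blast
    qed
  qed
qed

end


section \<open>Group oracles compared with the ideal game\<close>

text \<open>One permutation \<open>\<pi>0\<close> with the prescribed values exists by matching the
  complements; composing it with the permutations that fix the image of \<open>W\<close> under
  \<open>y\<close> gives all the others needed.\<close>

lemma fact_le_card_permutations_extending:
  fixes g :: "nat \<Rightarrow> 'a" and y :: "'a \<Rightarrow> nat"
  assumes g: "bij_betw g {..<N} \<Sigma>" and W: "W \<subseteq> \<Sigma>" and inj: "inj_on y W" and yW: "y ` W \<subseteq> {..<N}"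
  shows "fact (N - card W) \<le> card {\<pi>. \<pi> permutes {..<N} \<and> (\<forall>z\<in>W. g (\<pi> (y z)) = z)}"
proof -
  define A where "A = {..<N}"
  have finA: "finite A" by (simp add: A_def)
  define g' where "g' = the_inv_into A g"
  have g': "bij_betw g' \<Sigma> A" unfolding g'_def using g A_def by (simp add: bij_betw_the_inv_into)
  have gg': "g (g' z) = z" if "z \<in> \<Sigma>" for z
    using g that f_the_inv_into_f_bij_betw[of g A \<Sigma> z] unfolding g'_def A_def by blast
  have fin\<Sigma>: "finite \<Sigma>" using g bij_betw_finite by blast
  have finW: "finite W" using W fin\<Sigma> finite_subset by blast
  define Y where "Y = y ` W"
  define X where "X = g' ` W"
  have YA: "Y \<subseteq> A" using yW by (simp add: Y_def A_def)
  have XA: "X \<subseteq> A" using g' W unfolding X_def bij_betw_def by blast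
  have inj': "inj_on g' W" using g' W unfolding bij_betw_def by (meson inj_on_subset)
  have cY: "card Y = card W" unfolding Y_def using inj by (rule card_image)
  have cX: "card X = card W" unfolding X_def using inj' by (rule card_image)
  have "card (A - Y) = card (A - X)"
    using YA XA finA cX cY by (simp add: card_Diff_subset finite_subset)
  then obtain b where b: "bij_betw b (A - Y) (A - X)"
    using finite_same_card_bij[of "A - Y" "A - X"] finA by auto
  define f0 where "f0 = g' \<circ> the_inv_into W y"
  have f0: "bij_betw f0 Y X"
    unfolding f0_def
  proof (rule bij_betw_trans)
    show "bij_betw (the_inv_into W y) Y W"
      using inj by (intro bij_betw_the_inv_into) (simp add: bij_betw_def Y_def)
    show "bij_betw g' W X" using inj' by (simp add: bij_betw_def X_def)
  qed
  define \<pi>0 where "\<pi>0 x = (if x \<in> Y then f0 x else if x \<in> A then b x else x)" for x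
  have "bij_betw \<pi>0 Y X"
    using f0 by (rule bij_betw_cong[THEN iffD1, rotated]) (simp add: \<pi>0_def)
  moreover have "bij_betw \<pi>0 (A - Y) (A - X)"
    using b by (rule bij_betw_cong[THEN iffD1, rotated]) (simp add: \<pi>0_def)
  ultimately have "bij_betw \<pi>0 (Y \<union> (A - Y)) (X \<union> (A - X))"
    by (rule bij_betw_combine) blast
  moreover have "Y \<union> (A - Y) = A" "X \<union> (A - X) = A" using YA XA by blast+
  ultimately have "bij_betw \<pi>0 A A" by simp
  then have \<pi>0: "\<pi>0 permutes A"
    by (rule bij_imp_permutes) (use YA in \<open>auto simp: \<pi>0_def\<close>)
  have \<pi>0y: "\<pi>0 (y z) = g' z" if "z \<in> W" for z
    using that inj the_inv_into_f_f[of y W z] unfolding \<pi>0_def f0_def Y_def by simp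
  have "card {\<pi>. \<pi> permutes (A - Y)} \<le> card {\<pi>. \<pi> permutes A \<and> (\<forall>z\<in>W. g (\<pi> (y z)) = z)}"
  proof (rule card_inj_on_le[where f = "\<lambda>\<pi>. \<pi>0 \<circ> \<pi>"])
    show "inj_on (\<lambda>\<pi>. \<pi>0 \<circ> \<pi>) {\<pi>. \<pi> permutes A - Y}"
    proof (rule inj_onI)
      fix \<pi> \<pi>' assume "\<pi>0 \<circ> \<pi> = \<pi>0 \<circ> \<pi>'"
      then show "\<pi> = \<pi>'" using permutes_inj[OF \<pi>0] by (simp add: fun.inj_map_strong fun_eq_iff inj_eq)
    qed
    show "(\<lambda>\<pi>. \<pi>0 \<circ> \<pi>) ` {\<pi>. \<pi> permutes A - Y} \<subseteq> {\<pi>. \<pi> permutes A \<and> (\<forall>z\<in>W. g (\<pi> (y z)) = z)}"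
    proof (rule image_subsetI)
      fix \<pi> assume "\<pi> \<in> {\<pi>. \<pi> permutes A - Y}"
      then have \<pi>: "\<pi> permutes (A - Y)" by simp
      have "\<pi>0 \<circ> \<pi> permutes A"
        using permutes_compose[OF permutes_subset[OF \<pi>] \<pi>0] by blast
      moreover have "g ((\<pi>0 \<circ> \<pi>) (y z)) = z" if "z \<in> W" for z
      proof -
        have "\<pi> (y z) = y z" using permutes_not_in[OF \<pi>] that by (simp add: Y_def)
        then show ?thesis using \<pi>0y gg' that W by auto
      qed
      ultimately show "\<pi>0 \<circ> \<pi> \<in> {\<pi>. \<pi> permutes A \<and> (\<forall>z\<in>W. g (\<pi> (y z)) = z)}" by blast
    qed
    show "finite {\<pi>. \<pi> permutes A \<and> (\<forall>z\<in>W. g (\<pi> (y z)) = z)}"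
      by (rule finite_subset[OF _ finite_permutations[OF finA]]) blast
  qed
  moreover have "card {\<pi>. \<pi> permutes (A - Y)} = fact (N - card W)"
    by (rule card_permutations) (use finA YA cY in \<open>auto simp: card_Diff_subset finite_subset A_def\<close>)
  ultimately show ?thesis by (simp add: A_def)
qed

lemma card_PiE_filter_le:
  assumes I: "finite I" "x \<in> I" and fin: "\<And>i. i \<in> I \<Longrightarrow> finite (A i)"
    and le: "\<And>u. u \<in> PiE (I - {x}) A \<Longrightarrow> n * card {a \<in> A x. Q (u(x := a))} \<le> c * card (A x)"
  shows "n * card {u \<in> PiE I A. Q u} \<le> c * card (PiE I A)"
proof -
  define J where "J = I - {x}"
  have IJ: "I = insert x J" "x \<notin> J" "finite J" using I J_def by auto
  have finJ: "finite (PiE J A)" using fin IJ by (intro finite_PiE) auto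
  define S where "S = Sigma (PiE J A) (\<lambda>u. {a \<in> A x. Q (u(x := a))})"
  have "{u \<in> PiE I A. Q u} \<subseteq> (\<lambda>(u, a). u(x := a)) ` S"
  proof
    fix u assume "u \<in> {u \<in> PiE I A. Q u}"
    then have u: "u \<in> PiE I A" "Q u" by auto
    have "(u(x := undefined), u x) \<in> S"
      using u IJ by (auto simp: S_def PiE_def extensional_def Pi_def)
    moreover have "u = (\<lambda>(u, a). u(x := a)) (u(x := undefined), u x)" by simp
    ultimately show "u \<in> (\<lambda>(u, a). u(x := a)) ` S" by (rule rev_image_eqI)
  qed
  then have "card {u \<in> PiE I A. Q u} \<le> card S"
    by (rule surj_card_le[rotated]) (use finJ fin I in \<open>auto simp: S_def intro!: finite_SigmaI\<close>)
  also have "card S = (\<Sum>u\<in>PiE J A. card {a \<in> A x. Q (u(x := a))})"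
    unfolding S_def using finJ fin I by (intro card_SigmaI) auto
  finally have "n * card {u \<in> PiE I A. Q u} \<le> n * (\<Sum>u\<in>PiE J A. card {a \<in> A x. Q (u(x := a))})"
    by (rule mult_le_mono2)
  also have "\<dots> = (\<Sum>u\<in>PiE J A. n * card {a \<in> A x. Q (u(x := a))})" by (rule sum_distrib_left)
  also have "\<dots> \<le> (\<Sum>u\<in>PiE J A. c * card (A x))" using le by (intro sum_mono) (simp add: J_def)
  also have "\<dots> = c * card (PiE I A)" using IJ by (simp add: card_PiE)
  finally show ?thesis .
qed

text \<open>The factor 2 pays for an incomplete last block, as \<open>L\<close> need not be a
  multiple of \<open>n\<close>.\<close>

lemma card_residue_le:
  assumes "n > 0" "n \<le> L"
  shows "n * card {a \<in> {..<L}. a mod n = r} \<le> 2 * L"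
proof -
  have "card {a \<in> {..<L}. a mod n = r} \<le> card {..L div n}"
  proof (rule card_inj_on_le[where f = "\<lambda>a. a div n"])
    show "inj_on (\<lambda>a. a div n) {a \<in> {..<L}. a mod n = r}"
    proof (rule inj_onI)
      fix a b assume "a \<in> {a \<in> {..<L}. a mod n = r}" "b \<in> {a \<in> {..<L}. a mod n = r}" "a div n = b div n"
      then show "a = b" using div_mult_mod_eq[of a n] div_mult_mod_eq[of b n] by simp
    qed
  qed (auto intro: div_le_mono)
  then have "n * card {a \<in> {..<L}. a mod n = r} \<le> n * card {..L div n}" by (rule mult_le_mono2)
  also have "\<dots> = n * (L div n) + n" by simp
  also have "\<dots> \<le> L + L" using assms by (intro add_mono) auto
  finally show ?thesis by simp
qed

text \<open>Forms that agree modulo \<open>p\<close> always have equal values in the elementary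
  abelian group but need not in the cyclic one. These coincidences are what makes a prime
  unlucky.\<close>

definition separated :: "nat \<Rightarrow> state \<Rightarrow> bool" where
  "separated p m \<longleftrightarrow> (\<forall>z\<in>dom m. \<forall>z'\<in>dom m. z \<noteq> z' \<longrightarrow>
     (\<exists>x. \<not> int p dvd int (the (m z) x) - int (the (m z') x)))"

context pair_group
begin

lemma K_minus: "K a b \<Longrightarrow> K (- a) (- b)"
  using enc_eq_iff[of a b 0 0] enc_eq_iff[of 0 0 a b] by simp

text \<open>Variables range over indices of labels, which may exceed \<open>p^2\<close>, so they are
  reduced before their digits are taken.\<close>

definition val :: "bool list set \<Rightarrow> form \<Rightarrow> (bool list \<Rightarrow> nat) \<Rightarrow> nat" where
  "val I v u = enc (\<Sum>x\<in>I. int (v x) * int (u x mod p\<^sup>2 mod p)) (\<Sum>x\<in>I. int (v x) * int (u x mod p\<^sup>2 div p))"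

lemma val_less: "val I v u < p\<^sup>2"
  unfolding val_def by (rule enc_less)

lemma val_form_add: "val I (form_add v w) u = op (val I v u) (val I w u)"
  unfolding val_def op_enc form_add_def by (simp add: sum.distrib distrib_right)

lemma p2_pos: "p\<^sup>2 > 0"
  using prime_gt_0_nat[OF prime] by simp

lemma val_unit_form:
  assumes "finite I" "z \<in> I"
  shows "val I (unit_form z) u = u z mod p\<^sup>2"
proof -
  have *: "(\<Sum>x\<in>I. int (unit_form z x) * f x) = f z" for f :: "bool list \<Rightarrow> int"
  proof -
    have "(\<Sum>x\<in>I. int (unit_form z x) * f x) = (\<Sum>x\<in>I. if x = z then f x else 0)"
      by (rule sum.cong) (auto simp: unit_form_def)
    then show ?thesis using assms by simp
  qed
  show ?thesis unfolding val_def * by (rule enc_digits) (rule mod_less_divisor[OF p2_pos])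
qed

text \<open>Subtracting the two coincidences removes the other variables and leaves a coefficient
  prime to \<open>p\<close> times the digit difference of \<open>a\<close> and \<open>b\<close>,
  which \<open>K_cancel\<close> removes. So a collision fixes one variable modulo
  \<open>p^2\<close>.\<close>

lemma val_separates:
  assumes fin: "finite I" and x: "x \<in> I" and sep: "\<not> int p dvd int (v x) - int (w x)"
    and eq: "val I v (u(x := a)) = val I w (u(x := a))" "val I v (u(x := b)) = val I w (u(x := b))"
  shows "a mod p\<^sup>2 = b mod p\<^sup>2"
proof -
  define J where "J = I - {x}"
  define d1 where "d1 t = int (t mod p\<^sup>2 mod p)" for t
  define d2 where "d2 t = int (t mod p\<^sup>2 div p)" for t
  define k where "k = int (v x) - int (w x)"
  define R1 where "R1 v = (\<Sum>t\<in>J. int (v t) * d1 (u t))" for v :: form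
  define R2 where "R2 v = (\<Sum>t\<in>J. int (v t) * d2 (u t))" for v :: form
  have split: "(\<Sum>t\<in>I. int (f t) * d ((u(x := c)) t)) = int (f x) * d c + (\<Sum>t\<in>J. int (f t) * d (u t))"
    for f :: form and d :: "nat \<Rightarrow> int" and c
  proof -
    have "(\<Sum>t\<in>I. int (f t) * d ((u(x := c)) t))
        = int (f x) * d ((u(x := c)) x) + (\<Sum>t\<in>J. int (f t) * d ((u(x := c)) t))"
      unfolding J_def using fin x by (rule sum.remove)
    also have "(\<Sum>t\<in>J. int (f t) * d ((u(x := c)) t)) = (\<Sum>t\<in>J. int (f t) * d (u t))"
      by (rule sum.cong) (auto simp: J_def)
    finally show ?thesis by simp
  qed
  have val: "val I f (u(x := c)) = enc (int (f x) * d1 c + R1 f) (int (f x) * d2 c + R2 f)" for f c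
    using split[of f d1 c] split[of f d2 c] unfolding val_def R1_def R2_def by (simp only: d1_def d2_def)
  have K: "K (k * d1 c + (R1 v - R1 w)) (k * d2 c + (R2 v - R2 w))"
    if "val I v (u(x := c)) = val I w (u(x := c))" for c
  proof -
    have "K (int (v x) * d1 c + R1 v - (int (w x) * d1 c + R1 w)) (int (v x) * d2 c + R2 v - (int (w x) * d2 c + R2 w))"
      using that unfolding val enc_eq_iff .
    then show ?thesis by (simp add: k_def algebra_simps)
  qed
  have "K (k * (d1 a - d1 b)) (k * (d2 a - d2 b))"
    using K_add[OF K[OF eq(1)] K_minus[OF K[OF eq(2)]]] by (simp add: algebra_simps)
  then have "K (d1 a - d1 b) (d2 a - d2 b)" by (rule K_cancel[rotated]) (use sep k_def in simp)
  then have "enc (d1 a) (d2 a) = enc (d1 b) (d2 b)" by (simp add: enc_eq_iff)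
  then show ?thesis unfolding d1_def d2_def by (simp only: enc_digits mod_less_divisor p2_pos)
qed

text \<open>Intended indices of the known strings. A free string may be an alias and keeps its full
  index; the answer to a product is the label of a true element, below \<open>p^2\<close>.\<close>

definition assign :: "state \<Rightarrow> (bool list \<Rightarrow> nat) \<Rightarrow> bool list \<Rightarrow> nat" where
  "assign m u z = (if z \<in> free m then u z else val (free m) (the (m z)) u)"

lemma assign_mod:
  assumes "finite (free m)"
  shows "assign m u z mod p\<^sup>2 = val (free m) (the (m z)) u"
proof (cases "z \<in> free m")
  case True
  then have "m z = Some (unit_form z)" by (simp add: free_def)
  then show ?thesis using val_unit_form[OF assms True] True by (simp add: assign_def)
qed (simp add: assign_def val_less)

text \<open>Union bound over at most \<open>c^2\<close> pairs. Equal indices imply equal values, and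
  with all other variables fixed this leaves one residue class for a separating variable.\<close>

lemma card_noninjective_assignments:
  assumes inv: "state_inv \<Sigma> c B m" and fin: "finite \<Sigma>" and sep: "separated p m"
    and L: "\<And>x. p\<^sup>2 \<le> L x"
  shows "p\<^sup>2 * card {u \<in> PiE (free m) (\<lambda>x. {..<L x}). \<not> inj_on (assign m u) (dom m)}
    \<le> 2 * c\<^sup>2 * card (PiE (free m) (\<lambda>x. {..<L x}))"
proof -
  define I where "I = free m"
  define U where "U = PiE I (\<lambda>x. {..<L x})"
  have findom: "finite (dom m)" using inv fin finite_subset unfolding state_inv_def by blast
  have finI: "finite I" using findom free_subset_dom finite_subset unfolding I_def by blast
  have finU: "finite U" unfolding U_def using finI by (intro finite_PiE) auto
  define D where "D = {(z, z') \<in> dom m \<times> dom m. z \<noteq> z'}"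
  have finD: "finite D"
    by (rule finite_subset[of _ "dom m \<times> dom m"]) (use findom in \<open>auto simp: D_def\<close>)
  define C where "C zz = {u \<in> U. val I (the (m (fst zz))) u = val I (the (m (snd zz))) u}" for zz
  have C: "p\<^sup>2 * card (C zz) \<le> 2 * card U" if zz: "zz \<in> D" for zz
  proof -
    obtain z z' where z: "zz = (z, z')" "z \<in> dom m" "z' \<in> dom m" "z \<noteq> z'" using zz D_def by auto
    obtain v w where vw: "m z = Some v" "m z' = Some w" using z by blast
    then obtain x where x: "\<not> int p dvd int (v x) - int (w x)"
      using sep z unfolding separated_def by (metis option.sel)
    have "v x > 0 \<or> w x > 0"
    proof (rule ccontr)
      assume "\<not> ?thesis"
      then show False using x by simp
    qed
    then have xI: "x \<in> I" using inv vw unfolding state_inv_def I_def by blast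
    have "p\<^sup>2 * card {u \<in> PiE I (\<lambda>x. {..<L x}). val I v u = val I w u} \<le> 2 * card (PiE I (\<lambda>x. {..<L x}))"
    proof (rule card_PiE_filter_le[OF finI xI])
      fix u
      define E where "E = {a \<in> {..<L x}. val I v (u(x := a)) = val I w (u(x := a))}"
      show "p\<^sup>2 * card E \<le> 2 * card {..<L x}"
      proof (cases "E = {}")
        case False
        then obtain b where b: "b \<in> E" by blast
        have "E \<subseteq> {a \<in> {..<L x}. a mod p\<^sup>2 = b mod p\<^sup>2}"
        proof
          fix a assume a: "a \<in> E"
          then have "a mod p\<^sup>2 = b mod p\<^sup>2"
            using b by (intro val_separates[of I x v w u, OF finI xI x]) (simp_all add: E_def)
          then show "a \<in> {a \<in> {..<L x}. a mod p\<^sup>2 = b mod p\<^sup>2}" using a by (simp add: E_def)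
        qed
        then have "card E \<le> card {a \<in> {..<L x}. a mod p\<^sup>2 = b mod p\<^sup>2}"
          by (intro card_mono) auto
        then have "p\<^sup>2 * card E \<le> p\<^sup>2 * card {a \<in> {..<L x}. a mod p\<^sup>2 = b mod p\<^sup>2}"
          by (rule mult_le_mono2)
        also have "\<dots> \<le> 2 * L x" by (rule card_residue_le[OF p2_pos L])
        finally show ?thesis by simp
      qed simp
    qed simp
    then show ?thesis unfolding C_def U_def z by (simp add: vw)
  qed
  have "{u \<in> U. \<not> inj_on (assign m u) (dom m)} \<subseteq> (\<Union>zz\<in>D. C zz)"
  proof
    fix u assume "u \<in> {u \<in> U. \<not> inj_on (assign m u) (dom m)}"
    then have u: "u \<in> U" and "\<not> inj_on (assign m u) (dom m)" by auto
    then obtain z z' where z: "z \<in> dom m" "z' \<in> dom m" "z \<noteq> z'" "assign m u z = assign m u z'"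
      unfolding inj_on_def by blast
    have "val I (the (m z)) u = val I (the (m z')) u"
      using assign_mod[of m u z] assign_mod[of m u z'] z(4) finI unfolding I_def by simp
    then have "u \<in> C (z, z')" using u by (simp add: C_def)
    moreover have "(z, z') \<in> D" using z by (simp add: D_def)
    ultimately show "u \<in> (\<Union>zz\<in>D. C zz)" by blast
  qed
  then have "card {u \<in> U. \<not> inj_on (assign m u) (dom m)} \<le> card (\<Union>zz\<in>D. C zz)"
    using finD finU by (intro card_mono) (auto simp: C_def)
  also have "\<dots> \<le> (\<Sum>zz\<in>D. card (C zz))" using finD by (rule card_UN_le)
  finally have "p\<^sup>2 * card {u \<in> U. \<not> inj_on (assign m u) (dom m)} \<le> p\<^sup>2 * (\<Sum>zz\<in>D. card (C zz))"
    by (rule mult_le_mono2)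
  also have "\<dots> = (\<Sum>zz\<in>D. p\<^sup>2 * card (C zz))" by (rule sum_distrib_left)
  also have "\<dots> \<le> (\<Sum>zz\<in>D. 2 * card U)" using C by (rule sum_mono)
  also have "\<dots> = card D * (2 * card U)" by simp
  also have "\<dots> \<le> c\<^sup>2 * (2 * card U)"
  proof (rule mult_le_mono1)
    have "card D \<le> card (dom m \<times> dom m)" unfolding D_def using findom by (intro card_mono) auto
    also have "\<dots> \<le> c * c"
      using inv unfolding state_inv_def by (simp add: card_cartesian_product mult_le_mono)
    finally show "card D \<le> c\<^sup>2" by (simp add: power2_eq_square)
  qed
  finally show ?thesis unfolding U_def I_def by (simp add: algebra_simps)
qed

end

section \<open>Group oracles under a random labelling\<close>

locale group_game = pair_group p enc K + ideal_game \<Sigma> dflt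
  for p enc K \<Sigma> dflt +
  fixes g :: "nat \<Rightarrow> bool list"
  assumes bij_g: "bij_betw g {..<card \<Sigma>} \<Sigma>" and p2_le: "p\<^sup>2 \<le> card \<Sigma>"
begin

definition label :: "(nat \<Rightarrow> nat) \<Rightarrow> nat \<Rightarrow> bool list" where
  "label \<pi> = g \<circ> \<pi>"

text \<open>Reduction modulo \<open>p^2\<close> fixes the behaviour on strings that encode no
  element; on true labels it changes nothing.\<close>

definition unlabel :: "(nat \<Rightarrow> nat) \<Rightarrow> bool list \<Rightarrow> nat" where
  "unlabel \<pi> z = the_inv_into {..<card \<Sigma>} (label \<pi>) (norm_str z) mod p\<^sup>2"

definition sample_oracle :: "(nat \<Rightarrow> nat) \<Rightarrow> bool list pmf" where
  "sample_oracle \<pi> = map_pmf (label \<pi>) (pmf_of_set {..<p\<^sup>2})"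

definition product_oracle :: "(nat \<Rightarrow> nat) \<Rightarrow> bool list \<Rightarrow> bool list \<Rightarrow> bool list" where
  "product_oracle \<pi> a b = label \<pi> (op (unlabel \<pi> a) (unlabel \<pi> b))"

lemma bij_label:
  assumes "\<pi> permutes {..<card \<Sigma>}"
  shows "bij_betw (label \<pi>) {..<card \<Sigma>} \<Sigma>"
  unfolding label_def using permutes_imp_bij[OF assms] bij_g by (rule bij_betw_trans)

lemma inj_label:
  assumes "\<pi> permutes {..<card \<Sigma>}"
  shows "inj_on (label \<pi>) {..<p\<^sup>2}"
  using bij_label[OF assms] p2_le unfolding bij_betw_def
  by (meson inj_on_subset lessThan_subset_iff)

lemma unlabel_label:
  assumes "\<pi> permutes {..<card \<Sigma>}" "i < card \<Sigma>"
  shows "unlabel \<pi> (label \<pi> i) = i mod p\<^sup>2"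
proof -
  have b: "bij_betw (label \<pi>) {..<card \<Sigma>} \<Sigma>" by (rule bij_label[OF assms(1)])
  then have "label \<pi> i \<in> \<Sigma>" using assms(2) by (auto simp: bij_betw_def)
  moreover have "the_inv_into {..<card \<Sigma>} (label \<pi>) (label \<pi> i) = i"
    using b assms(2) by (intro the_inv_into_f_f) (auto simp: bij_betw_def)
  ultimately show ?thesis by (simp add: unlabel_def norm_str_def)
qed

lemma binary_structure_oracles:
  assumes \<pi>: "\<pi> permutes {..<card \<Sigma>}" and q: "p\<^sup>2 \<le> q" "\<Sigma> = bitstrings q"
  shows "binary_structure {..<p\<^sup>2} op q (sample_oracle \<pi>) (product_oracle \<pi>)"
proof -
  have "product_oracle \<pi> (label \<pi> i) (label \<pi> j) =
      label \<pi> (op (the_inv_into {..<p\<^sup>2} (label \<pi>) (label \<pi> i)) (the_inv_into {..<p\<^sup>2} (label \<pi>) (label \<pi> j)))"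
    if "i < p\<^sup>2" "j < p\<^sup>2" for i j
    using that p2_le unlabel_label[OF \<pi>] the_inv_into_f_f[OF inj_label[OF \<pi>]]
    unfolding product_oracle_def by simp
  moreover have "label \<pi> ` {..<p\<^sup>2} \<subseteq> bitstrings q"
    using bij_label[OF \<pi>] p2_le q(2) unfolding bij_betw_def by auto
  ultimately show ?thesis
    unfolding binary_structure_def sample_oracle_def using q inj_label[OF \<pi>]
    by (intro conjI exI[of _ "label \<pi>"]) auto
qed

definition consistent :: "(nat \<Rightarrow> nat) \<Rightarrow> transcript \<Rightarrow> bool" where
  "consistent \<pi> h \<longleftrightarrow> (\<forall>z. (Sample, z) \<in> set h \<longrightarrow> z \<in> label \<pi> ` {..<p\<^sup>2}) \<and>
     (\<forall>a b z. (Product a b, z) \<in> set h \<longrightarrow> product_oracle \<pi> a b = z)"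

lemma answer_weight_consistent:
  assumes \<pi>: "\<pi> permutes {..<card \<Sigma>}" and "consistent \<pi> h"
  shows "answer_weight (\<lambda>_. answer (sample_oracle \<pi>) (product_oracle \<pi>)) h = (1 / real (p\<^sup>2)) ^ num_samples h"
  using assms(2)
proof (induction h rule: rev_induct)
  case Nil
  then show ?case by (simp add: num_samples_def)
next
  case (snoc uz h)
  obtain u z where uz: "uz = (u, z)" by (cases uz)
  have con: "consistent \<pi> h" using snoc.prems unfolding consistent_def by auto
  show ?case
  proof (cases u)
    case Sample
    then obtain i where i: "i < p\<^sup>2" "z = label \<pi> i"
      using snoc.prems unfolding consistent_def uz by auto
    have ne: "{..<p\<^sup>2} \<noteq> {}" using p2_pos by (simp only: lessThan_empty_iff neq0_conv bot_nat_def)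
    have "pmf (sample_oracle \<pi>) z = pmf (pmf_of_set {..<p\<^sup>2}) i"
      unfolding sample_oracle_def i(2)
      by (rule pmf_map_inj) (use i inj_label[OF \<pi>] ne in \<open>simp_all add: set_pmf_of_set\<close>)
    then have "pmf (sample_oracle \<pi>) z = 1 / real (p\<^sup>2)" using i ne by simp
    then show ?thesis using snoc.IH[OF con]
      by (simp add: uz Sample answer_weight_snoc num_samples_def)
  next
    case (Product a b)
    then have "product_oracle \<pi> a b = z" using snoc.prems unfolding consistent_def uz by auto
    then show ?thesis using snoc.IH[OF con]
      by (simp add: uz Product answer_weight_snoc num_samples_def)
  qed
qed

lemma assign_less:
  assumes "u \<in> PiE (free m) (\<lambda>x. {..<L x})" "\<And>x. L x \<le> card \<Sigma>"
  shows "assign m u z < card \<Sigma>"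
proof (cases "z \<in> free m")
  case True
  then have "u z < L z" using PiE_mem[OF assms(1) True] by simp
  then show ?thesis using True assms(2)[of z] by (simp add: assign_def)
next
  case False
  then show ?thesis using val_less[of "free m" "the (m z)" u] p2_le by (simp add: assign_def)
qed

text \<open>If every known string sits at its assigned index, decoding it evaluates its form, so the
  relations recorded by \<open>explained\<close> become correct product answers. Samples are true
  elements because their range is cut down to \<open>p^2\<close>.\<close>

lemma consistent_if_extends_assign:
  assumes \<pi>: "\<pi> permutes {..<card \<Sigma>}" and inv: "state_inv \<Sigma> c B m" and ex: "explained m h"
    and sam: "sampled h \<subseteq> free m"
    and L: "\<And>x. L x \<le> card \<Sigma>" "\<And>x. x \<in> sampled h \<Longrightarrow> L x = p\<^sup>2"
    and u: "u \<in> PiE (free m) (\<lambda>x. {..<L x})"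
    and ext: "\<And>z. z \<in> dom m \<Longrightarrow> g (\<pi> (assign m u z)) = z"
  shows "consistent \<pi> h"
proof -
  have finf: "finite (free m)"
    using inv fin_\<Sigma> free_subset_dom[of m] finite_subset unfolding state_inv_def by meson
  have lab: "label \<pi> (assign m u z) = z" if "z \<in> dom m" for z
    using ext[OF that] by (simp add: label_def)
  have unlab: "unlabel \<pi> z = val (free m) v u" if "m (norm_str z) = Some v" for z v
  proof -
    have d: "norm_str z \<in> dom m" using that by blast
    have nn: "norm_str (norm_str z) = norm_str z" using norm_str_in by (simp add: norm_str_def)
    have "unlabel \<pi> z = unlabel \<pi> (norm_str z)" by (simp add: unlabel_def nn)
    also have "\<dots> = unlabel \<pi> (label \<pi> (assign m u (norm_str z)))" using lab[OF d] by simp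
    also have "\<dots> = assign m u (norm_str z) mod p\<^sup>2"
      by (rule unlabel_label[OF \<pi> assign_less[OF u L(1)]])
    also have "\<dots> = val (free m) v u" using assign_mod[OF finf] that by simp
    finally show ?thesis .
  qed
  have "z \<in> label \<pi> ` {..<p\<^sup>2}" if "(Sample, z) \<in> set h" for z
  proof -
    have zs: "z \<in> sampled h" using that by (simp add: sampled_def)
    then have zf: "z \<in> free m" using sam by blast
    then have "u z < p\<^sup>2" using PiE_mem[OF u zf] L(2)[OF zs] by simp
    moreover have "label \<pi> (u z) = z" using lab[of z] zf free_subset_dom[of m] by (auto simp: assign_def)
    ultimately show ?thesis by (metis imageI lessThan_iff)
  qed
  moreover have "product_oracle \<pi> a b = z" if mem: "(Product a b, z) \<in> set h" for a b z
  proof -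
    obtain v w where vw: "m (norm_str a) = Some v" "m (norm_str b) = Some w" "m z = Some (form_add v w)"
      using ex mem unfolding explained_def by blast
    have "\<exists>x. v x > 0" "\<exists>x. w x > 0" using inv vw(1,2) unfolding state_inv_def by blast+
    then have "z \<notin> free m" using form_add_neq_unit_form[of v w z] vw(3) by (auto simp: free_def)
    then have "assign m u z = val (free m) (form_add v w) u" using vw(3) by (simp add: assign_def)
    then have "product_oracle \<pi> a b = label \<pi> (assign m u z)"
      unfolding product_oracle_def unlab[OF vw(1)] unlab[OF vw(2)] by (simp add: val_form_add)
    also have "\<dots> = z" using lab[of z] vw(3) by blast
    finally show ?thesis .
  qed
  ultimately show ?thesis unfolding consistent_def by blast
qed

text \<open>Every injective assignment contributes its own set of labellings consistent with
  \<open>h\<close>; each such labelling has likelihood \<open>1 / p^2\<close> to the power of the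
  number of samples. The lost proportion is that of the noninjective assignments.\<close>

lemma sum_answer_weight_ge:
  assumes inv: "state_inv \<Sigma> c B m" and ex: "explained m h"
    and sam: "sampled h \<subseteq> free m" "card (sampled h) = num_samples h" and sep: "separated p m"
  shows "(1 - 2 * real c ^ 2 / real (p\<^sup>2)) * (fact (card \<Sigma>) * state_weight (card \<Sigma>) (num_samples h) m)
    \<le> (\<Sum>\<pi> | \<pi> permutes {..<card \<Sigma>}. answer_weight (\<lambda>_. answer (sample_oracle \<pi>) (product_oracle \<pi>)) h)"
proof -
  define N where "N = card \<Sigma>"
  define n where "n = p\<^sup>2"
  define s where "s = num_samples h"
  define d where "d = card (dom m)"
  \<comment> \<open>A sampled string encodes a true element, whereas a guessed one may have any of
    the \<open>N\<close> indices.\<close>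
  define L where "L x = (if x \<in> sampled h then n else N)" for x
  define U where "U = PiE (free m) (\<lambda>x. {..<L x})"
  define good where "good = {u \<in> U. inj_on (assign m u) (dom m)}"
  define Ext where "Ext u = {\<pi>. \<pi> permutes {..<N} \<and> (\<forall>z\<in>dom m. g (\<pi> (assign m u z)) = z)}" for u
  have nN: "n \<le> N" "n > 0" using p2_le p2_pos by (simp_all add: n_def N_def)
  have L: "L x \<le> N" "p\<^sup>2 \<le> L x" for x using nN by (auto simp: L_def n_def)
  have Ls: "L x = p\<^sup>2" if "x \<in> sampled h" for x using that by (simp add: L_def n_def)
  have findom: "finite (dom m)" using inv fin_\<Sigma> finite_subset unfolding state_inv_def by blast
  have finf: "finite (free m)" using findom free_subset_dom finite_subset by blast
  have finU: "finite U" unfolding U_def using finf by (intro finite_PiE) auto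
  have fins: "finite (sampled h)" using sam finf finite_subset by blast
  have cU: "card U = n ^ s * N ^ (card (free m) - s)"
  proof -
    have "card U = (\<Prod>x\<in>free m. L x)" unfolding U_def using finf by (simp add: card_PiE)
    also have "\<dots> = (\<Prod>x\<in>free m - sampled h. L x) * (\<Prod>x\<in>sampled h. L x)"
      by (rule prod.subset_diff[OF sam(1) finf])
    also have "(\<Prod>x\<in>free m - sampled h. L x) = (\<Prod>x\<in>free m - sampled h. N)"
      by (rule prod.cong) (auto simp: L_def)
    also have "(\<Prod>x\<in>sampled h. L x) = (\<Prod>x\<in>sampled h. n)"
      by (rule prod.cong) (auto simp: L_def)
    finally show ?thesis using sam fins by (simp add: card_Diff_subset s_def)
  qed
  have "U = good \<union> {u \<in> U. \<not> inj_on (assign m u) (dom m)}" unfolding good_def by blast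
  then have "card U \<le> card good + card {u \<in> U. \<not> inj_on (assign m u) (dom m)}"
    using card_Un_le[of good "{u \<in> U. \<not> inj_on (assign m u) (dom m)}"] by simp
  then have "n * card U \<le> n * (card good + card {u \<in> U. \<not> inj_on (assign m u) (dom m)})"
    by (rule mult_le_mono2)
  then have "n * card U \<le> n * card good + n * card {u \<in> U. \<not> inj_on (assign m u) (dom m)}"
    by (simp only: distrib_left)
  also have "\<dots> \<le> n * card good + 2 * c\<^sup>2 * card U"
    using card_noninjective_assignments[of \<Sigma> c B m L, OF inv fin_\<Sigma> sep L(2)] unfolding U_def n_def by simp
  finally have "real (n * card U) \<le> real (n * card good + 2 * c\<^sup>2 * card U)" by (rule of_nat_mono)
  then have "real n * real (card U) \<le> real n * real (card good) + 2 * real c ^ 2 * real (card U)"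
    by (simp only: of_nat_add of_nat_mult of_nat_power of_nat_numeral)
  then have cgood: "(1 - 2 * real c ^ 2 / real n) * real (card U) \<le> real (card good)"
    using nN(2) by (simp add: field_simps)
  have perm: "finite {\<pi>. \<pi> permutes {..<N}}" by (rule finite_permutations) simp
  have finE: "finite (Ext u)" for u unfolding Ext_def by (rule finite_subset[OF _ perm]) blast
  have less: "assign m u z < N" if "u \<in> U" for u z
    unfolding N_def using that L(1) unfolding U_def N_def by (rule assign_less)
  have cE: "fact (N - d) \<le> card (Ext u)" if "u \<in> good" for u
    unfolding Ext_def d_def
  proof (rule fact_le_card_permutations_extending)
    show "bij_betw g {..<N} \<Sigma>" using bij_g by (simp add: N_def)
    show "dom m \<subseteq> \<Sigma>" using inv by (simp add: state_inv_def)
    show "inj_on (assign m u) (dom m)" using that by (simp add: good_def)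
    show "assign m u ` dom m \<subseteq> {..<N}" using that less by (auto simp: good_def)
  qed
  \<comment> \<open>A labelling determines the index of each free string, hence the whole
    assignment.\<close>
  have disj: "Ext u \<inter> Ext u' = {}" if uu: "u \<in> good" "u' \<in> good" "u \<noteq> u'" for u u'
  proof (rule ccontr)
    assume "Ext u \<inter> Ext u' \<noteq> {}"
    then obtain \<pi> where \<pi>: "\<pi> \<in> Ext u" "\<pi> \<in> Ext u'" by blast
    then have perm: "\<pi> permutes {..<N}" by (simp add: Ext_def)
    have "u z = u' z" for z
    proof (cases "z \<in> free m")
      case True
      then have zd: "z \<in> dom m" using free_subset_dom by blast
      have "g (\<pi> (assign m u z)) = z" "g (\<pi> (assign m u' z)) = z"
        using \<pi> zd unfolding Ext_def by blast+
      then have "g (\<pi> (u z)) = g (\<pi> (u' z))" using True by (simp add: assign_def)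
      moreover have "u z < N" "u' z < N"
        using less[of u z] less[of u' z] uu True by (simp_all add: good_def assign_def)
      ultimately show ?thesis
        using bij_label[of \<pi>] perm inj_onD[where f = "g \<circ> \<pi>" and A = "{..<N}" and x = "u z" and y = "u' z"]
        unfolding N_def label_def bij_betw_def by simp
    next
      case False
      then show ?thesis using uu PiE_arb[of u "free m" "\<lambda>x. {..<L x}" z] PiE_arb[of u' "free m" "\<lambda>x. {..<L x}" z]
        unfolding good_def U_def by simp
    qed
    then show False using uu(3) by blast
  qed
  have fing: "finite good" unfolding good_def using finU by simp
  have "card good * fact (N - d) = (\<Sum>u\<in>good. fact (N - d))" by simp
  also have "\<dots> \<le> (\<Sum>u\<in>good. card (Ext u))" using cE by (rule sum_mono)
  also have "\<dots> = card (\<Union>u\<in>good. Ext u)"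
    using fing finE disj by (subst card_UN_disjoint) auto
  also have "\<dots> \<le> card {\<pi>. \<pi> permutes {..<N} \<and> consistent \<pi> h}"
  proof (rule card_mono)
    show "finite {\<pi>. \<pi> permutes {..<N} \<and> consistent \<pi> h}" by (rule finite_subset[OF _ perm]) blast
    show "(\<Union>u\<in>good. Ext u) \<subseteq> {\<pi>. \<pi> permutes {..<N} \<and> consistent \<pi> h}"
    proof
      fix \<pi> assume "\<pi> \<in> (\<Union>u\<in>good. Ext u)"
      then obtain u where u: "u \<in> U" "\<pi> permutes {..<N}" "\<And>z. z \<in> dom m \<Longrightarrow> g (\<pi> (assign m u z)) = z"
        by (auto simp: good_def Ext_def)
      have "consistent \<pi> h"
      proof (rule consistent_if_extends_assign[OF _ inv ex sam(1) _ Ls])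
        show "\<pi> permutes {..<card \<Sigma>}" using u(2) by (simp add: N_def)
        show "L x \<le> card \<Sigma>" for x using L(1) by (simp add: N_def)
        show "u \<in> PiE (free m) (\<lambda>x. {..<L x})" using u(1) by (simp add: U_def)
      qed (assumption, rule u(3))
      then show "\<pi> \<in> {\<pi>. \<pi> permutes {..<N} \<and> consistent \<pi> h}" using u(2) by simp
    qed
  qed
  finally have "real (card good * fact (N - d)) \<le> real (card {\<pi>. \<pi> permutes {..<N} \<and> consistent \<pi> h})"
    by (rule of_nat_mono)
  then have 1: "real (card good) * fact (N - d) \<le> real (card {\<pi>. \<pi> permutes {..<N} \<and> consistent \<pi> h})"
    by simp
  have "(1 - 2 * real c ^ 2 / real n) * (fact N * state_weight N s m)
      = (1 - 2 * real c ^ 2 / real n) * real (card U) * fact (N - d) * (1 / real n) ^ s"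
    unfolding state_weight_def cU d_def[symmetric] using nN(2) by (simp add: power_divide field_simps)
  also have "\<dots> \<le> real (card good) * fact (N - d) * (1 / real n) ^ s"
    using cgood by (intro mult_right_mono) auto
  also have "\<dots> \<le> real (card {\<pi>. \<pi> permutes {..<N} \<and> consistent \<pi> h}) * (1 / real n) ^ s"
    using 1 by (intro mult_right_mono) auto
  also have "\<dots> = (\<Sum>\<pi> | \<pi> permutes {..<N} \<and> consistent \<pi> h. (1 / real n) ^ s)" by simp
  also have "\<dots> = (\<Sum>\<pi> | \<pi> permutes {..<N} \<and> consistent \<pi> h.
      answer_weight (\<lambda>_. answer (sample_oracle \<pi>) (product_oracle \<pi>)) h)"
    by (rule sum.cong) (auto simp: answer_weight_consistent n_def s_def N_def)
  also have "\<dots> \<le> (\<Sum>\<pi> | \<pi> permutes {..<N}. answer_weight (\<lambda>_. answer (sample_oracle \<pi>) (product_oracle \<pi>)) h)"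
    by (rule sum_mono2[OF perm]) (auto intro: answer_weight_nonneg)
  finally show ?thesis unfolding N_def n_def s_def .
qed

end


section \<open>The lower bound\<close>

text \<open>For each pair of known strings, an unlucky prime must divide one fixed nonzero
  coefficient difference of size at most \<open>2 ^ M\<close>; then a union bound over at most
  \<open>c^2\<close> pairs.\<close>

lemma card_nonseparating_primes:
  assumes inv: "state_inv \<Sigma> c (2 ^ M) m" and fin: "finite \<Sigma>" and y: "y \<ge> 2"
  shows "real (card {p \<in> big_primes y. \<not> separated p m}) * log 2 (real y) \<le> real c ^ 2 * (2 * real M)"
proof -
  have findom: "finite (dom m)" using inv fin finite_subset unfolding state_inv_def by blast
  define D where "D = {(z, z') \<in> dom m \<times> dom m. z \<noteq> z'}"
  have finD: "finite D"
    by (rule finite_subset[of _ "dom m \<times> dom m"]) (use findom in \<open>auto simp: D_def\<close>)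
  have lg: "log 2 (real y) \<ge> 0" using y by simp
  define diff where "diff zz x = int (the (m (fst zz)) x) - int (the (m (snd zz)) x)" for zz x
  define C where "C zz = {p \<in> big_primes y. \<forall>x. int p dvd diff zz x}" for zz
  have C: "real (card (C zz)) * log 2 (real y) \<le> 2 * real M" if zz: "zz \<in> D" for zz
  proof -
    obtain z z' where z: "zz = (z, z')" "z \<in> dom m" "z' \<in> dom m" "z \<noteq> z'" using zz D_def by auto
    obtain v w where vw: "m z = Some v" "m z' = Some w" using z by blast
    have "v \<noteq> w" using inv z vw unfolding state_inv_def inj_on_def by metis
    then obtain x where x: "v x \<noteq> w x" by blast
    have d: "diff zz x = int (v x) - int (w x)" unfolding diff_def z by (simp add: vw)
    have "v x \<le> 2 ^ M" "w x \<le> 2 ^ M" using inv vw unfolding state_inv_def by blast+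
    then have "int (v x) \<le> 2 ^ M" "int (w x) \<le> 2 ^ M"
      by (simp_all add: of_nat_le_numeral_power_cancel_iff)
    then have "\<bar>diff zz x\<bar> \<le> 2 ^ M" unfolding d by linarith
    moreover have "diff zz x \<noteq> 0" using x d by simp
    ultimately have "real (card {p \<in> big_primes y. int p dvd diff zz x}) * log 2 (real y) \<le> 2 * real M"
      using y by (intro card_big_prime_divisors)
    moreover have "card (C zz) \<le> card {p \<in> big_primes y. int p dvd diff zz x}"
      by (rule card_mono) (use finite_big_primes in \<open>auto simp: C_def\<close>)
    then have "real (card (C zz)) * log 2 (real y)
        \<le> real (card {p \<in> big_primes y. int p dvd diff zz x}) * log 2 (real y)"
      using lg by (intro mult_right_mono) auto
    ultimately show ?thesis by linarith
  qed
  have "{p \<in> big_primes y. \<not> separated p m} \<subseteq> (\<Union>zz\<in>D. C zz)"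
  proof
    fix p assume "p \<in> {p \<in> big_primes y. \<not> separated p m}"
    then have p: "p \<in> big_primes y" and "\<not> separated p m" by auto
    then obtain z z' where z: "z \<in> dom m" "z' \<in> dom m" "z \<noteq> z'"
      "\<forall>x. int p dvd int (the (m z) x) - int (the (m z') x)"
      unfolding separated_def by blast
    then have "p \<in> C (z, z')" using p by (simp add: C_def diff_def)
    moreover have "(z, z') \<in> D" using z by (simp add: D_def)
    ultimately show "p \<in> (\<Union>zz\<in>D. C zz)" by blast
  qed
  then have "card {p \<in> big_primes y. \<not> separated p m} \<le> card (\<Union>zz\<in>D. C zz)"
    using finD finite_big_primes by (intro card_mono) (auto simp: C_def)
  also have "\<dots> \<le> (\<Sum>zz\<in>D. card (C zz))" using finD by (rule card_UN_le)
  finally have "real (card {p \<in> big_primes y. \<not> separated p m}) \<le> real (\<Sum>zz\<in>D. card (C zz))"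
    by (rule of_nat_mono)
  then have "real (card {p \<in> big_primes y. \<not> separated p m}) * log 2 (real y)
      \<le> real (\<Sum>zz\<in>D. card (C zz)) * log 2 (real y)"
    using lg by (rule mult_right_mono)
  also have "\<dots> = (\<Sum>zz\<in>D. real (card (C zz)) * log 2 (real y))"
    by (simp add: sum_distrib_right)
  also have "\<dots> \<le> (\<Sum>zz\<in>D. 2 * real M)" using C by (rule sum_mono)
  also have "\<dots> = real (card D) * (2 * real M)" by simp
  also have "\<dots> \<le> real c ^ 2 * (2 * real M)"
  proof (rule mult_right_mono)
    have "card D \<le> card (dom m \<times> dom m)" unfolding D_def using findom by (intro card_mono) auto
    also have "\<dots> \<le> c * c"
      using inv unfolding state_inv_def by (simp add: card_cartesian_product mult_le_mono)
    finally have "real (card D) \<le> real (c * c)" by (rule of_nat_mono)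
    then show "real (card D) \<le> real c ^ 2" by (simp add: power2_eq_square)
  qed simp
  finally show ?thesis .
qed

abbreviation oracle_answers :: "nat \<Rightarrow> (nat \<Rightarrow> int \<Rightarrow> int \<Rightarrow> nat) \<Rightarrow> bool list set \<Rightarrow> bool list \<Rightarrow>
    (nat \<Rightarrow> bool list) \<Rightarrow> (nat \<Rightarrow> nat) \<Rightarrow> answers" where
  "oracle_answers p enc \<Sigma> dflt g \<pi> \<equiv> \<lambda>_. answer (group_game.sample_oracle p g \<pi>)
     (group_game.product_oracle p (enc p) \<Sigma> dflt g \<pi>)"

text \<open>At most \<open>3 * M\<close> strings are known. The constant 300 makes
  \<open>18 * M ^ 3\<close> at most \<open>6 / 100 * y\<close>, so at most 12 percent of the primes
  are unlucky. For the others \<open>p\<^sup>2 > y\<close>, so collisions cost at most 6 percent.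
  Finally \<open>88 / 100 * (94 / 100)\<close> exceeds \<open>4 / 5\<close>.\<close>

lemma ideal_answer_weight_le_average:
  assumes gg: "\<And>p. p \<in> big_primes y \<Longrightarrow> group_game p (enc p) (K p) \<Sigma> dflt g"
    and ig: "ideal_game \<Sigma> dflt"
    and y: "y \<ge> 2" "y \<le> card \<Sigma>" "real y \<le> 2 * real (card (big_primes y)) * log 2 (real y)"
    and M: "M \<ge> 1" "300 * M ^ 3 \<le> y" and h: "length h \<le> M"
  shows "4 / 5 * answer_weight (ideal_game.ideal \<Sigma> dflt) h \<le>
    (\<Sum>\<omega>\<in>big_primes y \<times> {\<pi>. \<pi> permutes {..<card \<Sigma>}}.
       1 / (real (card (big_primes y)) * fact (card \<Sigma>)) *
       answer_weight (oracle_answers (fst \<omega>) enc \<Sigma> dflt g (snd \<omega>)) h)"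
proof -
  interpret ideal_game \<Sigma> dflt by (rule ig)
  define N where "N = card \<Sigma>"
  define P where "P = big_primes y"
  define Z where "Z = (\<Sum>\<omega>\<in>P \<times> {\<pi>. \<pi> permutes {..<N}}.
       1 / (real (card P) * fact N) * answer_weight (oracle_answers (fst \<omega>) enc \<Sigma> dflt g (snd \<omega>)) h)"
  have lg: "log 2 (real y) > 0" using y(1) by simp
  have P0: "real (card P) > 0"
  proof (rule ccontr)
    assume "\<not> ?thesis"
    then have "real (card P) = 0" by simp
    then show False using y(1,3) by (simp add: P_def)
  qed
  have finP: "finite P" unfolding P_def by (rule finite_big_primes)
  have Z0: "Z \<ge> 0" unfolding Z_def by (intro sum_nonneg mult_nonneg_nonneg answer_weight_nonneg) simp
  have "4 / 5 * answer_weight ideal h \<le> Z"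
  proof (cases "answer_weight ideal h > 0")
    case False
    then have "answer_weight ideal h = 0" using answer_weight_nonneg[of ideal h] by linarith
    then show ?thesis using Z0 by simp
  next
    case True
    define m where "m = state h"
    define s where "s = num_samples h"
    have "M \<le> M ^ 3" using M(1) by (simp add: self_le_power)
    then have "3 * length h < card \<Sigma>" using M y h by linarith
    from ideal_transcript[OF True this]
    have inv0: "state_inv \<Sigma> (3 * length h) (2 ^ length h) m" and ex: "explained m h"
      and sam: "sampled h \<subseteq> free m" "card (sampled h) = num_samples h"
      and w: "answer_weight ideal h \<le> state_weight N s m"
      unfolding m_def N_def s_def by blast+
    have inv: "state_inv \<Sigma> (3 * M) (2 ^ M) m"
      by (rule state_inv_mono[OF inv0]) (use h in \<open>auto intro: power_increasing\<close>)
    define G where "G = {p \<in> P. separated p m}"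
    define B where "B = {p \<in> P. \<not> separated p m}"
    have GB: "card P = card G + card B"
    proof -
      have "P = G \<union> B" "G \<inter> B = {}" by (auto simp: G_def B_def)
      then show ?thesis using finP card_Un_disjoint[of G B] by (metis finite_Un)
    qed
    have "real (card B) * log 2 (real y) \<le> real (3 * M) ^ 2 * (2 * real M)"
      unfolding B_def P_def by (rule card_nonseparating_primes[OF inv fin_\<Sigma> y(1)])
    also have "\<dots> = 18 * real M ^ 3" by (simp add: power2_eq_square power3_eq_cube)
    also have "\<dots> = 18 / 300 * real (300 * M ^ 3)" by simp
    also have "\<dots> \<le> 18 / 300 * real y" using M(2) by (intro mult_left_mono of_nat_mono) auto
    also have "\<dots> \<le> 18 / 300 * (2 * real (card P) * log 2 (real y))"
      using y(3) unfolding P_def by (intro mult_left_mono) auto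
    finally have "real (card B) * log 2 (real y) \<le> (12 / 100 * real (card P)) * log 2 (real y)"
      by (simp add: algebra_simps)
    then have Bc: "real (card B) \<le> 12 / 100 * real (card P)" using lg by simp
    then have Gc: "real (card G) \<ge> 88 / 100 * real (card P)" using GB by simp
    have sw: "state_weight N s m \<ge> 0" by (rule state_weight_nonneg)
    have each: "94 / 100 * (fact N * state_weight N s m)
        \<le> (\<Sum>\<pi> | \<pi> permutes {..<N}. answer_weight (oracle_answers p enc \<Sigma> dflt g \<pi>) h)"
      if p: "p \<in> G" for p
    proof -
      have pP: "p \<in> P" and sep: "separated p m" using p by (auto simp: G_def)
      interpret group_game p "enc p" "K p" \<Sigma> dflt g using gg pP P_def by blast
      have yp: "real y \<le> real (p\<^sup>2)" using pP unfolding P_def big_primes_def by simp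
      have "2 * real (3 * M) ^ 2 = 18 * real M ^ 2" by (simp add: power2_eq_square)
      also have "\<dots> \<le> 18 * real M ^ 3" using M(1) by (intro mult_left_mono power_increasing) auto
      also have "\<dots> = 6 / 100 * real (300 * M ^ 3)" by simp
      also have "\<dots> \<le> 6 / 100 * real y" using M(2) by (intro mult_left_mono of_nat_mono) auto
      finally have "2 * real (3 * M) ^ 2 \<le> 6 / 100 * real (p\<^sup>2)" using yp by linarith
      then have "2 * real (3 * M) ^ 2 / real (p\<^sup>2) \<le> 6 / 100"
        using p2_pos by (subst pos_divide_le_eq) (simp_all only: of_nat_0_less_iff)
      then have "94 / 100 * (fact N * state_weight N s m)
          \<le> (1 - 2 * real (3 * M) ^ 2 / real (p\<^sup>2)) * (fact N * state_weight N s m)"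
        using sw by (intro mult_right_mono) auto
      also have "\<dots> \<le> (\<Sum>\<pi> | \<pi> permutes {..<N}. answer_weight (oracle_answers p enc \<Sigma> dflt g \<pi>) h)"
        unfolding N_def s_def by (rule sum_answer_weight_ge[OF inv ex sam sep])
      finally show ?thesis .
    qed
    define T where "T p = (\<Sum>\<pi> | \<pi> permutes {..<N}. answer_weight (oracle_answers p enc \<Sigma> dflt g \<pi>) h)" for p
    have "Z = 1 / (real (card P) * fact N) * (\<Sum>\<omega>\<in>P \<times> {\<pi>. \<pi> permutes {..<N}}.
        answer_weight (oracle_answers (fst \<omega>) enc \<Sigma> dflt g (snd \<omega>)) h)"
      unfolding Z_def by (rule sum_distrib_left[symmetric])
    also have "(\<Sum>\<omega>\<in>P \<times> {\<pi>. \<pi> permutes {..<N}}.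
        answer_weight (oracle_answers (fst \<omega>) enc \<Sigma> dflt g (snd \<omega>)) h) = (\<Sum>p\<in>P. T p)"
      unfolding T_def by (simp add: sum.cartesian_product case_prod_beta)
    finally have Z: "Z = 1 / (real (card P) * fact N) * (\<Sum>p\<in>P. T p)" .
    have "real (card G) * (94 / 100 * (fact N * state_weight N s m))
        = (\<Sum>p\<in>G. 94 / 100 * (fact N * state_weight N s m))" by simp
    also have "\<dots> \<le> (\<Sum>p\<in>G. T p)" unfolding T_def by (rule sum_mono) (rule each)
    also have "\<dots> \<le> (\<Sum>p\<in>P. T p)"
      by (rule sum_mono2[OF finP]) (auto simp: G_def T_def intro!: sum_nonneg answer_weight_nonneg)
    finally have 1: "real (card G) * (94 / 100 * (fact N * state_weight N s m)) \<le> (\<Sum>p\<in>P. T p)" .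
    have "88 / 100 * real (card P) * (94 / 100 * (fact N * state_weight N s m))
        \<le> real (card G) * (94 / 100 * (fact N * state_weight N s m))"
      using Gc sw by (intro mult_right_mono) auto
    also note 1
    also have "88 / 100 * real (card P) * (94 / 100 * (fact N * state_weight N s m))
        = real (card P) * fact N * (88 / 100 * (94 / 100) * state_weight N s m)"
      by (simp only: ac_simps)
    finally have 2: "real (card P) * fact N * (88 / 100 * (94 / 100) * state_weight N s m) \<le> (\<Sum>p\<in>P. T p)" .
    have "4 / 5 * answer_weight ideal h \<le> 88 / 100 * (94 / 100) * state_weight N s m"
      using w sw by simp
    also have "\<dots> \<le> Z"
      unfolding Z using 2 P0 by (simp add: field_simps)
    finally show ?thesis .
  qed
  then show ?thesis unfolding Z_def P_def N_def .
qed

lemma finite_bitstrings: "finite (bitstrings q)"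
  and card_bitstrings: "card (bitstrings q) = 2 ^ nat \<lceil>log 2 (real q)\<rceil>"
proof -
  have "bitstrings q = {xs. set xs \<subseteq> UNIV \<and> length xs = nat \<lceil>log 2 (real q)\<rceil>}"
    by (simp add: bitstrings_def)
  then show "finite (bitstrings q)" "card (bitstrings q) = 2 ^ nat \<lceil>log 2 (real q)\<rceil>"
    using finite_lists_length_eq[of "UNIV :: bool set"] card_lists_length_eq[of "UNIV :: bool set"] by auto
qed

lemma le_card_bitstrings:
  assumes "q \<ge> 1"
  shows "q \<le> card (bitstrings q)"
proof -
  have "real q = 2 powr log 2 (real q)" using assms by simp
  also have "\<dots> \<le> 2 powr real (nat \<lceil>log 2 (real q)\<rceil>)"
    by (rule powr_mono) (simp_all add: real_nat_ceiling_ge)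
  also have "\<dots> = real (2 ^ nat \<lceil>log 2 (real q)\<rceil>)" by (simp add: powr_realpow)
  finally show ?thesis unfolding card_bitstrings by (simp only: of_nat_le_iff)
qed

lemma tester_mono:
  assumes "tester far \<epsilon> cyclic_group A" "far = hamming_far \<or> far = edit_far" "\<epsilon> \<le> \<delta>"
    and "table_far \<delta> \<Gamma> f" "magma \<Gamma> f" "binary_structure \<Gamma> f q O\<^sub>1 O\<^sub>2"
  shows "output_prob (A q) O\<^sub>1 O\<^sub>2 FAIL \<ge> 2 / 3"
proof -
  have "\<epsilon> * real (card \<Gamma>) ^ 2 \<le> \<delta> * real (card \<Gamma>) ^ 2" using assms(3) by (intro mult_right_mono) auto
  then have "table_far \<epsilon> \<Gamma> f" using assms(4) unfolding table_far_def by (meson order_trans)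
  then have "far \<epsilon> cyclic_group \<Gamma> f"
    using assms(2,5) table_far_imp_hamming_far table_far_imp_edit_far by blast
  then show ?thesis using assms(1,5,6) unfolding tester_def by blast
qed

text \<open>Otherwise the ideal run would have total mass 1, while 4/5 of its mass is at most
  \<open>1/3 + 1/3 + 0\<close>: FAIL is bounded through the cyclic groups, PASS through the
  products, and not having halted through the query bound.\<close>

lemma tester_query_bound:
  assumes t: "tester far \<epsilon> cyclic_group A" "far = hamming_far \<or> far = edit_far" "\<epsilon> \<le> 1 / 23"
    and y: "y \<ge> 2" "y\<^sup>2 \<le> q" "real y \<le> 2 * real (card (big_primes y)) * log 2 (real y)"
    and K: "query_complexity A q \<le> enat K"
  shows "y < 300 * Suc K ^ 3"
proof (rule ccontr)
  assume "\<not> ?thesis"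
  then have yK: "300 * Suc K ^ 3 \<le> y" by simp
  \<comment> \<open>One step for each of at most \<open>K\<close> queries, and one for
    halting.\<close>
  define M where "M = Suc K"
  define \<Sigma> where "\<Sigma> = bitstrings q"
  define N where "N = card \<Sigma>"
  define dflt where "dflt = replicate (nat \<lceil>log 2 (real q)\<rceil>) False"
  define g where "g = from_nat_into \<Sigma>"
  define P where "P = big_primes y"
  define \<Omega> where "\<Omega> = P \<times> {\<pi>. \<pi> permutes {..<N}}"
  have "1 \<le> y\<^sup>2" using y(1) by simp
  then have q1: "q \<ge> 1" using y(2) by linarith
  have qN: "q \<le> N" using le_card_bitstrings[OF q1] by (simp add: N_def \<Sigma>_def)
  have "y \<le> y\<^sup>2" using y(1) by (simp add: self_le_power)
  then have yN: "y \<le> card \<Sigma>" using y(2) qN N_def by linarith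
  have fin: "finite \<Sigma>" unfolding \<Sigma>_def by (rule finite_bitstrings)
  have ig: "ideal_game \<Sigma> dflt"
    by (rule ideal_game.intro) (simp_all add: fin, simp add: \<Sigma>_def dflt_def bitstrings_def)
  have bij: "bij_betw g {..<card \<Sigma>} \<Sigma>" unfolding g_def using fin by (rule bij_betw_from_nat_into_finite)
  have p2q: "p\<^sup>2 \<le> q" if "p \<in> P" for p
  proof -
    have "p\<^sup>2 \<le> y\<^sup>2" using that unfolding P_def big_primes_def by (intro power_mono) auto
    then show ?thesis using y(2) by linarith
  qed
  have primeP: "prime p" if "p \<in> P" for p using that by (simp add: P_def big_primes_def)
  have gg: "group_game p enc L \<Sigma> dflt g" if "p \<in> P" "pair_group p enc L" for p enc L
  proof (rule group_game.intro[OF that(2) ig])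
    show "group_game_axioms p \<Sigma> g"
      by (rule group_game_axioms.intro[OF bij]) (use p2q[OF that(1)] qN N_def in linarith)
  qed
  have ggc: "group_game p (cyclic_enc p) (\<lambda>a b. (int p)\<^sup>2 dvd a + int p * b) \<Sigma> dflt g" if "p \<in> P" for p
    using that by (intro gg pair_group_cyclic primeP)
  have ggp: "group_game p (product_enc p) (\<lambda>a b. int p dvd a \<and> int p dvd b) \<Sigma> dflt g" if "p \<in> P" for p
    using that by (intro gg pair_group_product primeP)
  define c where "c = 1 / (real (card P) * fact N)"
  have c0: "c \<ge> 0" by (simp add: c_def)
  have P0: "card P > 0"
  proof (rule ccontr)
    assume "\<not> ?thesis"
    then show False using y(1,3) by (simp add: P_def)
  qed
  have finP: "finite P" unfolding P_def by (rule finite_big_primes)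
  have fin\<Omega>: "finite \<Omega>" unfolding \<Omega>_def using finP finite_permutations[of "{..<N}"] by simp
  have "card \<Omega> = card P * fact N"
    unfolding \<Omega>_def by (simp add: card_cartesian_product card_permutations)
  then have c\<Omega>: "real (card \<Omega>) * c = 1" unfolding c_def using P0 by simp
  define Id where "Id = run_adaptive (A q) (ideal_game.ideal \<Sigma> dflt) M"
  \<comment> \<open>A bound valid for every prime and labelling passes to the ideal game, since the
    weights \<open>c\<close> sum to 1. Keeping \<open>enc\<close> general lets both families of
    groups be compared with the same game.\<close>
  have avg: "4 / 5 * measure_pmf.prob Id S \<le> b"
    if G: "\<And>p. p \<in> P \<Longrightarrow> group_game p (enc p) (L p) \<Sigma> dflt g"
      and b: "\<And>p \<pi>. p \<in> P \<Longrightarrow> \<pi> permutes {..<N} \<Longrightarrow>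
        measure_pmf.prob (run_adaptive (A q) (oracle_answers p enc \<Sigma> dflt g \<pi>) M) S \<le> b"
    for enc L S b
  proof -
    have "4 / 5 * measure_pmf.prob Id S \<le> (\<Sum>\<omega>\<in>\<Omega>. c *
        measure_pmf.prob (run_adaptive (A q) (oracle_answers (fst \<omega>) enc \<Sigma> dflt g (snd \<omega>)) M) S)"
      unfolding Id_def
    proof (rule prob_run_adaptive_le_average[OF fin\<Omega>])
      fix h :: transcript assume h: "length h \<le> M"
      show "4 / 5 * answer_weight (ideal_game.ideal \<Sigma> dflt) h \<le> (\<Sum>\<omega>\<in>\<Omega>. c *
          answer_weight (oracle_answers (fst \<omega>) enc \<Sigma> dflt g (snd \<omega>)) h)"
        unfolding \<Omega>_def P_def N_def c_def
        by (rule ideal_answer_weight_le_average[OF _ ig y(1) yN y(3) _ _ h])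
          (use G yK in \<open>simp_all add: P_def M_def\<close>)
    qed (use c0 in simp_all)
    also have "\<dots> \<le> (\<Sum>\<omega>\<in>\<Omega>. c * b)"
      by (rule sum_mono, rule mult_left_mono[OF b c0]) (auto simp: \<Omega>_def)
    also have "\<dots> = (real (card \<Omega>) * c) * b" by simp
    finally show ?thesis unfolding c\<Omega> by simp
  qed
  have bound: "num_queries d \<le> K"
    if "magma \<Gamma> f" "binary_structure \<Gamma> f q O\<^sub>1 O\<^sub>2" "d \<in> set_pmf (run (A q) O\<^sub>1 O\<^sub>2 n)" for \<Gamma> f O\<^sub>1 O\<^sub>2 d n
  proof -
    have "enat (num_queries d) \<le> query_complexity A q"
      unfolding query_complexity_def by (rule Sup_upper) (use that in blast)
    then have "enat (num_queries d) \<le> enat K" using K by (rule order_trans)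
    then show ?thesis by simp
  qed
  have compl: "measure_pmf.prob (run A' O\<^sub>1 O\<^sub>2 n) {Halted h v' |h. True} \<le> 1 / 3"
    if "v \<noteq> v'" "measure_pmf.prob (run A' O\<^sub>1 O\<^sub>2 n) {Halted h v |h. True} \<ge> 2 / 3" for A' O\<^sub>1 O\<^sub>2 n v v'
  proof -
    let ?p = "run A' O\<^sub>1 O\<^sub>2 n"
    have "measure_pmf.prob ?p {Halted h v |h. True} + measure_pmf.prob ?p {Halted h v' |h. True}
        = measure_pmf.prob ?p ({Halted h v |h. True} \<union> {Halted h v' |h. True})"
      by (rule measure_pmf.finite_measure_Union[symmetric]) (use that(1) in auto)
    also have "\<dots> \<le> 1" by (rule measure_pmf.prob_le_1)
    finally show ?thesis using that(2) by linarith
  qed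
  have fail: "4 / 5 * measure_pmf.prob Id {Halted h FAIL |h. True} \<le> 1 / 3"
  proof (rule avg[OF ggc])
    fix p \<pi> assume p: "p \<in> P" and \<pi>: "\<pi> permutes {..<N}"
    interpret group_game p "cyclic_enc p" "\<lambda>a b. (int p)\<^sup>2 dvd a + int p * b" \<Sigma> dflt g
      by (rule ggc[OF p])
    have bs: "binary_structure {..<p\<^sup>2} op q (sample_oracle \<pi>) (product_oracle \<pi>)"
      using \<pi> p2q[OF p] by (intro binary_structure_oracles) (simp_all add: N_def \<Sigma>_def)
    have "group_in cyclic_group {..<p\<^sup>2} op"
      using group_in_cyclic_op[OF primeP[OF p]] by (simp add: cyclic_op_def)
    then have "2 / 3 \<le> output_prob (A q) (sample_oracle \<pi>) (product_oracle \<pi>) PASS"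
      using t(1) magma_op bs unfolding tester_def by blast
    also have "\<dots> \<le> measure_pmf.prob (run (A q) (sample_oracle \<pi>) (product_oracle \<pi>) (Suc K)) {Halted h PASS |h. True}"
      by (rule output_prob_le_run) (rule bound[OF magma_op bs])
    finally have "measure_pmf.prob (run (A q) (sample_oracle \<pi>) (product_oracle \<pi>) M) {Halted h FAIL |h. True} \<le> 1 / 3"
      unfolding M_def by (rule compl[rotated]) simp
    then show "measure_pmf.prob (run_adaptive (A q) (oracle_answers p cyclic_enc \<Sigma> dflt g \<pi>) M)
        {Halted h FAIL |h. True} \<le> 1 / 3"
      by (simp only: run_conv_run_adaptive)
  qed
  have pass: "4 / 5 * measure_pmf.prob Id {Halted h PASS |h. True} \<le> 1 / 3"
  proof (rule avg[OF ggp])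
    fix p \<pi> assume p: "p \<in> P" and \<pi>: "\<pi> permutes {..<N}"
    interpret group_game p "product_enc p" "\<lambda>a b. int p dvd a \<and> int p dvd b" \<Sigma> dflt g
      by (rule ggp[OF p])
    have bs: "binary_structure {..<p\<^sup>2} op q (sample_oracle \<pi>) (product_oracle \<pi>)"
      using \<pi> p2q[OF p] by (intro binary_structure_oracles) (simp_all add: N_def \<Sigma>_def)
    have "table_far (1 / 23) {..<p\<^sup>2} op"
      using product_op_table_far[OF primeP[OF p]] by (simp add: product_op_def)
    from tester_mono[OF t this magma_op bs]
    have "2 / 3 \<le> output_prob (A q) (sample_oracle \<pi>) (product_oracle \<pi>) FAIL" .
    also have "\<dots> \<le> measure_pmf.prob (run (A q) (sample_oracle \<pi>) (product_oracle \<pi>) (Suc K)) {Halted h FAIL |h. True}"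
      by (rule output_prob_le_run) (rule bound[OF magma_op bs])
    finally have "measure_pmf.prob (run (A q) (sample_oracle \<pi>) (product_oracle \<pi>) M) {Halted h PASS |h. True} \<le> 1 / 3"
      unfolding M_def by (rule compl[rotated]) simp
    then show "measure_pmf.prob (run_adaptive (A q) (oracle_answers p product_enc \<Sigma> dflt g \<pi>) M)
        {Halted h PASS |h. True} \<le> 1 / 3"
      by (simp only: run_conv_run_adaptive)
  qed
  have running: "4 / 5 * measure_pmf.prob Id {Running h |h. True} \<le> 0"
  proof (rule avg[OF ggc])
    fix p \<pi> assume p: "p \<in> P" and \<pi>: "\<pi> permutes {..<N}"
    interpret group_game p "cyclic_enc p" "\<lambda>a b. (int p)\<^sup>2 dvd a + int p * b" \<Sigma> dflt g
      by (rule ggc[OF p])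
    have bs: "binary_structure {..<p\<^sup>2} op q (sample_oracle \<pi>) (product_oracle \<pi>)"
      using \<pi> p2q[OF p] by (intro binary_structure_oracles) (simp_all add: N_def \<Sigma>_def)
    let ?p = "run (A q) (sample_oracle \<pi>) (product_oracle \<pi>) M"
    have "Running h \<notin> set_pmf ?p" for h
    proof
      assume r: "Running h \<in> set_pmf ?p"
      then have "length h \<le> K" using bound[OF magma_op bs r] by simp
      moreover have "pmf ?p (Running h) \<noteq> 0" using r by (simp add: set_pmf_iff)
      then have "length h = M"
        unfolding run_conv_run_adaptive pmf_run_adaptive_Running by (simp split: if_splits)
      ultimately show False by (simp add: M_def)
    qed
    then have "set_pmf ?p \<inter> {Running h |h. True} = {}" by blast
    then have "measure_pmf.prob ?p {Running h |h. True} = 0" by (simp add: measure_pmf_zero_iff)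
    then show "measure_pmf.prob (run_adaptive (A q) (oracle_answers p cyclic_enc \<Sigma> dflt g \<pi>) M)
        {Running h |h. True} \<le> 0"
      by (simp only: run_conv_run_adaptive)
  qed
  have "d \<in> {Halted h FAIL |h. True} \<union> {Halted h PASS |h. True} \<union> {Running h |h. True}" for d
  proof (cases d)
    case (Halted h v)
    then show ?thesis by (cases v) auto
  qed auto
  then have "{Halted h FAIL |h. True} \<union> {Halted h PASS |h. True} \<union> {Running h |h. True} = (UNIV :: config set)"
    by blast
  then have "1 = measure_pmf.prob Id ({Halted h FAIL |h. True} \<union> {Halted h PASS |h. True} \<union> {Running h |h. True})"
    by simp
  also have "\<dots> \<le> measure_pmf.prob Id ({Halted h FAIL |h. True} \<union> {Halted h PASS |h. True})
      + measure_pmf.prob Id {Running h |h. True}"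
    by (rule measure_Un_le) simp_all
  also have "\<dots> \<le> measure_pmf.prob Id {Halted h FAIL |h. True} + measure_pmf.prob Id {Halted h PASS |h. True}
      + measure_pmf.prob Id {Running h |h. True}"
    by (rule add_right_mono, rule measure_Un_le) simp_all
  finally show False using fail pass running by linarith
qed

theorem theorem1:
  shows "\<exists>c>0. \<exists>q\<^sub>0. \<forall>\<epsilon> A. 0 < \<epsilon> \<and> \<epsilon> \<le> 1 / 23 \<and>
           (tester hamming_far \<epsilon> cyclic_group A \<or> tester edit_far \<epsilon> cyclic_group A) \<longrightarrow>
           (\<forall>q\<ge>q\<^sub>0. ereal (c * real q powr (1 / 6)) \<le> ereal_of_enat (query_complexity A q))"
proof -
  obtain y\<^sub>0 where y0: "\<And>y. y \<ge> y\<^sub>0 \<Longrightarrow> real y \<le> 2 * real (card (big_primes y)) * log 2 (real y)"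
    using card_big_primes_ge by blast
  \<comment> \<open>With \<open>1 / 20\<close> the additive 1 in \<open>Suc K\<close> is absorbed by
    passing to \<open>1 / 10\<close>; then \<open>300 / 1000 * sqrt x\<close> stays below
    \<open>sqrt x - 1\<close>, which is less than \<open>y\<close>.\<close>
  have "eventually (\<lambda>x::real. 1 / 20 * x powr (1 / 6) + 1 \<le> 1 / 10 * x powr (1 / 6)) at_top"
    and "eventually (\<lambda>x::real. 300 / 1000 * sqrt x < sqrt x - 1) at_top" by real_asymp+
  then have "eventually (\<lambda>x::real. 300 * (1 / 20 * x powr (1 / 6) + 1) ^ 3 < sqrt x - 1) at_top"
    using eventually_gt_at_top[of 0]
  proof eventually_elim
    case (elim x)
    have "(x powr (1 / 6)) ^ 3 = x powr (1 / 6 * 3)" using elim(3) by (simp add: powr_powr flip: powr_realpow)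
    then have cube: "(x powr (1 / 6)) ^ 3 = sqrt x" using elim(3) by (simp add: powr_half_sqrt)
    have "300 * (1 / 20 * x powr (1 / 6) + 1) ^ 3 \<le> 300 * (1 / 10 * x powr (1 / 6)) ^ 3"
      using elim(1) by (intro mult_left_mono power_mono) auto
    also have "\<dots> = 300 / 1000 * sqrt x" unfolding power_mult_distrib cube by (simp add: power3_eq_cube)
    finally show ?case using elim(2) by linarith
  qed
  moreover have "eventually (\<lambda>x::real. sqrt x \<ge> real (max 2 y\<^sub>0) + 1) at_top" by real_asymp
  ultimately have "eventually (\<lambda>x::real. 300 * (1 / 20 * x powr (1 / 6) + 1) ^ 3 < sqrt x - 1 \<and>
      sqrt x \<ge> real (max 2 y\<^sub>0) + 1) at_top" by (rule eventually_conj)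
  then obtain x0 where x0: "\<And>x. x \<ge> x0 \<Longrightarrow> 300 * (1 / 20 * x powr (1 / 6) + 1) ^ 3 < sqrt x - 1 \<and>
      sqrt x \<ge> real (max 2 y\<^sub>0) + 1"
    unfolding eventually_at_top_linorder by blast
  have "ereal (1 / 20 * real q powr (1 / 6)) \<le> ereal_of_enat (query_complexity A q)"
    if \<epsilon>: "\<epsilon> \<le> 1 / 23" and t: "tester hamming_far \<epsilon> cyclic_group A \<or> tester edit_far \<epsilon> cyclic_group A"
      and q: "q \<ge> nat \<lceil>x0\<rceil>" for \<epsilon> A q
  proof (rule ccontr)
    assume neg: "\<not> ?thesis"
    then obtain K where K: "query_complexity A q = enat K"
      by (cases "query_complexity A q") auto
    with neg have Kq: "real K < 1 / 20 * real q powr (1 / 6)" by simp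
    have "real q \<ge> x0" using q by linarith
    note x = x0[OF this]
    \<comment> \<open>The largest \<open>y\<close> with \<open>y\<^sup>2 \<le> q\<close>, so that
      groups of order \<open>p^2\<close> with \<open>p \<le> y\<close> are admissible.\<close>
    define y where "y = nat \<lfloor>sqrt (real q)\<rfloor>"
    have fl: "real y \<le> sqrt (real q)" "sqrt (real q) - 1 < real y"
      unfolding y_def by (simp_all add: of_nat_floor)
    have "real y > real (max 2 y\<^sub>0)" using x fl by linarith
    then have y2: "y \<ge> 2" "y \<ge> y\<^sub>0" by simp_all
    have "(real y)\<^sup>2 \<le> (sqrt (real q))\<^sup>2" using fl(1) by (intro power_mono) auto
    then have "real (y\<^sup>2) \<le> real q" by simp
    then have yq: "y\<^sup>2 \<le> q" by (simp only: of_nat_le_iff)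
    obtain far where far: "tester far \<epsilon> cyclic_group A" "far = hamming_far \<or> far = edit_far"
      using t by blast
    have "y < 300 * Suc K ^ 3"
      by (rule tester_query_bound[OF far \<epsilon> y2(1) yq y0[OF y2(2)]]) (simp add: K)
    then have "real y < real (300 * Suc K ^ 3)" by (rule of_nat_less_iff[THEN iffD2])
    also have "\<dots> = 300 * (real K + 1) ^ 3" by (simp add: add.commute)
    also have "\<dots> \<le> 300 * (1 / 20 * real q powr (1 / 6) + 1) ^ 3"
      using Kq by (intro mult_left_mono power_mono) auto
    also have "\<dots> < sqrt (real q) - 1" using x by blast
    finally show False using fl(2) by linarith
  qed
  then show ?thesis by (intro exI[of _ "1 / 20"] conjI exI[of _ "nat \<lceil>x0\<rceil>"]) auto
qed

end
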